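(* Let $1<p,r<\infty$. There is a constant $C$, depending only on $n,p,r$, such that for every $\kappa\in\mathbb{N}$, every vector-valued Haar-shift operator $\mathcal{S}_r$ of complexity $\kappa$ on $\mathbb{R}^n$, and every weight $w\in A_p$, $$\|\mathcal{S}_r\|_{L^p_{\ell^r}(w)\to L^p(w)}\le C\,\kappa^4\,[w]_{A_p}^{\max\{1,\frac1{p-1}\}}.$$
   Context: $\mathbb{N}=\{1,2,\dots\}$. $\mathcal{D}=\{2^{-k}([0,1)^n+m):k\in\mathbb{Z},m\in\mathbb{Z}^n\}$ is the standard dyadic grid; $\ell(I)$ is the side length and $|I|$ the volume of a cube $I$. A generalized Haar shift operator of complexity $\kappa$ is an operator of the form $Sf=\sum_{I\in\mathcal{D}}S_If$, $S_If=\langle f,k_I\rangle h_I$, where $\langle f,g\rangle=\int fg\,dx$, the functions $h_I,k_I$ are supported on $I$ and constant on the dyadic subcubes of $I$ of side length $2^{-\kappa}\ell(I)$, $\|h_I\|_\infty\|k_I\|_\infty\le|I|^{-1}$, and $S$ is bounded on $L^2(\mathbb{R}^n)$ with norm at most $1$. The series is understood as the limit, as $N\to\infty$, of $\sum_{2^{-N}\le\ell(I)\le2^N}S_If$: for $f\in L^2$ the limit is assumed to exist in $L^2$, and for general $f\in L^1_{\rm loc}(\mathbb{R}^n)$, $Sf$ is said to be defined if the limit exists in measure on bounded sets. Given a sequence $\{S^j\}_{j\ge1}$ of generalized Haar shift operators of complexity $\kappa$, the associated vector-valued Haar-shift operator of complexity $\kappa$ is $$\mathcal{S}_r\mathbf{f}(x)=\Big(\sum_{j=1}^\infty|S^jf_j(x)|^r\Big)^{1/r},\qquad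 \mathbf{f}=\{f_j\},\ f_j\in L^1_{\rm loc}(\mathbb{R}^n),$$ for those $\mathbf{f}$ for which all $S^jf_j$ are defined. A weight is an a.e. positive locally integrable function $w$; $w\in A_p$ means $[w]_{A_p}=\sup_Q\big(\frac1{|Q|}\int_Qw\big)\big(\frac1{|Q|}\int_Qw^{-1/(p-1)}\big)^{p-1}<\infty$, the supremum over all cubes $Q\subset\mathbb{R}^n$. $L^p_{\ell^r}(w)$ consists of sequences $\mathbf{f}=\{f_j\}$ of measurable functions with $\|\mathbf{f}\|_{L^p_{\ell^r}(w)}=\big(\int\|\mathbf{f}(x)\|_{\ell^r}^pw(x)\,dx\big)^{1/p}<\infty$, where $\|\mathbf{f}(x)\|_{\ell^r}=(\sum_j|f_j(x)|^r)^{1/r}$. The norm $\|\mathcal{S}_r\|_{L^p_{\ell^r}(w)\to L^p(w)}$ is the least $A$ with $\|\mathcal{S}_r\mathbf{f}\|_{L^p(w)}\le A\|\mathbf{f}\|_{L^p_{\ell^r}(w)}$ for all $\mathbf{f}\in L^p_{\ell^r}(w)$ for which $\mathcal{S}_r\mathbf{f}$ is defined. *)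

theory Defs
  imports "HOL-Analysis.Analysis"
begin

text \<open>Functions on \<open>\<real>\<^sup>n\<close> are real-valued and all integrals are with respect to Lebesgue measure.
  Powers and norms that may be infinite take values in \<^typ>\<open>ennreal\<close>.\<close>

text \<open>Only used with exponents \<open>a > 0\<close>, so that \<open>0\<close> and \<open>\<infinity>\<close> are mapped to themselves.\<close>
definition ennpow :: "ennreal \<Rightarrow> real \<Rightarrow> ennreal" where
  "ennpow x a = (if x = \<infinity> then \<infinity> else ennreal (enn2real x powr a))"

definition locally_integrable :: "(real^'n \<Rightarrow> real) \<Rightarrow> bool" where
  "locally_integrable f \<longleftrightarrow>
     f \<in> borel_measurable lebesgue \<and> (\<forall>K. compact K \<longrightarrow> set_integrable lebesgue K f)"


subsection \<open>The standard dyadic grid\<close>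

definition dyadic_cube :: "int \<Rightarrow> int^'n \<Rightarrow> (real^'n) set" where
  "dyadic_cube j m =
     (\<lambda>x. (2 powi (- j)) *\<^sub>R (x + (\<chi> i. real_of_int (m $ i)))) ` {x. \<forall>i. 0 \<le> x $ i \<and> x $ i < 1}"

text \<open>The dyadic cubes of side length \<open>2\<^sup>-\<^sup>j\<close>; the grid is the disjoint union of these sets over
  \<open>j \<in> \<int>\<close>.\<close>
definition dyadic_gen :: "int \<Rightarrow> (real^'n) set set" where
  "dyadic_gen j = range (dyadic_cube j)"


subsection \<open>Weights and weighted norms\<close>

definition weight :: "(real^'n \<Rightarrow> real) \<Rightarrow> bool" where
  "weight w \<longleftrightarrow> locally_integrable w \<and> (AE x in lebesgue. 0 < w x)"

definition cube :: "real^'n \<Rightarrow> real \<Rightarrow> (real^'n) set" where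
  "cube a s = cbox a (\<chi> i. a $ i + s)"

definition average :: "(real^'n) set \<Rightarrow> (real^'n \<Rightarrow> real) \<Rightarrow> ennreal" where
  "average Q v = (\<integral>\<^sup>+x\<in>Q. ennreal (v x) \<partial>lebesgue) / emeasure lebesgue Q"

definition Ap_char :: "real \<Rightarrow> (real^'n \<Rightarrow> real) \<Rightarrow> ennreal" where
  "Ap_char p w = (SUP (a, s) \<in> UNIV \<times> {0<..}.
     average (cube a s) w * ennpow (average (cube a s) (\<lambda>x. w x powr (- 1 / (p - 1)))) (p - 1))"

definition Ap_weights :: "real \<Rightarrow> (real^'n \<Rightarrow> real) set" where
  "Ap_weights p = {w. weight w \<and> Ap_char p w < \<infinity>}"

text \<open>The argument is the absolute value of the function whose norm is taken; it is allowed to be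
  infinite because \<open>\<S>\<^sub>r\<close> is.\<close>
definition Lp_norm :: "real \<Rightarrow> (real^'n \<Rightarrow> real) \<Rightarrow> (real^'n \<Rightarrow> ennreal) \<Rightarrow> ennreal" where
  "Lp_norm p w F = ennpow (\<integral>\<^sup>+x. ennpow (F x) p * ennreal (w x) \<partial>lebesgue) (1 / p)"

text \<open>Sequences \<open>(a\<^sub>j)\<close>, \<open>j \<ge> 1\<close>, are indexed by \<^typ>\<open>nat\<close>, starting from \<open>0\<close>.\<close>
definition lr_norm :: "real \<Rightarrow> (nat \<Rightarrow> real) \<Rightarrow> ennreal" where
  "lr_norm r a = ennpow (\<Sum>j. ennreal (\<bar>a j\<bar> powr r)) (1 / r)"

definition Lp_lr_norm ::
    "real \<Rightarrow> real \<Rightarrow> (real^'n \<Rightarrow> real) \<Rightarrow> (nat \<Rightarrow> real^'n \<Rightarrow> real) \<Rightarrow> ennreal" where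
  "Lp_lr_norm p r w f = Lp_norm p w (\<lambda>x. lr_norm r (\<lambda>j. f j x))"

definition Lp_lr ::
    "real \<Rightarrow> real \<Rightarrow> (real^'n \<Rightarrow> real) \<Rightarrow> (nat \<Rightarrow> real^'n \<Rightarrow> real) set" where
  "Lp_lr p r w = {f. (\<forall>j. f j \<in> borel_measurable lebesgue) \<and> Lp_lr_norm p r w f < \<infinity>}"

definition L2_norm :: "(real^'n \<Rightarrow> real) \<Rightarrow> ennreal" where
  "L2_norm f = Lp_norm 2 (\<lambda>_. 1) (\<lambda>x. ennreal \<bar>f x\<bar>)"

definition L2 :: "(real^'n \<Rightarrow> real) set" where
  "L2 = {f. f \<in> borel_measurable lebesgue \<and> L2_norm f < \<infinity>}"


subsection \<open>Generalized Haar shifts\<close>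

text \<open>A Haar shift is given by its families of functions \<open>h\<^sub>I\<close>, \<open>k\<^sub>I\<close>, of which only the values at
  dyadic cubes \<open>I\<close> matter.\<close>
type_synonym 'n cube_family = "(real^'n) set \<Rightarrow> real^'n \<Rightarrow> real"

definition pairing :: "(real^'n \<Rightarrow> real) \<Rightarrow> (real^'n \<Rightarrow> real) \<Rightarrow> real" where
  "pairing f g = (\<integral>x. f x * g x \<partial>lebesgue)"

text \<open>The sum of \<open>S\<^sub>I f\<close> over the dyadic cubes with \<open>2\<^sup>-\<^sup>N \<le> \<ell>(I) \<le> 2\<^sup>N\<close>. When \<open>h\<^sub>I\<close> is supported on
  \<open>I\<close>, at most \<open>2 N + 1\<close> terms are nonzero at each point \<open>x\<close>.\<close>
definition haar_partial ::
    "'n::finite cube_family \<Rightarrow> 'n cube_family \<Rightarrow> nat \<Rightarrow> (real^'n \<Rightarrow> real) \<Rightarrow> real^'n \<Rightarrow> real" where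
  "haar_partial h k N f x =
     (\<Sum>\<^sub>\<infinity>I\<in>(\<Union>j\<in>{- int N..int N}. dyadic_gen j). pairing f (k I) * h I x)"

text \<open>\<open>g\<close> is (a representative of) the limit \<open>S f\<close> in measure on bounded sets.\<close>
definition haar_value ::
    "'n::finite cube_family \<Rightarrow> 'n cube_family \<Rightarrow> (real^'n \<Rightarrow> real) \<Rightarrow> (real^'n \<Rightarrow> real) \<Rightarrow> bool" where
  "haar_value h k f g \<longleftrightarrow> g \<in> borel_measurable lebesgue \<and>
     (\<forall>B\<in>sets lebesgue. bounded B \<longrightarrow> (\<forall>\<epsilon>>0.
        (\<lambda>N. emeasure lebesgue {x\<in>B. \<bar>haar_partial h k N f x - g x\<bar> > \<epsilon>}) \<longlonglongrightarrow> 0))"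

text \<open>Here \<open>I\<close> has side length \<open>2\<^sup>-\<^sup>j\<close>, and so the cubes \<open>J\<close> below have side length
  \<open>2\<^sup>-\<^sup>\<kappa> \<ell>(I)\<close>. Since \<open>h\<^sub>I\<close> and \<open>k\<^sub>I\<close> take finitely many values, each nonzero one on a set of positive
  measure, the suprema of absolute values are the \<open>L\<^sup>\<infinity>\<close> norms.\<close>
definition generalized_haar_shift ::
    "nat \<Rightarrow> 'n::finite cube_family \<Rightarrow> 'n cube_family \<Rightarrow> bool" where
  "generalized_haar_shift \<kappa> h k \<longleftrightarrow>
     (\<forall>j. \<forall>I\<in>dyadic_gen j.
        (\<forall>x. x \<notin> I \<longrightarrow> h I x = 0 \<and> k I x = 0) \<and>
        (\<forall>J\<in>dyadic_gen (j + int \<kappa>). J \<subseteq> I \<longrightarrow> h I constant_on J \<and> k I constant_on J) \<and>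
        (SUP x. \<bar>h I x\<bar>) * (SUP x. \<bar>k I x\<bar>) \<le> 1 / measure lebesgue I) \<and>
     (\<forall>f\<in>L2. \<exists>g\<in>L2.
        (\<lambda>N. L2_norm (\<lambda>x. haar_partial h k N f x - g x)) \<longlonglongrightarrow> 0 \<and> L2_norm g \<le> L2_norm f)"


subsection \<open>Vector-valued Haar shifts\<close>

text \<open>\<open>F = \<S>\<^sub>r f\<close>, which includes that all \<open>S\<^sup>j f\<^sub>j\<close> are defined. \<open>F\<close> is determined only almost
  everywhere, as the \<open>S\<^sup>j f\<^sub>j\<close> are.\<close>
definition vector_haar_value ::
    "real \<Rightarrow> (nat \<Rightarrow> 'n::finite cube_family) \<Rightarrow> (nat \<Rightarrow> 'n cube_family) \<Rightarrow>
     (nat \<Rightarrow> real^'n \<Rightarrow> real) \<Rightarrow> (real^'n \<Rightarrow> ennreal) \<Rightarrow> bool" where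
  "vector_haar_value r h k f F \<longleftrightarrow> (\<forall>j. locally_integrable (f j)) \<and>
     (\<exists>g. (\<forall>j. haar_value (h j) (k j) (f j) (g j)) \<and> F = (\<lambda>x. lr_norm r (\<lambda>j. g j x)))"

text \<open>The norm of \<open>\<S>\<^sub>r\<close> from \<open>L\<^sup>p\<^bsub>\<ell>\<^sup>r\<^esub>(w)\<close> to \<open>L\<^sup>p(w)\<close>; it is \<open>\<infinity>\<close> if there is no finite
  bound.\<close>
definition vector_haar_norm ::
    "real \<Rightarrow> real \<Rightarrow> (real^'n \<Rightarrow> real) \<Rightarrow>
     (nat \<Rightarrow> 'n::finite cube_family) \<Rightarrow> (nat \<Rightarrow> 'n cube_family) \<Rightarrow> ennreal" where
  "vector_haar_norm p r w h k =
     Inf {A. \<forall>f\<in>Lp_lr p r w. \<forall>F. vector_haar_value r h k f F \<longrightarrow>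
               Lp_norm p w F \<le> A * Lp_lr_norm p r w f}"

end

theory Submission
  imports Defs
begin

text \<open>
  Write \<open>a(Q)\<close> and \<open>b(Q)\<close> for the integrals over \<open>Q\<close> of the pointwise norms \<open>\<bar>f\<bar>\<close> of \<open>f\<close> in
  \<open>\<ell>\<^sup>r\<close> and \<open>\<bar>g\<bar>\<close> of \<open>g\<close> in \<open>\<ell>\<^sup>s\<close>, where \<open>1/r + 1/s = 1\<close>, and \<open>\<sigma>\<close> for the dual weight
  \<open>w powr (-1/(p-1))\<close>. The proof bounds \<open>\<Sum>\<^sub>j \<langle>S\<^sup>j f\<^sub>j, g\<^sub>j\<rangle>\<close> by an induction over dyadic cubes that
  performs a sparse domination and the summation of the sparse form at once.

  \<^bold>\<open>Discretization.\<close> By Fatou's lemma and monotone convergence it suffices to treat finitely many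
  \<open>j\<close> and the partial sums over side lengths between \<open>2\<^sup>-\<^sup>N\<close> and \<open>2\<^sup>N\<close>, uniformly in \<open>N\<close>
  (\<open>limit_bound\<close>). On a cube of side length \<open>2\<^sup>N\<close> such a partial sum depends only on the averages of
  \<open>f\<close> over the cubes of side length \<open>2 powr (-N-\<kappa>)\<close>, the leaves, and is constant on each leaf
  (\<open>apply_shift_cells\<close>). So the problem concerns a finite tree of finite sets of leaves.

  \<^bold>\<open>Local step\<close> (\<open>local_step\<close>). In a cube \<open>Q\<close> select the maximal subcubes \<open>J\<close> on which the average of
  \<open>\<bar>f\<bar>\<close> or of \<open>\<bar>g\<bar>\<close> exceeds four times its average over \<open>Q\<close>. They cover at most half of \<open>Q\<close>. Split
  \<open>f\<close> and \<open>g\<close> into good parts, which equal the averages on each \<open>J\<close>, and bad parts, which have mean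
  zero on each \<open>J\<close>. The good parts are bounded by multiples of the averages over \<open>Q\<close>, and so the
  form of the good parts is controlled as soon as the form is controlled on bounded functions. A bad
  part on \<open>J\<close> is annihilated by every \<open>k\<^sub>I\<close> or \<open>h\<^sub>I\<close> that is constant on \<open>J\<close>, which leaves fewer than
  \<open>\<kappa>\<close> cubes \<open>I\<close> strictly above \<open>J\<close>. Hence the form over \<open>Q\<close> differs from the sum of the forms over the
  \<open>J\<close> by at most a constant times \<open>(A + \<kappa>) a(Q) b(Q) / |Q|\<close>, where \<open>A\<close> is the testing constant.

  \<^bold>\<open>Weighted summation\<close> (\<open>weighted_form_bound\<close>). Let \<open>E\<close> be the part of \<open>Q\<close> outside the selected
  cubes. The \<open>A\<^sub>p\<close> condition on \<open>Q\<close> bounds \<open>a(Q) b(Q) / |Q|\<close> by the sharp power of the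
  characteristic times \<open>(a(Q)/\<sigma>(Q)) powr p * \<sigma>(E)\<close> plus the dual quantity for \<open>b\<close> and \<open>w\<close>
  (\<open>weight_step\<close>). These are the terms of a Carleson embedding sum, and each of them is paid for by
  the decrease of a Bellman function from \<open>Q\<close> to the cubes \<open>J\<close> (\<open>bellman_step\<close>). Induction on \<open>Q\<close>
  bounds the form by \<open>\<integral> \<bar>f\<bar>\<^sup>p w\<close> plus the dual integral of \<open>g\<close>, and inserting the extremal \<open>g\<close> gives the
  norm inequality (\<open>weighted_shift_bound\<close>).

  \<^bold>\<open>Testing.\<close> The argument runs twice. The bound on \<open>L\<^sup>2\<close> controls the form of a single shift on
  bounded functions, with constant \<open>\<kappa> + 8\<close> (\<open>cell_test\<close>). Run for a single shift, with the exponent \<open>r\<close>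
  and the weight \<open>1\<close>, the argument turns this into an estimate on \<open>L\<^sup>r\<close> with a constant of order \<open>\<kappa>\<close>
  (\<open>scalar_form_bound\<close>). These estimates add up over \<open>j\<close> and control the vector-valued form on bounded
  functions (\<open>vector_test\<close>). The second run then yields the weighted bound for \<open>p\<close>, with a constant of
  order \<open>\<kappa>\<close>, which is at most \<open>\<kappa>\<^sup>4\<close>.
\<close>

section \<open>Numerical inequalities\<close>

text \<open>The function \<open>(f, s) \<mapsto> f\<^sup>p / s powr (p - 1)\<close> is convex and homogeneous, and the left side is its
  tangent plane along the ray \<open>f = c s\<close>. Summed or integrated with \<open>c\<close> equal to the quotient of the
  totals, this is Hoelder's inequality in the form needed below.\<close>
lemma powr_tangent_le:
  fixes p c f s :: real
  assumes p: "1 < p" and c: "0 \<le> c" and f: "0 \<le> f" and s: "0 < s"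
  shows "p * c powr (p - 1) * f - (p - 1) * c powr p * s \<le> f powr p / s powr (p - 1)"
proof -
  define q where "q = p / (p - 1)"
  define x where "x = f / s"
  have q: "1 < q" "1 / p + 1 / q = 1"
    using p by (auto simp: q_def field_simps)
  have "x * c powr (p - 1) \<le> x powr p / p + (c powr (p - 1)) powr q / q"
    using Youngs_inequality[of p q x "c powr (p - 1)"] p q f s by (auto simp: x_def)
  also have "(c powr (p - 1)) powr q = c powr p"
    using p by (simp add: powr_powr q_def)
  finally have "p * (x * c powr (p - 1)) \<le> p * (x powr p / p + c powr p / q)"
    using p by simp
  also have "\<dots> = x powr p + (p - 1) * c powr p"
    using p by (simp add: q_def field_simps)
  finally have "(p * c powr (p - 1) * x - (p - 1) * c powr p) * s \<le> x powr p * s"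
    using s by (intro mult_right_mono) (simp_all add: algebra_simps)
  also have "x powr p * s = f powr p / s powr (p - 1)"
    using f s by (simp add: x_def powr_divide powr_diff)
  also have "(p * c powr (p - 1) * x - (p - 1) * c powr p) * s
      = p * c powr (p - 1) * f - (p - 1) * c powr p * s"
    using s by (simp add: x_def field_simps)
  finally show ?thesis .
qed

lemma powr_quotient_eq_tangent:
  fixes p f s :: real
  assumes "0 \<le> f" "0 < s"
  shows "f powr p / s powr (p - 1)
    = p * (f / s) powr (p - 1) * f - (p - 1) * (f / s) powr p * s"
proof (cases "f = 0")
  case False
  with assms have f: "0 < f" by simp
  define X where "X = f powr p / s powr (p - 1)"
  have 1: "(f / s) powr (p - 1) * f = X"
    using f assms by (simp add: X_def powr_divide powr_diff)
  have 2: "(f / s) powr p * s = X"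
    using f assms by (simp add: X_def powr_divide powr_diff)
  show ?thesis
    unfolding mult.assoc 1 2 X_def[symmetric] by (simp add: algebra_simps)
qed simp

lemma sum_powr_quotient_ge:
  fixes f s :: "'a \<Rightarrow> real" and p :: real
  assumes p: "1 < p" and A: "finite A" "A \<noteq> {}"
    and f: "\<And>x. x \<in> A \<Longrightarrow> 0 \<le> f x" and s: "\<And>x. x \<in> A \<Longrightarrow> 0 < s x"
  shows "sum f A powr p / sum s A powr (p - 1) \<le> (\<Sum>x\<in>A. f x powr p / s x powr (p - 1))"
proof -
  define c where "c = sum f A / sum s A"
  have fA: "0 \<le> sum f A" and sA: "0 < sum s A"
    using A f s by (auto intro: sum_nonneg sum_pos)
  have "sum f A powr p / sum s A powr (p - 1)
      = p * c powr (p - 1) * sum f A - (p - 1) * c powr p * sum s A"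
    unfolding c_def by (rule powr_quotient_eq_tangent[OF fA sA])
  also have "\<dots> = (\<Sum>x\<in>A. p * c powr (p - 1) * f x - (p - 1) * c powr p * s x)"
    by (simp add: sum_subtractf sum_distrib_left)
  also have "\<dots> \<le> (\<Sum>x\<in>A. f x powr p / s x powr (p - 1))"
    using p f s fA sA by (intro sum_mono powr_tangent_le) (auto simp: c_def)
  finally show ?thesis .
qed

text \<open>The Bellman function of the Carleson embedding theorem for the measure \<open>s\<close> and the function \<open>a / s\<close>.
  In general the denominator is \<open>s(Q)\<close> plus the mass that the Carleson sequence puts on the
  subcubes of \<open>Q\<close>; here the sequence is given by disjoint sets that exhaust \<open>Q\<close>, so that this mass
  is \<open>s(Q)\<close> again.\<close>
definition bellman :: "real \<Rightarrow> ('a \<Rightarrow> real) \<Rightarrow> ('a \<Rightarrow> real) \<Rightarrow> 'a set \<Rightarrow> real" where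
  "bellman p a s Q = (\<Sum>x\<in>Q. a x powr p / s x powr (p - 1)) - sum a Q powr p / (2 * sum s Q) powr (p - 1)"

lemma bellman_le:
  "bellman p a s Q \<le> (\<Sum>x\<in>Q. a x powr p / s x powr (p - 1))"
  unfolding bellman_def by simp

text \<open>The left side is the contribution of \<open>Q\<close> to the Carleson embedding sum. It comes from taking
  all tangents with the slope of \<open>Q\<close>: passing to the cubes of \<open>\<J>\<close>, the part of \<open>Q\<close> outside them
  counts with weight \<open>s\<close> instead of \<open>2 s\<close>, and the gain is proportional to its measure.\<close>
lemma bellman_step:
  fixes a s :: "'a \<Rightarrow> real" and p :: real
  assumes p: "1 < p" and Q: "finite Q" and JQ: "\<Union>\<J> \<subseteq> Q" and dis: "disjoint \<J>"
    and ne: "\<And>J. J \<in> \<J> \<Longrightarrow> J \<noteq> {}" and Qne: "Q \<noteq> {}"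
    and a: "\<And>x. x \<in> Q \<Longrightarrow> 0 \<le> a x" and s: "\<And>x. x \<in> Q \<Longrightarrow> 0 < s x"
  shows "(p - 1) / 2 powr p * ((sum a Q / sum s Q) powr p * sum s (Q - \<Union>\<J>))
      \<le> bellman p a s Q - (\<Sum>J\<in>\<J>. bellman p a s J)"
proof -
  define c where "c = sum a Q / (2 * sum s Q)"
  define E where "E = Q - \<Union>\<J>"
  have finJ: "finite \<J>"
    by (rule finite_UnionD[OF finite_subset[OF JQ Q]])
  have finJ': "finite J" if "J \<in> \<J>" for J
    using that JQ Q by (meson Sup_upper finite_subset subset_trans)
  have aQ: "0 \<le> sum a Q" and sQ: "0 < sum s Q"
    using Q Qne a s by (auto intro: sum_nonneg sum_pos)
  have c: "0 \<le> c" using aQ sQ by (simp add: c_def)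
  have split: "sum t Q = sum t E + (\<Sum>J\<in>\<J>. sum t J)" for t :: "'a \<Rightarrow> real"
  proof -
    have "sum t Q = sum t E + sum t (\<Union>\<J>)"
      unfolding E_def using Q JQ by (metis sum.subset_diff)
    also have "sum t (\<Union>\<J>) = (\<Sum>J\<in>\<J>. sum t J)"
      using finJ' dis unfolding pairwise_def disjnt_def by (subst sum.Union_disjoint) auto
    finally show ?thesis .
  qed
  define \<Phi> where "\<Phi> = (\<lambda>x. a x powr p / s x powr (p - 1))"
  have E: "p * c powr (p - 1) * sum a E - (p - 1) * c powr p * sum s E \<le> sum \<Phi> E"
    unfolding sum_distrib_left sum_subtractf[symmetric] \<Phi>_def
    using a s c p by (intro sum_mono powr_tangent_le) (auto simp: E_def)
  have J: "p * c powr (p - 1) * sum a J - (p - 1) * c powr p * (2 * sum s J)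
      \<le> sum a J powr p / (2 * sum s J) powr (p - 1)" if J: "J \<in> \<J>" for J
  proof (rule powr_tangent_le[OF p c])
    have sub: "J \<subseteq> Q" using J JQ by blast
    show "0 \<le> sum a J" using sub a by (auto intro: sum_nonneg)
    have "0 < sum s J" using sub s J ne finJ' by (intro sum_pos) auto
    then show "0 < 2 * sum s J" by simp
  qed
  have tangent_Q: "p * c powr (p - 1) * sum a Q - (p - 1) * c powr p * (2 * sum s Q)
      = sum a Q powr p / (2 * sum s Q) powr (p - 1)"
    unfolding c_def using aQ sQ by (subst powr_quotient_eq_tangent) auto
  have "p * c powr (p - 1) * sum a Q - (p - 1) * c powr p * (2 * sum s Q - sum s E)
     = (p * c powr (p - 1) * sum a E - (p - 1) * c powr p * sum s E)
      + (\<Sum>J\<in>\<J>. p * c powr (p - 1) * sum a J - (p - 1) * c powr p * (2 * sum s J))"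
    unfolding split[of a] split[of s] sum_subtractf sum_distrib_left[symmetric]
    by (simp add: algebra_simps)
  also have "\<dots> \<le> sum \<Phi> E + (\<Sum>J\<in>\<J>. sum a J powr p / (2 * sum s J) powr (p - 1))"
    using E J by (intro add_mono sum_mono) auto
  finally have "sum a Q powr p / (2 * sum s Q) powr (p - 1) + (p - 1) * c powr p * sum s E
      \<le> sum \<Phi> E + (\<Sum>J\<in>\<J>. sum a J powr p / (2 * sum s J) powr (p - 1))"
    unfolding tangent_Q[symmetric] by (simp add: algebra_simps)
  moreover have "(p - 1) / 2 powr p * ((sum a Q / sum s Q) powr p * sum s E)
      = (p - 1) * c powr p * sum s E"
    using aQ sQ by (simp add: c_def powr_divide powr_mult)
  ultimately show ?thesis
    unfolding E_def[symmetric] bellman_def \<Phi>_def[symmetric] split[of \<Phi>] sum_subtractf by simp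
qed

text \<open>Here \<open>m\<close> and \<open>e\<close> are the volumes of \<open>Q\<close> and of a subset \<open>E\<close> that fills at least half of it;
  \<open>sQ\<close>, \<open>sE\<close>, \<open>wQ\<close>, \<open>wE\<close> are their masses for \<open>\<sigma>\<close> and \<open>w\<close>. As \<open>2 - p \<le> 0\<close>,
  the \<open>A\<^sub>p\<close> condition gives
  \<open>w(Q) \<sigma>(Q) / |Q| \<le> W |Q| powr (p-1) * \<sigma>(Q) powr (2-p) \<le> C W |E| powr (p-1) * \<sigma>(E) powr (2-p)\<close>,
  and Hoelder's inequality on \<open>E\<close> turns this into \<open>w(E) powr (1/q) * \<sigma>(E) powr (1/p)\<close>, to which Young's
  inequality applies. It is this step that makes the power of \<open>W\<close> sharp.\<close>
lemma weight_step_ge_2: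
  fixes p :: real
  assumes p: "2 \<le> p" and m: "0 < m" "m \<le> 2 * e" and W: "0 \<le> W"
    and E: "0 < sE" "0 < wE" "sE \<le> sQ" "wE \<le> wQ" "e powr p \<le> wE * sE powr (p - 1)"
    and Q: "wQ * sQ powr (p - 1) \<le> W * m powr p"
    and ab: "0 \<le> a" "0 \<le> b"
  shows "a * b / m \<le> 2 powr (p - 1) * W *
     ((a / sQ) powr p * sE + (b / wQ) powr (p / (p - 1)) * wE)"
proof -
  define q where "q = p / (p - 1)"
  have q: "1 < q" "1 / p + 1 / q = 1" and p1: "1 < p"
    using p by (auto simp: q_def field_simps)
  have pos: "0 < sQ" "0 < wQ" "0 < e" using E m by auto
  have "wQ * sQ = (wQ * sQ powr (p - 1)) * sQ powr (2 - p)"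
  proof -
    have "sQ powr (p - 1) * sQ powr (2 - p) = sQ powr 1"
      by (simp add: powr_add[symmetric])
    then show ?thesis using pos by simp
  qed
  also have "\<dots> \<le> (W * m powr p) * sE powr (2 - p)"
    by (rule mult_mono[OF Q powr_mono2']) (use E W p m in auto)
  finally have 1: "wQ * sQ / m \<le> W * m powr (p - 1) * sE powr (2 - p)"
    using m by (simp add: field_simps powr_diff)
  have "m powr (p - 1) \<le> (2 * e) powr (p - 1)"
    using m p by (intro powr_mono2) auto
  also have "\<dots> = 2 powr (p - 1) * (e powr p) powr (1 / q)"
    using pos p by (simp add: powr_mult powr_powr q_def)
  also have "\<dots> \<le> 2 powr (p - 1) * (wE * sE powr (p - 1)) powr (1 / q)"
    using E q by (intro mult_left_mono powr_mono2) auto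
  also have "\<dots> = 2 powr (p - 1) * (wE powr (1 / q) * sE powr ((p - 1) / q))"
    using E by (simp add: powr_mult powr_powr)
  finally have 2: "m powr (p - 1) * sE powr (2 - p)
      \<le> 2 powr (p - 1) * (wE powr (1 / q) * (sE powr ((p - 1) / q) * sE powr (2 - p)))"
    by (simp add: mult_right_mono mult.assoc[symmetric])
  have "(p - 1) / q + (2 - p) = 1 / p"
    using p by (simp add: q_def field_simps)
  then have 3: "sE powr ((p - 1) / q) * sE powr (2 - p) = sE powr (1 / p)"
    by (simp add: powr_add[symmetric])
  have 4: "wQ * sQ / m \<le> W * (2 powr (p - 1) * (wE powr (1 / q) * sE powr (1 / p)))"
    using order_trans[OF 1] mult_left_mono[OF 2[unfolded 3] W] by (simp add: mult.assoc)
  define x where "x = a / sQ * sE powr (1 / p)"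
  define y where "y = b / wQ * wE powr (1 / q)"
  have xy: "0 \<le> x" "0 \<le> y" using ab pos by (auto simp: x_def y_def)
  have "x * y \<le> x powr p / p + y powr q / q"
    using Youngs_inequality[of p q x y] p1 q xy by auto
  also have "\<dots> \<le> x powr p + y powr q"
    using p q by (intro add_mono) (auto simp: field_simps mult_le_cancel_left1 mult_le_cancel_right1)
  also have "x powr p = (a / sQ) powr p * sE"
    using ab pos E p unfolding x_def by (subst powr_mult) (auto simp: powr_powr)
  also have "y powr q = (b / wQ) powr q * wE"
    using ab pos E q unfolding y_def by (subst powr_mult) (auto simp: powr_powr)
  finally have 5: "x * y \<le> (a / sQ) powr p * sE + (b / wQ) powr q * wE" .
  have "a * b / m = (a / sQ) * (b / wQ) * (wQ * sQ / m)"
    using pos by simp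
  also have "\<dots> \<le> (a / sQ) * (b / wQ) * (W * (2 powr (p - 1) * (wE powr (1 / q) * sE powr (1 / p))))"
    using 4 ab pos by (intro mult_left_mono) auto
  also have "\<dots> = 2 powr (p - 1) * W * (x * y)"
    by (simp add: x_def y_def)
  also have "\<dots> \<le> 2 powr (p - 1) * W * ((a / sQ) powr p * sE + (b / wQ) powr q * wE)"
    using 5 W by (intro mult_left_mono) auto
  finally show ?thesis by (simp add: q_def)
qed

text \<open>For \<open>p < 2\<close> the roles of \<open>(w, p)\<close> and \<open>(\<sigma>, q)\<close> are exchanged, since \<open>\<sigma>\<close> is an \<open>A\<^sub>q\<close> weight
  with characteristic \<open>W powr (1/(p-1))\<close>.\<close>
lemma weight_step:
  fixes p :: real
  assumes p: "1 < p" and m: "0 < m" "m \<le> 2 * e" and W: "0 \<le> W"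
    and E: "0 < sE" "0 < wE" "sE \<le> sQ" "wE \<le> wQ" "e powr p \<le> wE * sE powr (p - 1)"
    and Q: "wQ * sQ powr (p - 1) \<le> W * m powr p"
    and ab: "0 \<le> a" "0 \<le> b"
  shows "a * b / m \<le> 2 powr (max p (p / (p - 1)) - 1) * W powr (max 1 (1 / (p - 1))) *
     ((a / sQ) powr p * sE + (b / wQ) powr (p / (p - 1)) * wE)"
proof (cases "2 \<le> p")
  case True
  then have "max 1 (1 / (p - 1)) = 1" "max p (p / (p - 1)) = p"
    by (auto simp: field_simps max_def)
  with weight_step_ge_2[OF True m W E Q ab] W show ?thesis by simp
next
  case False
  define q where "q = p / (p - 1)"
  have q2: "2 \<le> q" and q1: "q - 1 = 1 / (p - 1)" and qp: "q / (q - 1) = p" "(p - 1) * (q - 1) = 1"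
      "p * (q - 1) = q"
    using p False by (auto simp: q_def field_simps)
  have mx: "max 1 (1 / (p - 1)) = q - 1" "max p q = q"
    using p False by (auto simp: field_simps max_def q_def)
  have pos: "0 < sQ" "0 < wQ" "0 < e" using E m by auto
  have "(e powr p) powr (q - 1) \<le> (wE * sE powr (p - 1)) powr (q - 1)"
    using E q2 by (intro powr_mono2) auto
  then have a1: "e powr q \<le> sE * wE powr (q - 1)"
    using E qp by (simp add: powr_mult powr_powr mult.commute)
  have "(wQ * sQ powr (p - 1)) powr (q - 1) \<le> (W * m powr p) powr (q - 1)"
    using E Q q2 by (intro powr_mono2) auto
  then have a2: "sQ * wQ powr (q - 1) \<le> W powr (q - 1) * m powr q"
    using pos W m qp by (simp add: powr_mult powr_powr mult.commute)
  have "b * a / m \<le> 2 powr (q - 1) * W powr (q - 1) *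
     ((b / wQ) powr q * wE + (a / sQ) powr (q / (q - 1)) * sE)"
    by (rule weight_step_ge_2[OF q2 m _ E(2,1,4,3) a1 a2]) (use ab in auto)
  then show ?thesis
    unfolding q_def[symmetric] mx qp by (simp add: add.commute mult.commute[of b a])
qed

section \<open>Dual norms and stopping cubes\<close>

text \<open>Two norms in duality on vectors indexed by \<open>L\<close>. The induction is run once with the absolute
  value of a single coordinate and once with \<open>\<ell>\<^sup>r\<close> and its dual.\<close>
locale dual_norms =
  fixes L :: "'j set" and N N' :: "('j \<Rightarrow> real) \<Rightarrow> real"
  assumes finite_L: "finite L"
    and N_nonneg: "0 \<le> N u" and N'_nonneg: "0 \<le> N' u"
    and holder: "(\<Sum>j\<in>L. \<bar>u j\<bar> * \<bar>v j\<bar>) \<le> N u * N' v"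
    and ex_norming: "\<exists>v. N' v \<le> 1 \<and> (\<Sum>j\<in>L. u j * v j) = N u"
    and ex_norming': "\<exists>u. N u \<le> 1 \<and> (\<Sum>j\<in>L. u j * v j) = N' v"
begin

lemma dual_norms_swap: "dual_norms L N' N"
proof
  show "(\<Sum>j\<in>L. \<bar>u j\<bar> * \<bar>v j\<bar>) \<le> N' u * N v" for u v
    using holder[of v u] by (simp add: mult.commute)
  show "\<exists>v. N v \<le> 1 \<and> (\<Sum>j\<in>L. u j * v j) = N' u" for u
    using ex_norming'[of u] by (simp add: mult.commute)
  show "\<exists>u. N' u \<le> 1 \<and> (\<Sum>j\<in>L. u j * v j) = N v" for v
    using ex_norming[of v] by (simp add: mult.commute)
qed (rule finite_L N_nonneg N'_nonneg)+

lemma pairing_le: "(\<Sum>j\<in>L. u j * v j) \<le> N u * N' v"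
proof -
  have "(\<Sum>j\<in>L. u j * v j) \<le> (\<Sum>j\<in>L. \<bar>u j\<bar> * \<bar>v j\<bar>)"
    by (intro sum_mono) (metis abs_ge_self abs_mult)
  then show ?thesis using holder[of u v] by simp
qed

lemma pairing_le_unit: "N' v \<le> 1 \<Longrightarrow> (\<Sum>j\<in>L. u j * v j) \<le> N u"
  using pairing_le[of u v] mult_left_mono[of "N' v" 1 "N u"] N_nonneg[of u] by simp

lemma N_diff_le: "N (\<lambda>j. u j - v j) \<le> N u + N v"
proof -
  obtain c where c: "N' c \<le> 1" "(\<Sum>j\<in>L. (u j - v j) * c j) = N (\<lambda>j. u j - v j)"
    using ex_norming[of "\<lambda>j. u j - v j"] by auto
  have "N' (\<lambda>j. - c j) \<le> 1"
  proof -
    obtain e where e: "N e \<le> 1" "(\<Sum>j\<in>L. e j * (- c j)) = N' (\<lambda>j. - c j)"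
      using ex_norming'[of "\<lambda>j. - c j"] by auto
    have "(\<Sum>j\<in>L. e j * (- c j)) \<le> (\<Sum>j\<in>L. \<bar>e j\<bar> * \<bar>c j\<bar>)"
      by (intro sum_mono) (metis abs_ge_self abs_mult abs_minus_cancel)
    also have "\<dots> \<le> N e * N' c" by (rule holder)
    also have "\<dots> \<le> 1"
      using c e N_nonneg N'_nonneg by (simp add: mult_le_one)
    finally show ?thesis using e by simp
  qed
  from pairing_le_unit[OF this, of v] pairing_le_unit[OF c(1), of u] show ?thesis
    unfolding c(2)[symmetric] by (simp add: algebra_simps sum_subtractf sum_negf)
qed

lemma N_sum_le:
  assumes "finite A" and "\<And>x. x \<in> A \<Longrightarrow> 0 \<le> \<alpha> x"
  shows "N (\<lambda>j. \<Sum>x\<in>A. \<alpha> x * f j x) \<le> (\<Sum>x\<in>A. \<alpha> x * N (\<lambda>j. f j x))"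
proof -
  obtain c where c: "N' c \<le> 1"
    "(\<Sum>j\<in>L. (\<Sum>x\<in>A. \<alpha> x * f j x) * c j) = N (\<lambda>j. \<Sum>x\<in>A. \<alpha> x * f j x)"
    using ex_norming[of "\<lambda>j. \<Sum>x\<in>A. \<alpha> x * f j x"] by auto
  have "(\<Sum>j\<in>L. (\<Sum>x\<in>A. \<alpha> x * f j x) * c j) = (\<Sum>x\<in>A. \<alpha> x * (\<Sum>j\<in>L. f j x * c j))"
    unfolding sum_distrib_left sum_distrib_right by (subst sum.swap) (simp add: mult.assoc)
  also have "\<dots> \<le> (\<Sum>x\<in>A. \<alpha> x * N (\<lambda>j. f j x))"
    using assms c by (intro sum_mono mult_left_mono pairing_le_unit) auto
  finally show ?thesis using c by simp
qed

end

definition mass :: "(('j \<Rightarrow> real) \<Rightarrow> real) \<Rightarrow> ('j \<Rightarrow> 'x \<Rightarrow> real) \<Rightarrow> 'x set \<Rightarrow> real" where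
  "mass N f A = (\<Sum>x\<in>A. N (\<lambda>j. f j x))"

text \<open>Cubes appear as finite sets of atoms of equal volume, so that \<open>card\<close> is the volume. The constant
  \<open>B\<close>, for dyadic cubes \<open>2\<^sup>n\<close>, limits how much an average can grow from a cube to its child.\<close>
locale cube_tree =
  fixes D :: "'x set set" and B :: real
  assumes finite_D: "finite D" and B_ge_1: "1 \<le> B"
    and finite_cube: "Q \<in> D \<Longrightarrow> finite Q" and cube_nonempty: "Q \<in> D \<Longrightarrow> Q \<noteq> {}"
    and nested: "I \<in> D \<Longrightarrow> J \<in> D \<Longrightarrow> I \<subseteq> J \<or> J \<subseteq> I \<or> I \<inter> J = {}"
    and atom: "Q \<in> D \<Longrightarrow> x \<in> Q \<Longrightarrow> {x} \<in> D"
    and parent: "J \<in> D \<Longrightarrow> Q \<in> D \<Longrightarrow> J \<subset> Q \<Longrightarrow>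
      \<exists>P\<in>D. J \<subset> P \<and> P \<subseteq> Q \<and> real (card P) \<le> B * real (card J)"
begin

lemma card_pos: "Q \<in> D \<Longrightarrow> 0 < real (card Q)"
  using finite_cube cube_nonempty by (simp add: card_gt_0_iff)

text \<open>The maximal subcubes with a large average of \<open>a\<close> or of \<open>b\<close>. By Chebyshev's inequality each
  of the two conditions covers at most a quarter of \<open>Q\<close>. By maximality the parent of a stopping cube
  does not have large averages, whence the upper bound on the stopping cube itself.\<close>
lemma ex_stopping_cubes:
  fixes a b :: "'x \<Rightarrow> real"
  assumes Q: "Q \<in> D" and a: "\<And>x. 0 \<le> a x" and b: "\<And>x. 0 \<le> b x"
    and aQ: "0 < sum a Q" and bQ: "0 < sum b Q"
  obtains \<J> where "\<J> \<subseteq> D" "disjoint \<J>" "\<And>J. J \<in> \<J> \<Longrightarrow> J \<subset> Q"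
    "real (card Q) \<le> 2 * real (card (Q - \<Union>\<J>))"
    "\<And>I. I \<in> D \<Longrightarrow> I \<subseteq> Q \<Longrightarrow> (\<And>J. J \<in> \<J> \<Longrightarrow> \<not> I \<subseteq> J) \<Longrightarrow>
       sum a I \<le> 4 * (sum a Q / card Q) * card I \<and> sum b I \<le> 4 * (sum b Q / card Q) * card I"
    "\<And>J. J \<in> \<J> \<Longrightarrow>
       sum a J \<le> 4 * B * (sum a Q / card Q) * card J \<and> sum b J \<le> 4 * B * (sum b Q / card Q) * card J"
proof -
  define \<alpha> where "\<alpha> = sum a Q / card Q"
  define \<beta> where "\<beta> = sum b Q / card Q"
  have cQ: "0 < real (card Q)" by (rule card_pos[OF Q])
  have \<alpha>: "0 < \<alpha>" "sum a Q = \<alpha> * card Q" and \<beta>: "0 < \<beta>" "sum b Q = \<beta> * card Q"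
    using aQ bQ cQ by (auto simp: \<alpha>_def \<beta>_def)
  define S where "S = {J \<in> D. J \<subset> Q \<and> (4 * \<alpha> * card J < sum a J \<or> 4 * \<beta> * card J < sum b J)}"
  define \<J> where "\<J> = {J \<in> S. \<forall>P\<in>S. J \<subseteq> P \<longrightarrow> J = P}"
  have finS: "finite S" using finite_D by (simp add: S_def)
  have JS: "\<J> \<subseteq> S" and SD: "S \<subseteq> D" by (auto simp: \<J>_def S_def)
  have JQ: "J \<subset> Q" if "J \<in> \<J>" for J using that JS by (auto simp: S_def)
  have finJ: "finite \<J>" using JS finS by (rule finite_subset)
  have good: "sum a I \<le> 4 * \<alpha> * card I \<and> sum b I \<le> 4 * \<beta> * card I"
    if I: "I \<in> D" "I \<subseteq> Q" "I \<notin> S" for I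
  proof (cases "I = Q")
    case True
    then show ?thesis using \<alpha> \<beta> cQ by simp
  next
    case False
    then show ?thesis using I by (auto simp: S_def not_less)
  qed
  have dis: "disjoint \<J>"
  proof (rule disjointI)
    fix I J assume IJ: "I \<in> \<J>" "J \<in> \<J>" "I \<noteq> J"
    then have "\<not> I \<subseteq> J" "\<not> J \<subseteq> I" by (auto simp: \<J>_def)
    with nested[of I J] IJ JS SD show "I \<inter> J = {}" by blast
  qed
  have avoid: "I \<notin> S" if I: "\<And>J. J \<in> \<J> \<Longrightarrow> \<not> I \<subseteq> J" for I
  proof
    assume "I \<in> S"
    from finite_has_maximal2[OF finS this] obtain J where "J \<in> S" "I \<subseteq> J" "\<forall>P\<in>S. J \<subseteq> P \<longrightarrow> J = P"
      by blast
    then have "J \<in> \<J>" by (simp add: \<J>_def)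
    with I \<open>I \<subseteq> J\<close> show False by blast
  qed
  have stopped: "sum a J \<le> 4 * B * \<alpha> * card J \<and> sum b J \<le> 4 * B * \<beta> * card J" if J: "J \<in> \<J>" for J
  proof -
    have JD: "J \<in> D" and JS': "J \<in> S" using J JS SD by auto
    obtain P where P: "P \<in> D" "J \<subset> P" "P \<subseteq> Q" "real (card P) \<le> B * real (card J)"
      using parent[OF JD Q JQ[OF J]] by auto
    have "P \<notin> S" using J P(2) by (auto simp: \<J>_def)
    from good[OF P(1,3) this] have
      "sum a P \<le> 4 * \<alpha> * card P" "sum b P \<le> 4 * \<beta> * card P" by auto
    moreover have "sum a J \<le> sum a P" "sum b J \<le> sum b P"
      using P finite_cube[OF P(1)] a b by (auto intro!: sum_mono2)
    moreover have "4 * \<alpha> * card P \<le> 4 * \<alpha> * (B * card J)" "4 * \<beta> * card P \<le> 4 * \<beta> * (B * card J)"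
      using P(4) \<alpha> \<beta> by (auto intro!: mult_left_mono)
    ultimately show ?thesis by (auto simp: mult_ac)
  qed
  have size: "real (card Q) \<le> 2 * real (card (Q - \<Union>\<J>))"
  proof -
    have finJ': "finite J" if "J \<in> \<J>" for J
      using that JS SD finite_cube by blast
    have UQ: "\<Union>\<J> \<subseteq> Q" using JQ by blast
    have U: "sum t (\<Union>\<J>) = (\<Sum>J\<in>\<J>. sum t J)" for t :: "'x \<Rightarrow> real"
      using finJ' dis unfolding pairwise_def disjnt_def by (subst sum.Union_disjoint) auto
    have "real (card (\<Union>\<J>)) = (\<Sum>J\<in>\<J>. real (card J))"
      using U[of "\<lambda>_. 1"] by simp
    also have "\<dots> \<le> (\<Sum>J\<in>\<J>. sum a J / (4 * \<alpha>) + sum b J / (4 * \<beta>))"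
    proof (rule sum_mono)
      fix J assume "J \<in> \<J>"
      then have "4 * \<alpha> * card J < sum a J \<or> 4 * \<beta> * card J < sum b J"
        using JS by (auto simp: S_def)
      then have "card J \<le> sum a J / (4 * \<alpha>) \<or> card J \<le> sum b J / (4 * \<beta>)"
        using \<alpha> \<beta> by (auto simp: pos_le_divide_eq mult.commute)
      moreover have "0 \<le> sum a J / (4 * \<alpha>)" "0 \<le> sum b J / (4 * \<beta>)"
        using a b \<alpha> \<beta> by (auto intro!: divide_nonneg_nonneg sum_nonneg)
      ultimately show "real (card J) \<le> sum a J / (4 * \<alpha>) + sum b J / (4 * \<beta>)" by linarith
    qed
    also have "\<dots> = sum a (\<Union>\<J>) / (4 * \<alpha>) + sum b (\<Union>\<J>) / (4 * \<beta>)"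
      by (simp add: U sum.distrib sum_divide_distrib)
    also have "\<dots> \<le> sum a Q / (4 * \<alpha>) + sum b Q / (4 * \<beta>)"
      using UQ finite_cube[OF Q] a b \<alpha> \<beta>
      by (intro add_mono divide_right_mono sum_mono2) auto
    also have "\<dots> = card Q / 2"
      using \<alpha> \<beta> by simp
    finally have "real (card (\<Union>\<J>)) \<le> card Q / 2" .
    moreover have "real (card (Q - \<Union>\<J>)) = card Q - card (\<Union>\<J>)"
      using UQ finite_cube[OF Q] by (simp add: card_Diff_subset finite_subset card_mono of_nat_diff)
    ultimately show ?thesis by simp
  qed
  show thesis
  proof (rule that[of \<J>])
    show "\<J> \<subseteq> D" using JS SD by blast
  qed (use dis JQ size good avoid stopped in \<open>auto simp: \<alpha>_def \<beta>_def\<close>)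
qed

end

section \<open>Haar shifts on a finite tree\<close>

text \<open>The contribution of the cube \<open>I\<close> to \<open>\<Sum>\<^sub>j \<langle>S\<^sup>j f\<^sub>j, g\<^sub>j\<rangle>\<close>.\<close>
definition block where
  "block L k h I f g = (\<Sum>j\<in>L. (\<Sum>x\<in>I. f j x * k j I x) * (\<Sum>y\<in>I. g j y * (h j I y :: real)))"

definition form where
  "form D L k h Q f g = (\<Sum>I | I \<in> D \<and> I \<subseteq> Q. block L k h I f g)"

definition condexp :: "'x set set \<Rightarrow> ('j \<Rightarrow> 'x \<Rightarrow> real) \<Rightarrow> 'j \<Rightarrow> 'x \<Rightarrow> real" where
  "condexp \<J> f j x = (if x \<in> \<Union>\<J> then let J = (THE J. J \<in> \<J> \<and> x \<in> J) in (\<Sum>y\<in>J. f j y) / card J else f j x)"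

lemma block_swap: "block L h k I g f = block L k h I f g"
  by (simp add: block_def mult.commute)

lemma block_add_left:
  "block L k h I (\<lambda>j x. f j x + f' j x) g = block L k h I f g + block L k h I f' g"
  by (simp add: block_def sum.distrib distrib_right)

lemma block_add_right:
  "block L k h I f (\<lambda>j x. g j x + g' j x) = block L k h I f g + block L k h I f g'"
  by (simp add: block_def sum.distrib distrib_left distrib_right)

lemma condexp_eq:
  assumes "disjoint \<J>" "J \<in> \<J>" "x \<in> J"
  shows "condexp \<J> f j x = (\<Sum>y\<in>J. f j y) / card J"
proof -
  have "(THE J. J \<in> \<J> \<and> x \<in> J) = J"
    using assms by (intro the_equality) (auto simp: pairwise_def disjnt_def)
  with assms show ?thesis by (auto simp: condexp_def)
qed

lemma condexp_outside: "x \<notin> \<Union>\<J> \<Longrightarrow> condexp \<J> f j x = f j x"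
  by (simp add: condexp_def)

text \<open>A cube \<open>I\<close> above \<open>J\<close> interacts with functions of mean zero on \<open>J\<close> only if one of its functions is
  not constant on \<open>J\<close>; the assumption on the complexity counts these cubes.\<close>
locale haar_tree = dual_norms L N N' + cube_tree D B
  for L :: "'j set" and N N' :: "('j \<Rightarrow> real) \<Rightarrow> real" and D :: "'x set set" and B :: real +
  fixes k h :: "'j \<Rightarrow> 'x set \<Rightarrow> 'x \<Rightarrow> real" and \<kappa> :: real
  assumes size: "j \<in> L \<Longrightarrow> I \<in> D \<Longrightarrow> x \<in> I \<Longrightarrow> y \<in> I \<Longrightarrow> \<bar>k j I x\<bar> * \<bar>h j I y\<bar> \<le> 1 / card I"
    and complexity: "J \<in> D \<Longrightarrow>
      card {I \<in> D. J \<subset> I \<and> \<not> (\<forall>j\<in>L. k j I constant_on J \<and> h j I constant_on J)} \<le> \<kappa>"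
begin

lemma haar_tree_swap: "haar_tree L N' N D B h k \<kappa>"
proof -
  interpret sw: dual_norms L N' N by (rule dual_norms_swap)
  show ?thesis
  proof
    show "\<bar>h j I x\<bar> * \<bar>k j I y\<bar> \<le> 1 / card I" if "j \<in> L" "I \<in> D" "x \<in> I" "y \<in> I" for j I x y
      using size[of j I y x] that by (simp add: mult.commute)
    show "card {I \<in> D. J \<subset> I \<and> \<not> (\<forall>j\<in>L. h j I constant_on J \<and> k j I constant_on J)} \<le> \<kappa>"
      if "J \<in> D" for J
      using complexity[OF that] by (simp add: conj_commute)
  qed
qed

lemma mass_nonneg: "0 \<le> mass N f A"
  by (simp add: mass_def sum_nonneg N_nonneg)

lemma mass_mono: "finite A \<Longrightarrow> C \<subseteq> A \<Longrightarrow> mass N f C \<le> mass N f A"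
  unfolding mass_def by (intro sum_mono2) (auto intro: N_nonneg)

lemma mass'_nonneg: "0 \<le> mass N' f A"
  by (simp add: mass_def sum_nonneg N'_nonneg)

lemma mass'_mono: "finite A \<Longrightarrow> C \<subseteq> A \<Longrightarrow> mass N' f C \<le> mass N' f A"
  unfolding mass_def by (intro sum_mono2) (auto intro: N'_nonneg)

lemma local_pairing_le:
  assumes I: "I \<in> D" and A: "A \<subseteq> I" and C: "C \<subseteq> I"
  shows "\<bar>\<Sum>j\<in>L. (\<Sum>x\<in>A. f j x * k j I x) * (\<Sum>y\<in>C. g j y * h j I y)\<bar>
    \<le> mass N f A * mass N' g C / card I"
proof -
  have "\<bar>\<Sum>j\<in>L. (\<Sum>x\<in>A. f j x * k j I x) * (\<Sum>y\<in>C. g j y * h j I y)\<bar>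
      \<le> (\<Sum>j\<in>L. \<bar>\<Sum>x\<in>A. f j x * k j I x\<bar> * \<bar>\<Sum>y\<in>C. g j y * h j I y\<bar>)"
    by (metis (mono_tags, lifting) abs_mult sum_abs sum.cong)
  also have "\<dots> \<le> (\<Sum>j\<in>L. (\<Sum>x\<in>A. \<bar>f j x * k j I x\<bar>) * (\<Sum>y\<in>C. \<bar>g j y * h j I y\<bar>))"
    by (intro sum_mono mult_mono sum_abs) (auto intro: sum_nonneg)
  also have "\<dots> = (\<Sum>j\<in>L. \<Sum>x\<in>A. \<Sum>y\<in>C. \<bar>f j x\<bar> * \<bar>g j y\<bar> * (\<bar>k j I x\<bar> * \<bar>h j I y\<bar>))"
    by (simp add: sum_product abs_mult mult_ac)
  also have "\<dots> \<le> (\<Sum>j\<in>L. \<Sum>x\<in>A. \<Sum>y\<in>C. \<bar>f j x\<bar> * \<bar>g j y\<bar> * (1 / card I))"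
    using A C by (intro sum_mono mult_left_mono size[OF _ I]) auto
  also have "\<dots> = (\<Sum>x\<in>A. \<Sum>y\<in>C. (\<Sum>j\<in>L. \<bar>f j x\<bar> * \<bar>g j y\<bar>) / card I)"
    by (subst sum.swap, subst sum.swap[of _ _ L]) (simp add: sum_divide_distrib)
  also have "\<dots> \<le> (\<Sum>x\<in>A. \<Sum>y\<in>C. N (\<lambda>j. f j x) * N' (\<lambda>j. g j y) / card I)"
    by (intro sum_mono divide_right_mono holder) auto
  also have "\<dots> = mass N f A * mass N' g C / card I"
    by (simp add: mass_def sum_product sum_divide_distrib)
  finally show ?thesis .
qed

lemma block_le: "I \<in> D \<Longrightarrow> \<bar>block L k h I f g\<bar> \<le> mass N f I * mass N' g I / card I"
  unfolding block_def by (rule local_pairing_le) auto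

text \<open>The function \<open>f\<close> is the bad part: it lives on the stopping cubes \<open>J\<close> and has mean zero on
  each of them. An unstopped cube \<open>I\<close> either misses \<open>J\<close> or contains it, and in the second case it
  sees \<open>f\<close> on \<open>J\<close> only if \<open>k\<^sub>I\<close> or \<open>h\<^sub>I\<close> is not constant there. This leaves at most \<open>\<kappa>\<close> pairs \<open>(I, J)\<close>
  for each \<open>J\<close>, each of which contributes at most \<open>t\<close> times the mass of \<open>f\<close> on \<open>J\<close>.\<close>
lemma cancellation_le:
  fixes t :: real
  assumes Q: "Q \<in> D" and JD: "\<J> \<subseteq> D" and dis: "disjoint \<J>"
    and U: "U = {I \<in> D. I \<subseteq> Q \<and> (\<forall>J\<in>\<J>. \<not> I \<subseteq> J)}"
    and supp: "\<And>j x. x \<in> Q - \<Union>\<J> \<Longrightarrow> f j x = 0"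
    and zero: "\<And>j J. J \<in> \<J> \<Longrightarrow> (\<Sum>x\<in>J. f j x) = 0"
    and g: "\<And>I. I \<in> U \<Longrightarrow> mass N' g I \<le> t * card I" and t: "0 \<le> t"
  shows "\<bar>\<Sum>I\<in>U. block L k h I f g\<bar> \<le> \<kappa> * t * (\<Sum>J\<in>\<J>. mass N f J)"
proof -
  have finU: "finite U" using finite_D by (simp add: U)
  have finJ: "finite \<J>" using JD finite_D by (rule finite_subset)
  define R where "R I J \<longleftrightarrow> J \<subset> I \<and> \<not> (\<forall>j\<in>L. k j I constant_on J \<and> h j I constant_on J)" for I J
  have I: "\<bar>block L k h I f g\<bar> \<le> (\<Sum>J\<in>{J\<in>\<J>. R I J}. t * mass N f J)" if IU: "I \<in> U" for I
  proof -
    have ID: "I \<in> D" and IQ: "I \<subseteq> Q" using IU by (auto simp: U)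
    have sub: "J \<subset> I \<or> J \<inter> I = {}" if "J \<in> \<J>" for J
      using that IU nested[of J I] JD by (auto simp: U)
    have split: "(\<Sum>x\<in>I. f j x * k j I x) = (\<Sum>J\<in>{J\<in>\<J>. R I J}. \<Sum>x\<in>J. f j x * k j I x)"
      if j: "j \<in> L" for j
    proof -
      have "(\<Sum>x\<in>I. f j x * k j I x) = (\<Sum>x\<in>\<Union>{J\<in>\<J>. J \<subset> I}. f j x * k j I x)"
      proof (rule sum.mono_neutral_right)
        show "\<forall>x\<in>I - \<Union> {J \<in> \<J>. J \<subset> I}. f j x * k j I x = 0"
        proof
          fix x assume x: "x \<in> I - \<Union> {J \<in> \<J>. J \<subset> I}"
          then have "x \<in> Q - \<Union>\<J>" using sub IQ by blast
          then show "f j x * k j I x = 0" by (simp add: supp)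
        qed
      qed (use finite_cube[OF ID] in auto)
      also have "\<dots> = (\<Sum>J\<in>{J\<in>\<J>. J \<subset> I}. \<Sum>x\<in>J. f j x * k j I x)"
        using dis JD finite_cube unfolding pairwise_def disjnt_def
        by (subst sum.Union_disjoint) auto
      also have "\<dots> = (\<Sum>J\<in>{J\<in>\<J>. R I J}. \<Sum>x\<in>J. f j x * k j I x)"
      proof (rule sum.mono_neutral_right)
        show "\<forall>J\<in>{J \<in> \<J>. J \<subset> I} - {J \<in> \<J>. R I J}. (\<Sum>x\<in>J. f j x * k j I x) = 0"
        proof
          fix J assume J: "J \<in> {J \<in> \<J>. J \<subset> I} - {J \<in> \<J>. R I J}"
          then obtain c where "\<forall>x\<in>J. k j I x = c"
            using j unfolding R_def constant_on_def by blast
          then have "(\<Sum>x\<in>J. f j x * k j I x) = (\<Sum>x\<in>J. f j x) * c"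
            by (simp add: sum_distrib_right)
          then show "(\<Sum>x\<in>J. f j x * k j I x) = 0" using J zero by simp
        qed
      qed (use finJ in \<open>auto simp: R_def\<close>)
      finally show ?thesis .
    qed
    have "block L k h I f g = (\<Sum>J\<in>{J\<in>\<J>. R I J}.
        \<Sum>j\<in>L. (\<Sum>x\<in>J. f j x * k j I x) * (\<Sum>y\<in>I. g j y * h j I y))"
      unfolding block_def by (subst sum.swap) (simp add: split sum_distrib_right)
    also have "\<bar>\<dots>\<bar> \<le> (\<Sum>J\<in>{J\<in>\<J>. R I J}. mass N f J * mass N' g I / card I)"
      by (rule order_trans[OF sum_abs]) (intro sum_mono local_pairing_le ID, auto simp: R_def)
    also have "\<dots> \<le> (\<Sum>J\<in>{J\<in>\<J>. R I J}. t * mass N f J)"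
    proof (rule sum_mono)
      fix J
      have "mass N f J * mass N' g I / card I \<le> mass N f J * (t * card I) / card I"
        using g[OF IU] mass_nonneg by (intro divide_right_mono mult_left_mono) auto
      then show "mass N f J * mass N' g I / card I \<le> t * mass N f J"
        using card_pos[OF ID] by (simp add: mult.commute)
    qed
    finally show ?thesis .
  qed
  have "\<bar>\<Sum>I\<in>U. block L k h I f g\<bar> \<le> (\<Sum>I\<in>U. \<Sum>J\<in>{J\<in>\<J>. R I J}. t * mass N f J)"
    by (rule order_trans[OF sum_abs]) (intro sum_mono I)
  also have "\<dots> = (\<Sum>J\<in>\<J>. \<Sum>I\<in>{I\<in>U. R I J}. t * mass N f J)"
    by (rule sum.swap_restrict[OF finU finJ])
  also have "\<dots> = (\<Sum>J\<in>\<J>. real (card {I\<in>U. R I J}) * (t * mass N f J))"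
    by simp
  also have "\<dots> \<le> (\<Sum>J\<in>\<J>. \<kappa> * (t * mass N f J))"
  proof (intro sum_mono mult_right_mono)
    fix J assume J: "J \<in> \<J>"
    have "card {I\<in>U. R I J} \<le> card {I \<in> D. R I J}"
      using finite_D by (intro card_mono) (auto simp: U)
    moreover have "card {I \<in> D. R I J} \<le> \<kappa>"
      unfolding R_def using complexity J JD by auto
    ultimately show "real (card {I\<in>U. R I J}) \<le> \<kappa>" by simp
  qed (simp add: t mass_nonneg)
  also have "\<dots> = \<kappa> * t * (\<Sum>J\<in>\<J>. mass N f J)"
    by (simp add: sum_distrib_left mult.assoc)
  finally show ?thesis .
qed

lemma kappa_nonneg: "D \<noteq> {} \<Longrightarrow> 0 \<le> \<kappa>"
  using complexity by (meson all_not_in_conv of_nat_0_le_iff order_trans)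

lemma N_condexp_le:
  assumes J: "J \<in> D" "J \<in> \<J>" "disjoint \<J>" "x \<in> J"
  shows "N (\<lambda>j. condexp \<J> f j x) \<le> mass N f J / card J"
proof -
  have "N (\<lambda>j. condexp \<J> f j x) = N (\<lambda>j. \<Sum>y\<in>J. (1 / card J) * f j y)"
    by (simp add: condexp_eq[OF J(3,2,4)] sum_divide_distrib)
  also have "\<dots> \<le> (\<Sum>y\<in>J. (1 / card J) * N (\<lambda>j. f j y))"
    using finite_cube[OF J(1)] by (intro N_sum_le) auto
  also have "\<dots> = mass N f J / card J"
    by (simp add: mass_def sum_divide_distrib)
  finally show ?thesis .
qed

lemma mass_condexp_le:
  assumes J: "J \<in> D" "J \<in> \<J>" "disjoint \<J>"
  shows "mass N (condexp \<J> f) J \<le> mass N f J"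
proof -
  have "mass N (condexp \<J> f) J \<le> (\<Sum>x\<in>J. mass N f J / card J)"
    unfolding mass_def[of N "condexp \<J> f"] using N_condexp_le[OF J] by (intro sum_mono)
  also have "\<dots> = mass N f J"
    using card_pos[OF J(1)] by simp
  finally show ?thesis .
qed

lemma condexp_bad_part:
  fixes f :: "'j \<Rightarrow> 'x \<Rightarrow> real"
  assumes JD: "\<J> \<subseteq> D" and dis: "disjoint \<J>"
  defines "fb \<equiv> \<lambda>j x. f j x - condexp \<J> f j x"
  shows "x \<notin> \<Union>\<J> \<Longrightarrow> fb j x = 0"
    and "J \<in> \<J> \<Longrightarrow> (\<Sum>x\<in>J. fb j x) = 0"
    and "J \<in> \<J> \<Longrightarrow> mass N fb J \<le> 2 * mass N f J"
proof -
  show "x \<notin> \<Union>\<J> \<Longrightarrow> fb j x = 0" by (simp add: fb_def condexp_outside)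
next
  assume J: "J \<in> \<J>"
  have "(\<Sum>x\<in>J. condexp \<J> f j x) = (\<Sum>x\<in>J. (\<Sum>y\<in>J. f j y) / card J)"
    using condexp_eq[OF dis J] by (intro sum.cong) auto
  also have "\<dots> = (\<Sum>y\<in>J. f j y)"
    using card_pos[of J] J JD by auto
  finally show "(\<Sum>x\<in>J. fb j x) = 0" by (simp add: fb_def sum_subtractf)
next
  assume J: "J \<in> \<J>"
  have "mass N fb J \<le> mass N f J + mass N (condexp \<J> f) J"
    unfolding fb_def mass_def sum.distrib[symmetric] by (intro sum_mono N_diff_le)
  then show "mass N fb J \<le> 2 * mass N f J"
    using mass_condexp_le[of J \<J> f] J JD dis by auto
qed

lemma form_split:
  assumes Q: "Q \<in> D" and JD: "\<J> \<subseteq> D" and dis: "disjoint \<J>" and JQ: "\<And>J. J \<in> \<J> \<Longrightarrow> J \<subset> Q"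
    and U: "U = {I \<in> D. I \<subseteq> Q \<and> (\<forall>J\<in>\<J>. \<not> I \<subseteq> J)}"
  shows "(\<Sum>I\<in>U. block L k h I f g) = form D L k h Q f g - (\<Sum>J\<in>\<J>. form D L k h J f g)"
proof -
  have finJ: "finite \<J>" using JD finite_D by (rule finite_subset)
  define S where "S J = {I. I \<in> D \<and> I \<subseteq> J}" for J
  have "S Q = U \<union> (\<Union>J\<in>\<J>. S J)"
    using JQ unfolding U S_def by blast
  moreover have "U \<inter> (\<Union>J\<in>\<J>. S J) = {}" by (auto simp: U S_def)
  moreover have "finite (S J)" for J using finite_D by (simp add: S_def)
  moreover have "finite U" using finite_D by (simp add: U)
  moreover have "S I \<inter> S J = {}" if "I \<in> \<J>" "J \<in> \<J>" "I \<noteq> J" for I J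
  proof -
    have "I \<inter> J = {}" using dis that by (auto simp: pairwise_def disjnt_def)
    then show ?thesis using cube_nonempty by (auto simp: S_def) blast
  qed
  ultimately have "sum t (S Q) = sum t U + (\<Sum>J\<in>\<J>. sum t (S J))" for t :: "'x set \<Rightarrow> real"
    using finJ by (simp add: sum.union_disjoint sum.UNION_disjoint)
  then show ?thesis by (simp add: form_def S_def)
qed

text \<open>One step of the sparse domination: with \<open>f = f\<^sub>g + f\<^sub>b\<close> and \<open>g = g\<^sub>g + g\<^sub>b\<close>, the sum over the
  unstopped cubes splits into the pairs \<open>(f\<^sub>b, g)\<close> and \<open>(f\<^sub>g, g\<^sub>b)\<close>, to which cancellation applies, and
  \<open>(f\<^sub>g, g\<^sub>g)\<close>, for which the sum is written as the form over \<open>Q\<close> minus the forms over the stopping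
  cubes, all evaluated at bounded functions.\<close>
lemma local_step:
  assumes Q: "Q \<in> D" and A: "0 \<le> A"
    and test: "\<And>J f g s t. J \<in> D \<Longrightarrow> 0 < s \<Longrightarrow> 0 < t \<Longrightarrow> (\<And>x. x \<in> J \<Longrightarrow> N (\<lambda>j. f j x) \<le> s) \<Longrightarrow>
      (\<And>x. x \<in> J \<Longrightarrow> N' (\<lambda>j. g j x) \<le> t) \<Longrightarrow> \<bar>form D L k h J f g\<bar> \<le> A * s * t * card J"
  obtains \<J> where "\<J> \<subseteq> D" "disjoint \<J>" "\<And>J. J \<in> \<J> \<Longrightarrow> J \<subset> Q"
    "real (card Q) \<le> 2 * real (card (Q - \<Union>\<J>))"
    "\<bar>form D L k h Q f g - (\<Sum>J\<in>\<J>. form D L k h J f g)\<bar>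
      \<le> 32 * B\<^sup>2 * (A + \<kappa>) * (mass N f Q * mass N' g Q / card Q)"
proof (cases "mass N f Q = 0 \<or> mass N' g Q = 0")
  case True
  have "\<bar>block L k h I f g\<bar> \<le> 0" if I: "I \<in> D" "I \<subseteq> Q" for I
  proof -
    have "mass N f I \<le> mass N f Q" "mass N' g I \<le> mass N' g Q"
      using I finite_cube[OF Q] by (auto intro: mass_mono mass'_mono)
    then have "mass N f I = 0 \<or> mass N' g I = 0"
      using True mass_nonneg[of f I] mass'_nonneg[of g I] by auto
    with block_le[OF I(1), of f g] show ?thesis by auto
  qed
  then have "form D L k h Q f g = 0"
    unfolding form_def by (intro sum.neutral) auto
  then show ?thesis using True by (intro that[of "{}"]) auto
next
  case False
  define \<alpha> where "\<alpha> = mass N f Q / card Q"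
  define \<beta> where "\<beta> = mass N' g Q / card Q"
  have cQ: "0 < real (card Q)" by (rule card_pos[OF Q])
  have pos: "0 < mass N f Q" "0 < mass N' g Q"
    using False mass_nonneg[of f Q] mass'_nonneg[of g Q] by auto
  then have ab: "0 < \<alpha>" "0 < \<beta>" using cQ by (auto simp: \<alpha>_def \<beta>_def)
  have B: "0 < B" using B_ge_1 by simp
  have \<kappa>: "0 \<le> \<kappa>" using kappa_nonneg Q by auto
  obtain \<J> where JD: "\<J> \<subseteq> D" and dis: "disjoint \<J>" and JQ: "\<And>J. J \<in> \<J> \<Longrightarrow> J \<subset> Q"
    and half: "real (card Q) \<le> 2 * real (card (Q - \<Union>\<J>))"
    and U': "\<And>I. I \<in> D \<Longrightarrow> I \<subseteq> Q \<Longrightarrow> (\<And>J. J \<in> \<J> \<Longrightarrow> \<not> I \<subseteq> J) \<Longrightarrow>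
       mass N f I \<le> 4 * \<alpha> * card I \<and> mass N' g I \<le> 4 * \<beta> * card I"
    and J': "\<And>J. J \<in> \<J> \<Longrightarrow> mass N f J \<le> 4 * B * \<alpha> * card J \<and> mass N' g J \<le> 4 * B * \<beta> * card J"
    using ex_stopping_cubes[OF Q, of "\<lambda>x. N (\<lambda>j. f j x)" "\<lambda>x. N' (\<lambda>j. g j x)"] pos N_nonneg N'_nonneg
    unfolding \<alpha>_def \<beta>_def mass_def by metis
  define U where "U = {I \<in> D. I \<subseteq> Q \<and> (\<forall>J\<in>\<J>. \<not> I \<subseteq> J)}"
  interpret sw: haar_tree L N' N D B h k \<kappa> by (rule haar_tree_swap)
  define fg where "fg = condexp \<J> f"
  define gg where "gg = condexp \<J> g"
  define fb where "fb = (\<lambda>j x. f j x - fg j x)"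
  define gb where "gb = (\<lambda>j x. g j x - gg j x)"
  have finJ: "finite \<J>" using JD finite_D by (rule finite_subset)
  have UQ: "\<Union>\<J> \<subseteq> Q" using JQ by blast
  have split: "(\<Sum>I\<in>U. block L k h I u v) = form D L k h Q u v - (\<Sum>J\<in>\<J>. form D L k h J u v)" for u v
    by (rule form_split[OF Q JD dis _ U_def]) (rule JQ)
  have good: "N (\<lambda>j. fg j x) \<le> 4 * B * \<alpha>" "N' (\<lambda>j. gg j x) \<le> 4 * B * \<beta>" if x: "x \<in> Q" for x
  proof -
    have "N (\<lambda>j. fg j x) \<le> 4 * B * \<alpha> \<and> N' (\<lambda>j. gg j x) \<le> 4 * B * \<beta>"
    proof (cases "x \<in> \<Union>\<J>")
      case True
      then obtain J where J: "J \<in> \<J>" "x \<in> J" by blast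
      then have JD': "J \<in> D" and cJ: "0 < real (card J)" using JD card_pos by blast+
      have "mass N f J / card J \<le> 4 * B * \<alpha>" "mass N' g J / card J \<le> 4 * B * \<beta>"
        using J'[OF J(1)] cJ by (auto simp: pos_divide_le_eq)
      then show ?thesis
        using N_condexp_le[OF JD' J(1) dis J(2), of f] sw.N_condexp_le[OF JD' J(1) dis J(2), of g]
        by (simp add: fg_def gg_def)
    next
      case False
      then have "mass N f {x} \<le> 4 * \<alpha> * card {x} \<and> mass N' g {x} \<le> 4 * \<beta> * card {x}"
        using x atom[OF Q x] by (intro U') auto
      moreover have "4 * \<alpha> \<le> 4 * B * \<alpha>" "4 * \<beta> \<le> 4 * B * \<beta>" using ab B_ge_1 by auto
      ultimately show ?thesis using False by (simp add: fg_def gg_def condexp_outside mass_def)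
    qed
    then show "N (\<lambda>j. fg j x) \<le> 4 * B * \<alpha>" "N' (\<lambda>j. gg j x) \<le> 4 * B * \<beta>" by auto
  qed
  have mass_U: "(\<Sum>J\<in>\<J>. t J) \<le> t Q" if t: "t = mass N f \<or> t = mass N' g" for t
  proof -
    obtain u where u: "t = sum u" "\<And>x. 0 \<le> u x"
      using t N_nonneg N'_nonneg unfolding mass_def fun_eq_iff by metis
    have "(\<Sum>J\<in>\<J>. t J) = sum u (\<Union>\<J>)"
      unfolding u(1) using dis JD finite_cube unfolding pairwise_def disjnt_def
      by (subst sum.Union_disjoint) auto
    also have "\<dots> \<le> sum u Q" using UQ finite_cube[OF Q] u(2) by (intro sum_mono2) auto
    finally show ?thesis by (simp add: u(1))
  qed
  have gg_mass: "mass N' g I \<le> 4 * \<beta> * card I" "mass N fg I \<le> 4 * B * \<alpha> * card I" if I: "I \<in> U" for I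
  proof -
    show "mass N' g I \<le> 4 * \<beta> * card I" using U'[of I] I by (auto simp: U_def)
    have "mass N fg I \<le> (\<Sum>x\<in>I. 4 * B * \<alpha>)"
      unfolding mass_def using I good by (intro sum_mono) (auto simp: U_def)
    then show "mass N fg I \<le> 4 * B * \<alpha> * card I" by (simp add: mult.commute)
  qed
  have total: "\<alpha> * \<beta> * card Q = mass N f Q * mass N' g Q / card Q"
    using cQ by (simp add: \<alpha>_def \<beta>_def)
  have 1: "\<bar>\<Sum>I\<in>U. block L k h I fb g\<bar> \<le> 8 * \<kappa> * (\<alpha> * \<beta> * card Q)"
  proof -
    have "\<bar>\<Sum>I\<in>U. block L k h I fb g\<bar> \<le> \<kappa> * (4 * \<beta>) * (\<Sum>J\<in>\<J>. mass N fb J)"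
      unfolding fb_def fg_def
      by (rule cancellation_le[OF Q JD dis U_def])
        (use gg_mass ab condexp_bad_part(1,2)[OF JD dis] in auto)
    also have "\<dots> \<le> \<kappa> * (4 * \<beta>) * (\<Sum>J\<in>\<J>. 2 * mass N f J)"
      unfolding fb_def fg_def using ab \<kappa> condexp_bad_part(3)[OF JD dis]
      by (intro mult_left_mono sum_mono) auto
    also have "\<dots> \<le> \<kappa> * (4 * \<beta>) * (2 * mass N f Q)"
      unfolding sum_distrib_left[symmetric] using ab \<kappa> mass_U by (intro mult_left_mono) auto
    also have "\<dots> = 8 * \<kappa> * (\<alpha> * \<beta> * card Q)" using cQ by (simp add: \<alpha>_def)
    finally show ?thesis .
  qed
  have 2: "\<bar>\<Sum>I\<in>U. block L k h I fg gb\<bar> \<le> 8 * B * \<kappa> * (\<alpha> * \<beta> * card Q)"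
  proof -
    have "\<bar>\<Sum>I\<in>U. block L h k I gb fg\<bar> \<le> \<kappa> * (4 * B * \<alpha>) * (\<Sum>J\<in>\<J>. mass N' gb J)"
      unfolding gb_def gg_def
      by (rule sw.cancellation_le[OF Q JD dis U_def])
        (use gg_mass ab B sw.condexp_bad_part(1,2)[OF JD dis] in auto)
    also have "\<dots> \<le> \<kappa> * (4 * B * \<alpha>) * (\<Sum>J\<in>\<J>. 2 * mass N' g J)"
      unfolding gb_def gg_def using ab \<kappa> B sw.condexp_bad_part(3)[OF JD dis]
      by (intro mult_left_mono sum_mono) auto
    also have "\<dots> \<le> \<kappa> * (4 * B * \<alpha>) * (2 * mass N' g Q)"
      unfolding sum_distrib_left[symmetric] using ab \<kappa> B mass_U by (intro mult_left_mono) auto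
    also have "\<dots> = 8 * B * \<kappa> * (\<alpha> * \<beta> * card Q)" using cQ by (simp add: \<beta>_def)
    finally show ?thesis by (simp add: block_swap)
  qed
  have 3: "\<bar>\<Sum>I\<in>U. block L k h I fg gg\<bar> \<le> 32 * B\<^sup>2 * A * (\<alpha> * \<beta> * card Q)"
  proof -
    define c where "c = A * (4 * B * \<alpha>) * (4 * B * \<beta>)"
    have c: "0 \<le> c" using A B ab by (simp add: c_def)
    have t: "\<bar>form D L k h J fg gg\<bar> \<le> c * card J" if "J \<in> D" "J \<subseteq> Q" for J
      unfolding c_def using that good ab B by (intro test) auto
    have "\<bar>\<Sum>I\<in>U. block L k h I fg gg\<bar>
        \<le> \<bar>form D L k h Q fg gg\<bar> + (\<Sum>J\<in>\<J>. \<bar>form D L k h J fg gg\<bar>)"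
      unfolding split
      using sum_abs[of "\<lambda>J. form D L k h J fg gg" \<J>] by linarith
    also have "\<dots> \<le> c * card Q + (\<Sum>J\<in>\<J>. c * card J)"
      using t Q JD JQ by (intro add_mono sum_mono) auto
    also have "(\<Sum>J\<in>\<J>. c * card J) = c * card (\<Union>\<J>)"
      using JD finite_cube dis
      by (subst card_Union_disjoint) (auto simp: sum_distrib_left pairwise_def disjnt_def)
    also have "\<dots> \<le> c * card Q"
      using c UQ finite_cube[OF Q] by (auto intro!: mult_left_mono card_mono)
    finally show ?thesis by (simp add: c_def power2_eq_square mult_ac)
  qed
  have "(\<Sum>I\<in>U. block L k h I f g) = (\<Sum>I\<in>U. block L k h I fb g)
      + ((\<Sum>I\<in>U. block L k h I fg gb) + (\<Sum>I\<in>U. block L k h I fg gg))"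
  proof -
    have f: "f = (\<lambda>j x. fb j x + fg j x)" and g: "g = (\<lambda>j x. gb j x + gg j x)"
      by (auto simp: fb_def gb_def)
    have "block L k h I f g = block L k h I fb g + (block L k h I fg gb + block L k h I fg gg)" for I
      using block_add_left[of L k h I fb fg g] block_add_right[of L k h I fg gb gg]
      unfolding f[symmetric] g[symmetric] by simp
    then show ?thesis by (simp add: sum.distrib)
  qed
  then have "\<bar>\<Sum>I\<in>U. block L k h I f g\<bar>
      \<le> (8 * \<kappa> + 8 * B * \<kappa> + 32 * B\<^sup>2 * A) * (\<alpha> * \<beta> * card Q)"
    using 1 2 3 by (simp add: algebra_simps)
  also have "\<dots> \<le> (32 * B\<^sup>2 * (A + \<kappa>)) * (\<alpha> * \<beta> * card Q)"
  proof (rule mult_right_mono)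
    have "B \<le> B\<^sup>2" "1 \<le> B\<^sup>2" using B_ge_1 by (auto simp: power2_eq_square mult_le_cancel_left1)
       (metis B_ge_1 mult_mono' mult_1 zero_le_one)
    then have "8 * \<kappa> + 8 * B * \<kappa> \<le> 8 * B\<^sup>2 * \<kappa> + 8 * B\<^sup>2 * \<kappa>"
      using \<kappa> by (intro add_mono mult_right_mono) auto
    also have "\<dots> \<le> 32 * B\<^sup>2 * \<kappa>" using \<kappa> by simp
    finally show "8 * \<kappa> + 8 * B * \<kappa> + 32 * B\<^sup>2 * A \<le> 32 * B\<^sup>2 * (A + \<kappa>)"
      by (simp add: algebra_simps)
  qed (use ab cQ in auto)
  finally show ?thesis
    unfolding split total
    using JD dis JQ half by (intro that[of \<J>]) auto
qed

end

section \<open>Weighted bounds on a finite tree\<close>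

definition tree_const :: "real \<Rightarrow> real \<Rightarrow> real" where
  "tree_const p B = 32 * B\<^sup>2 * 2 powr (max p (p / (p - 1)) - 1) *
     max (2 powr p / (p - 1)) (2 powr (p / (p - 1)) / (p / (p - 1) - 1))"

lemma tree_const_pos: "1 < p \<Longrightarrow> 1 \<le> B \<Longrightarrow> 0 < tree_const p B"
  unfolding tree_const_def by (intro mult_pos_pos) (auto simp: less_max_iff_disj)

lemma form_scale:
  "form D L k h Q (\<lambda>j x. a * f j x) (\<lambda>j x. b * g j x) = a * b * form D L k h Q f g"
proof -
  have "(\<Sum>x\<in>I. a * f j x * k j I x) = a * (\<Sum>x\<in>I. f j x * k j I x)"
    "(\<Sum>x\<in>I. b * g j x * h j I x) = b * (\<Sum>x\<in>I. g j x * h j I x)" for j I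
    by (simp_all add: sum_distrib_left mult.assoc)
  then have "block L k h I (\<lambda>j x. a * f j x) (\<lambda>j x. b * g j x) = a * b * block L k h I f g" for I
    by (simp add: block_def sum_distrib_left mult_ac)
  then show ?thesis by (simp add: form_def sum_distrib_left)
qed

lemma dual_norms_abs: "dual_norms {j} (\<lambda>u. \<bar>u j\<bar>) (\<lambda>u. \<bar>u j\<bar>)"
proof
  show "\<exists>v. \<bar>v j\<bar> \<le> (1::real) \<and> (\<Sum>j\<in>{j}. u j * v j) = \<bar>u j\<bar>" for u
    by (rule exI[of _ "\<lambda>_. sgn (u j)"]) (auto simp: sgn_if)
  show "\<exists>u. \<bar>u j\<bar> \<le> (1::real) \<and> (\<Sum>j\<in>{j}. u j * v j) = \<bar>v j\<bar>" for v
    by (rule exI[of _ "\<lambda>_. sgn (v j)"]) (auto simp: sgn_if)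
qed auto

text \<open>The value at the leaf \<open>y\<close> of the part of \<open>S\<^sup>j f\<^sub>j\<close> that comes from the subcubes of \<open>Q\<close>.\<close>
definition apply_shift where
  "apply_shift D k h Q f j y = (\<Sum>I | I \<in> D \<and> I \<subseteq> Q \<and> y \<in> I. (\<Sum>x\<in>I. f j x * k j I x) * (h j I y :: real))"

context haar_tree
begin

text \<open>The form is bounded by a multiple of the sum of the Bellman functions of \<open>(f, \<sigma>, p)\<close> and \<open>(g, w, q)\<close>, by induction on
  \<open>Q\<close>: the error of the local step is at most that multiple of the decrease of the Bellman functions from \<open>Q\<close> to
  the stopping cubes.\<close>
theorem weighted_form_bound:
  fixes p A W :: real and w \<sigma> :: "'x \<Rightarrow> real"
  assumes p: "1 < p" and A: "0 \<le> A" and W: "0 \<le> W"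
    and test: "\<And>J f g s t. J \<in> D \<Longrightarrow> 0 < s \<Longrightarrow> 0 < t \<Longrightarrow> (\<And>x. x \<in> J \<Longrightarrow> N (\<lambda>j. f j x) \<le> s) \<Longrightarrow>
      (\<And>x. x \<in> J \<Longrightarrow> N' (\<lambda>j. g j x) \<le> t) \<Longrightarrow> \<bar>form D L k h J f g\<bar> \<le> A * s * t * card J"
    and w: "\<And>Q x. Q \<in> D \<Longrightarrow> x \<in> Q \<Longrightarrow> 0 < w x" and \<sigma>: "\<And>Q x. Q \<in> D \<Longrightarrow> x \<in> Q \<Longrightarrow> 0 < \<sigma> x"
    and w\<sigma>: "\<And>Q x. Q \<in> D \<Longrightarrow> x \<in> Q \<Longrightarrow> 1 \<le> w x * \<sigma> x powr (p - 1)"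
    and Ap: "\<And>Q. Q \<in> D \<Longrightarrow> sum w Q * sum \<sigma> Q powr (p - 1) \<le> W * real (card Q) powr p"
    and Q: "Q \<in> D"
  shows "\<bar>form D L k h Q f g\<bar> \<le> tree_const p B * (A + \<kappa>) * W powr (max 1 (1 / (p - 1))) *
    ((\<Sum>x\<in>Q. N (\<lambda>j. f j x) powr p / \<sigma> x powr (p - 1)) +
     (\<Sum>x\<in>Q. N' (\<lambda>j. g j x) powr (p / (p - 1)) / w x powr (p / (p - 1) - 1)))"
proof -
  define q where "q = p / (p - 1)"
  have q: "1 < q" using p by (simp add: q_def)
  define M where "M = max (2 powr p / (p - 1)) (2 powr q / (q - 1))"
  define c where "c = 32 * B\<^sup>2 * (A + \<kappa>) * (2 powr (max p q - 1) * W powr (max 1 (1 / (p - 1))))"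
  define K where "K = c * M"
  define a where "a = (\<lambda>x. N (\<lambda>j. f j x))"
  define b where "b = (\<lambda>x. N' (\<lambda>j. g j x))"
  have \<kappa>: "0 \<le> \<kappa>" using kappa_nonneg Q by auto
  have c: "0 \<le> c" using A \<kappa> by (simp add: c_def)
  have M: "0 < M" using p by (auto simp: M_def less_max_iff_disj)
  have K: "0 \<le> K" using c M by (simp add: K_def)
  have a0: "0 \<le> a x" and b0: "0 \<le> b x" for x by (auto simp: a_def b_def N_nonneg N'_nonneg)
  have main: "\<bar>form D L k h Q f g\<bar> \<le> K * (bellman p a \<sigma> Q + bellman q b w Q)"
    using finite_cube[OF Q] Q
  proof (induction Q rule: finite_psubset_induct)
    case (psubset Q)
    note Q = psubset.prems
    have "\<exists>\<J>. \<J> \<subseteq> D \<and> disjoint \<J> \<and> (\<forall>J\<in>\<J>. J \<subset> Q) \<and>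
        real (card Q) \<le> 2 * real (card (Q - \<Union>\<J>)) \<and>
        \<bar>form D L k h Q f g - (\<Sum>J\<in>\<J>. form D L k h J f g)\<bar>
          \<le> 32 * B\<^sup>2 * (A + \<kappa>) * (mass N f Q * mass N' g Q / card Q)"
    proof (rule local_step[OF Q A, where f = f and g = g])
      show "\<bar>form D L k h J f g\<bar> \<le> A * s * t * card J"
        if "J \<in> D" "0 < s" "0 < t" "\<And>x. x \<in> J \<Longrightarrow> N (\<lambda>j. f j x) \<le> s"
          "\<And>x. x \<in> J \<Longrightarrow> N' (\<lambda>j. g j x) \<le> t" for J f g s t
        using that by (rule test)
    qed blast
    then obtain \<J> where J: "\<J> \<subseteq> D" "disjoint \<J>" "\<And>J. J \<in> \<J> \<Longrightarrow> J \<subset> Q"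
      and half: "real (card Q) \<le> 2 * real (card (Q - \<Union>\<J>))"
      and diff: "\<bar>form D L k h Q f g - (\<Sum>J\<in>\<J>. form D L k h J f g)\<bar>
        \<le> 32 * B\<^sup>2 * (A + \<kappa>) * (mass N f Q * mass N' g Q / card Q)"
      by blast
    define E where "E = Q - \<Union>\<J>"
    have cQ: "0 < real (card Q)" by (rule card_pos[OF Q])
    have E: "finite E" "E \<noteq> {}" "E \<subseteq> Q"
      using half cQ finite_cube[OF Q] unfolding E_def by (fastforce dest: arg_cong[of _ _ card])+
    have pos: "0 < sum \<sigma> E" "0 < sum w E"
      using E \<sigma>[OF Q] w[OF Q] by (auto intro!: sum_pos)
    have mono: "sum \<sigma> E \<le> sum \<sigma> Q" "sum w E \<le> sum w Q"
      using E finite_cube[OF Q] \<sigma>[OF Q] w[OF Q] by (auto simp: less_imp_le intro!: sum_mono2)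
    have "real (card E) powr p / sum \<sigma> E powr (p - 1) \<le> (\<Sum>x\<in>E. 1 powr p / \<sigma> x powr (p - 1))"
      using sum_powr_quotient_ge[OF p E(1,2), of "\<lambda>_. 1" \<sigma>] \<sigma>[OF Q] E by auto
    also have "\<dots> \<le> sum w E"
    proof (rule sum_mono)
      fix x assume "x \<in> E"
      then have "x \<in> Q" using E by auto
      then show "1 powr p / \<sigma> x powr (p - 1) \<le> w x"
        using w\<sigma>[OF Q, of x] \<sigma>[OF Q, of x] by (simp add: divide_le_eq)
    qed
    finally have cardE: "real (card E) powr p \<le> sum w E * sum \<sigma> E powr (p - 1)"
      using pos by (simp add: pos_divide_le_eq)
    have "mass N f Q * mass N' g Q / card Q = sum a Q * sum b Q / card Q"
      by (simp add: mass_def a_def b_def)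
    also have "\<dots> \<le> 2 powr (max p q - 1) * W powr (max 1 (1 / (p - 1))) *
       ((sum a Q / sum \<sigma> Q) powr p * sum \<sigma> E + (sum b Q / sum w Q) powr q * sum w E)"
      unfolding q_def
      by (rule weight_step[OF p cQ half[folded E_def] W pos mono cardE Ap[OF Q]])
        (auto intro: sum_nonneg a0 b0)
    finally have "32 * B\<^sup>2 * (A + \<kappa>) * (mass N f Q * mass N' g Q / card Q) \<le>
        32 * B\<^sup>2 * (A + \<kappa>) * \<dots>"
      using A \<kappa> by (intro mult_left_mono) auto
    also have "\<dots> = c * ((sum a Q / sum \<sigma> Q) powr p * sum \<sigma> E + (sum b Q / sum w Q) powr q * sum w E)"
      by (simp only: c_def mult.assoc)
    also have "\<dots> \<le> c * (M * (bellman p a \<sigma> Q - (\<Sum>J\<in>\<J>. bellman p a \<sigma> J)) +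
        M * (bellman q b w Q - (\<Sum>J\<in>\<J>. bellman q b w J)))"
    proof (intro mult_left_mono add_mono c)
      have step: "X \<le> M * Z"
        if XZ: "(e - 1) / 2 powr e * X \<le> Z" and X: "0 \<le> X" and e: "1 < e" "2 powr e / (e - 1) \<le> M" for e X Z
      proof -
        have "X = 2 powr e / (e - 1) * ((e - 1) / 2 powr e * X)" using e by simp
        also have "\<dots> \<le> M * Z"
          using XZ X e M by (intro mult_mono) auto
        finally show ?thesis .
      qed
      have ne: "J \<noteq> {}" if "J \<in> \<J>" for J using that J cube_nonempty by blast
      have sub: "\<Union>\<J> \<subseteq> Q" using J by blast
      show "(sum a Q / sum \<sigma> Q) powr p * sum \<sigma> E \<le> M * (bellman p a \<sigma> Q - (\<Sum>J\<in>\<J>. bellman p a \<sigma> J))"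
        unfolding E_def
        by (rule step[OF bellman_step[OF p finite_cube[OF Q] sub J(2) ne]])
          (use p pos cube_nonempty[OF Q] a0 \<sigma>[OF Q] in \<open>auto simp: M_def E_def\<close>)
      show "(sum b Q / sum w Q) powr q * sum w E \<le> M * (bellman q b w Q - (\<Sum>J\<in>\<J>. bellman q b w J))"
        unfolding E_def
        by (rule step[OF bellman_step[OF q finite_cube[OF Q] sub J(2) ne]])
          (use q pos cube_nonempty[OF Q] b0 w[OF Q] in \<open>auto simp: M_def E_def\<close>)
    qed
    also have "\<dots> = K * (bellman p a \<sigma> Q + bellman q b w Q) -
        (\<Sum>J\<in>\<J>. K * (bellman p a \<sigma> J + bellman q b w J))"
      by (simp add: K_def algebra_simps sum_distrib_left sum.distrib)
    finally have "\<bar>form D L k h Q f g - (\<Sum>J\<in>\<J>. form D L k h J f g)\<bar> \<le>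
        K * (bellman p a \<sigma> Q + bellman q b w Q) - (\<Sum>J\<in>\<J>. K * (bellman p a \<sigma> J + bellman q b w J))"
      using diff by linarith
    moreover have "\<bar>\<Sum>J\<in>\<J>. form D L k h J f g\<bar> \<le> (\<Sum>J\<in>\<J>. K * (bellman p a \<sigma> J + bellman q b w J))"
      using J by (intro order_trans[OF sum_abs] sum_mono psubset.IH) auto
    ultimately show ?case by linarith
  qed
  also have "\<dots> \<le> K * ((\<Sum>x\<in>Q. a x powr p / \<sigma> x powr (p - 1)) + (\<Sum>x\<in>Q. b x powr q / w x powr (q - 1)))"
    using K by (intro mult_left_mono add_mono bellman_le)
  also have "K = tree_const p B * (A + \<kappa>) * W powr (max 1 (1 / (p - 1)))"
    by (simp add: K_def c_def M_def tree_const_def q_def)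
  finally show ?thesis by (simp add: a_def b_def q_def)
qed

lemma haar_tree_scalar:
  assumes j: "j \<in> L"
  shows "haar_tree {j} (\<lambda>u. \<bar>u j\<bar>) (\<lambda>u. \<bar>u j\<bar>) D B k h \<kappa>"
proof -
  interpret s: dual_norms "{j}" "\<lambda>u. \<bar>u j\<bar>" "\<lambda>u. \<bar>u j\<bar>" by (rule dual_norms_abs)
  show ?thesis
  proof
    show "real (card {I \<in> D. J \<subset> I \<and> \<not> (\<forall>j\<in>{j}. k j I constant_on J \<and> h j I constant_on J)}) \<le> \<kappa>"
      if "J \<in> D" for J
    proof -
      have "card {I \<in> D. J \<subset> I \<and> \<not> (\<forall>j\<in>{j}. k j I constant_on J \<and> h j I constant_on J)}
        \<le> card {I \<in> D. J \<subset> I \<and> \<not> (\<forall>j\<in>L. k j I constant_on J \<and> h j I constant_on J)}"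
        using finite_D j by (intro card_mono) auto
      then show ?thesis using complexity[OF that] by linarith
    qed
  qed (use size j in auto)
qed

text \<open>The constant weights \<open>w = \<sigma> = 1\<close> have characteristic \<open>1\<close>. The right side is a sum of powers
  instead of a product of norms, and so it can be summed over \<open>j\<close> directly.\<close>
lemma scalar_form_bound:
  fixes r A :: real
  assumes r: "1 < r" and A: "0 \<le> A" and j: "j \<in> L"
    and test: "\<And>J f g. J \<in> D \<Longrightarrow> (\<And>x. x \<in> J \<Longrightarrow> \<bar>f j x\<bar> \<le> 1) \<Longrightarrow>
      (\<And>x. x \<in> J \<Longrightarrow> \<bar>g j x\<bar> \<le> 1) \<Longrightarrow> \<bar>form D {j} k h J f g\<bar> \<le> A * card J"
    and Q: "Q \<in> D"
  shows "\<bar>form D {j} k h Q f g\<bar> \<le> tree_const r B * (A + \<kappa>) *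
    (\<Sum>x\<in>Q. \<bar>f j x\<bar> powr r + \<bar>g j x\<bar> powr (r / (r - 1)))"
proof -
  interpret s: haar_tree "{j}" "\<lambda>u. \<bar>u j\<bar>" "\<lambda>u. \<bar>u j\<bar>" D B k h \<kappa>
    by (rule haar_tree_scalar[OF j])
  have "\<bar>form D {j} k h Q f g\<bar> \<le> tree_const r B * (A + \<kappa>) * 1 powr (max 1 (1 / (r - 1))) *
    ((\<Sum>x\<in>Q. \<bar>f j x\<bar> powr r / 1 powr (r - 1)) +
     (\<Sum>x\<in>Q. \<bar>g j x\<bar> powr (r / (r - 1)) / 1 powr (r / (r - 1) - 1)))"
  proof (rule s.weighted_form_bound[OF r A _ _ _ _ _ _ Q])
    fix J :: "'x set" and f g :: "'j \<Rightarrow> 'x \<Rightarrow> real" and s t :: real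
    assume J: "J \<in> D" and s: "0 < s" and t: "0 < t"
      and fs: "\<And>x. x \<in> J \<Longrightarrow> \<bar>f j x\<bar> \<le> s" and gt: "\<And>x. x \<in> J \<Longrightarrow> \<bar>g j x\<bar> \<le> t"
    have "form D {j} k h J f g = s * t * form D {j} k h J (\<lambda>j x. 1 / s * f j x) (\<lambda>j x. 1 / t * g j x)"
      using s t unfolding form_scale by simp
    moreover have "\<bar>form D {j} k h J (\<lambda>j x. 1 / s * f j x) (\<lambda>j x. 1 / t * g j x)\<bar> \<le> A * card J"
      using s t fs gt by (intro test[OF J]) auto
    ultimately show "\<bar>form D {j} k h J f g\<bar> \<le> A * s * t * card J"
      using s t mult_left_mono[of _ "A * card J" "s * t"] by (simp add: abs_mult mult_ac)
  next
    fix Q assume "Q \<in> D"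
    then have c: "0 < real (card Q)" by (rule card_pos)
    have "real (card Q) * real (card Q) powr (r - 1) = real (card Q) powr (1 + (r - 1))"
      using c by (subst powr_add) simp
    then show "(\<Sum>x\<in>Q. 1) * (\<Sum>x\<in>Q. 1) powr (r - 1) \<le> 1 * real (card Q) powr r"
      by simp
  qed auto
  then show ?thesis by (simp add: sum.distrib)
qed

lemma form_sum_scalar: "form D L k h Q f g = (\<Sum>j\<in>L. form D {j} k h Q f g)"
  unfolding form_def block_def by (subst sum.swap) simp

lemma form_eq_apply_shift:
  assumes Q: "Q \<in> D"
  shows "form D L k h Q f g = (\<Sum>y\<in>Q. \<Sum>j\<in>L. apply_shift D k h Q f j y * g j y)"
proof -
  define S where "S = {I. I \<in> D \<and> I \<subseteq> Q}"
  define P where "P j I = (\<Sum>x\<in>I. f j x * k j I x)" for j I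
  have finS: "finite S" using finite_D by (simp add: S_def)
  have "form D L k h Q f g = (\<Sum>I\<in>S. \<Sum>j\<in>L. \<Sum>y | y \<in> Q \<and> y \<in> I. P j I * (g j y * h j I y))"
    unfolding form_def block_def S_def[symmetric] P_def[symmetric] sum_distrib_left
    by (intro sum.cong refl) (auto simp: S_def)
  also have "\<dots> = (\<Sum>j\<in>L. \<Sum>I\<in>S. \<Sum>y | y \<in> Q \<and> y \<in> I. P j I * (g j y * h j I y))"
    by (rule sum.swap)
  also have "\<dots> = (\<Sum>j\<in>L. \<Sum>y\<in>Q. \<Sum>I | I \<in> S \<and> y \<in> I. P j I * (g j y * h j I y))"
    by (intro sum.cong refl sum.swap_restrict finS finite_cube[OF Q])
  also have "\<dots> = (\<Sum>j\<in>L. \<Sum>y\<in>Q. apply_shift D k h Q f j y * g j y)"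
    unfolding apply_shift_def P_def[symmetric] sum_distrib_right S_def
    by (intro sum.cong refl) (auto simp: mult_ac)
  finally show ?thesis by (subst sum.swap)
qed

end

definition lr :: "'j set \<Rightarrow> real \<Rightarrow> ('j \<Rightarrow> real) \<Rightarrow> real" where
  "lr L r u = (\<Sum>j\<in>L. \<bar>u j\<bar> powr r) powr (1 / r)"

lemma lr_nonneg: "0 \<le> lr L r u"
  by (simp add: lr_def)

lemma lr_powr: "r \<noteq> 0 \<Longrightarrow> lr L r u powr r = (\<Sum>j\<in>L. \<bar>u j\<bar> powr r)"
  by (simp add: lr_def powr_powr sum_nonneg)

lemma lr_holder:
  assumes r: "1 < r"
  shows "(\<Sum>j\<in>L. \<bar>u j\<bar> * \<bar>v j\<bar>) \<le> lr L r u * lr L (r / (r - 1)) v"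
proof (cases "finite L")
  case L: True
  define q where "q = r / (r - 1)"
  have q: "1 < q" "1 / r + 1 / q = 1" "q \<noteq> 0" using r by (auto simp: q_def field_simps)
  define s where "s = lr L r u"
  define t where "t = lr L q v"
  show ?thesis
  proof (cases "s = 0 \<or> t = 0")
    case True
    have "u j = 0 \<or> v j = 0" if "j \<in> L" for j
    proof (cases "s = 0")
      case True
      then have "(\<Sum>j\<in>L. \<bar>u j\<bar> powr r) = 0" by (simp add: s_def lr_def)
      with that L show ?thesis by (simp add: sum_nonneg_eq_0_iff)
    next
      case False
      with \<open>s = 0 \<or> t = 0\<close> have "(\<Sum>j\<in>L. \<bar>v j\<bar> powr q) = 0" by (simp add: t_def lr_def)
      with that L show ?thesis by (simp add: sum_nonneg_eq_0_iff)
    qed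
    then have "(\<Sum>j\<in>L. \<bar>u j\<bar> * \<bar>v j\<bar>) = 0" by (intro sum.neutral) auto
    then show ?thesis by (simp add: lr_nonneg)
  next
    case False
    then have pos: "0 < s" "0 < t" by (auto simp: s_def t_def lr_nonneg order_less_le)
    have "(\<Sum>j\<in>L. (\<bar>u j\<bar> / s) * (\<bar>v j\<bar> / t))
        \<le> (\<Sum>j\<in>L. (\<bar>u j\<bar> / s) powr r / r + (\<bar>v j\<bar> / t) powr q / q)"
      by (intro sum_mono Youngs_inequality) (use r q pos in auto)
    also have "\<dots> = (\<Sum>j\<in>L. \<bar>u j\<bar> powr r) / s powr r / r + (\<Sum>j\<in>L. \<bar>v j\<bar> powr q) / t powr q / q"
      using pos by (simp add: sum.distrib sum_divide_distrib powr_divide)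
    also have "\<dots> = 1"
      using pos r q by (simp add: s_def t_def lr_powr[symmetric])
    finally have "(\<Sum>j\<in>L. \<bar>u j\<bar> * \<bar>v j\<bar>) / (s * t) \<le> 1"
      by (simp add: sum_divide_distrib)
    then show ?thesis using pos by (simp add: s_def t_def q_def pos_divide_le_eq)
  qed
qed (simp add: lr_nonneg)

lemma lr_norming:
  assumes r: "1 < r" and L: "finite L"
  shows "\<exists>v. lr L (r / (r - 1)) v \<le> 1 \<and> (\<Sum>j\<in>L. u j * v j) = lr L r u"
proof (cases "lr L r u = 0")
  case True
  then show ?thesis using r by (intro exI[of _ "\<lambda>_. 0"]) (auto simp: lr_def)
next
  case False
  define s where "s = lr L r u"
  have s: "0 < s" using False lr_nonneg[of L r u] by (simp add: s_def)
  have sr: "(\<Sum>j\<in>L. \<bar>u j\<bar> powr r) = s powr r" using r by (simp add: s_def lr_powr)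
  define v where "v = (\<lambda>j. sgn (u j) * (\<bar>u j\<bar> / s) powr (r - 1))"
  have "\<bar>v j\<bar> powr (r / (r - 1)) = \<bar>u j\<bar> powr r / s powr r" for j
    using r s by (cases "u j = 0") (simp_all add: v_def abs_mult powr_powr powr_divide)
  then have "(\<Sum>j\<in>L. \<bar>v j\<bar> powr (r / (r - 1))) = 1"
    using s by (simp add: sum_divide_distrib[symmetric] sr)
  then have "lr L (r / (r - 1)) v = 1" by (simp add: lr_def)
  moreover have "u j * v j = \<bar>u j\<bar> powr r / s powr (r - 1)" for j
  proof -
    have "u j * v j = \<bar>u j\<bar> * \<bar>u j\<bar> powr (r - 1) / s powr (r - 1)"
      using s by (simp add: v_def powr_divide sgn_if)
    then show ?thesis by (cases "u j = 0") (simp_all add: powr_diff)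
  qed
  then have "(\<Sum>j\<in>L. u j * v j) = s powr r / s powr (r - 1)"
    by (simp add: sum_divide_distrib[symmetric] sr)
  ultimately show ?thesis using s by (intro exI[of _ v]) (simp add: s_def[symmetric] powr_diff)
qed

lemma dual_norms_lr:
  assumes r: "1 < r" and L: "finite L"
  shows "dual_norms L (lr L r) (lr L (r / (r - 1)))"
proof
  have q: "1 < r / (r - 1)" "r / (r - 1) / (r / (r - 1) - 1) = r"
    using r by (auto simp: field_simps)
  show "\<exists>v. lr L (r / (r - 1)) v \<le> 1 \<and> (\<Sum>j\<in>L. u j * v j) = lr L r u" for u
    by (rule lr_norming[OF r L])
  show "\<exists>u. lr L r u \<le> 1 \<and> (\<Sum>j\<in>L. u j * v j) = lr L (r / (r - 1)) v" for v
    using lr_norming[OF q(1) L, of v] unfolding q(2) by (simp add: mult.commute)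
qed (use L lr_nonneg lr_holder[OF r] in auto)

locale lr_haar_tree = haar_tree L "lr L r" "lr L (r / (r - 1))" D B k h \<kappa>
  for L :: "'j set" and r :: real and D :: "'x set set" and B and k h :: "'j \<Rightarrow> 'x set \<Rightarrow> 'x \<Rightarrow> real" and \<kappa> +
  fixes A :: real
  assumes r: "1 < r" and A_nonneg: "0 \<le> A"
    and test: "\<And>j J f g. j \<in> L \<Longrightarrow> J \<in> D \<Longrightarrow> (\<And>x. x \<in> J \<Longrightarrow> \<bar>f j x\<bar> \<le> 1) \<Longrightarrow>
      (\<And>x. x \<in> J \<Longrightarrow> \<bar>g j x\<bar> \<le> 1) \<Longrightarrow> \<bar>form D {j} k h J f g\<bar> \<le> A * card J"
begin

text \<open>If \<open>f(x)\<close> and \<open>g(x)\<close> lie in the unit balls of \<open>\<ell>\<^sup>r\<close> and its dual, then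
  the scalar bounds add up to a multiple of the volume.\<close>
lemma vector_test:
  assumes J: "J \<in> D" and s: "0 < s" and t: "0 < t"
    and f: "\<And>x. x \<in> J \<Longrightarrow> lr L r (\<lambda>j. f j x) \<le> s"
    and g: "\<And>x. x \<in> J \<Longrightarrow> lr L (r / (r - 1)) (\<lambda>j. g j x) \<le> t"
  shows "\<bar>form D L k h J f g\<bar> \<le> 2 * tree_const r B * (A + \<kappa>) * s * t * card J"
proof -
  define K where "K = tree_const r B * (A + \<kappa>)"
  define q where "q = r / (r - 1)"
  have q: "0 < q" using r by (simp add: q_def)
  have K: "0 \<le> K"
    using tree_const_pos[OF r B_ge_1] A_nonneg kappa_nonneg J
    unfolding K_def by (intro mult_nonneg_nonneg add_nonneg_nonneg) auto
  \<comment> \<open>Normalized to the unit balls.\<close>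
  define f' where "f' = (\<lambda>j x. 1 / s * f j x)"
  define g' where "g' = (\<lambda>j x. 1 / t * g j x)"
  have le1: "(\<Sum>j\<in>L. \<bar>1 / c * u j\<bar> powr e) \<le> 1" if "lr L e u \<le> c" "0 < c" "0 < e" for u c e
  proof -
    have "(\<Sum>j\<in>L. \<bar>1 / c * u j\<bar> powr e) = lr L e u powr e / c powr e"
      using that by (simp add: lr_powr powr_divide sum_divide_distrib)
    also have "\<dots> \<le> 1"
      using that powr_mono2[of e "lr L e u" c] lr_nonneg[of L e u] by simp
    finally show ?thesis .
  qed
  have "\<bar>form D L k h J f' g'\<bar> \<le> (\<Sum>j\<in>L. \<bar>form D {j} k h J f' g'\<bar>)"
    unfolding form_sum_scalar[of J f' g'] by (rule sum_abs)
  also have "\<dots> \<le> (\<Sum>j\<in>L. K * (\<Sum>x\<in>J. \<bar>f' j x\<bar> powr r + \<bar>g' j x\<bar> powr q))"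
    unfolding K_def q_def
    by (intro sum_mono scalar_form_bound[OF r A_nonneg _ test J]) auto
  also have "\<dots> = K * (\<Sum>x\<in>J. (\<Sum>j\<in>L. \<bar>f' j x\<bar> powr r) + (\<Sum>j\<in>L. \<bar>g' j x\<bar> powr q))"
    unfolding sum_distrib_left[symmetric] by (subst sum.swap) (simp add: sum.distrib)
  also have "\<dots> \<le> K * (\<Sum>x\<in>J. 1 + 1)"
    using K f g s t r q unfolding f'_def g'_def
    by (intro mult_left_mono sum_mono add_mono le1) (auto simp: q_def)
  finally have "\<bar>form D L k h J f' g'\<bar> \<le> K * (2 * card J)" by simp
  moreover have "form D L k h J f g = s * t * form D L k h J f' g'"
    using s t unfolding f'_def g'_def form_scale by simp
  ultimately show ?thesis
    using s t mult_left_mono[of _ "K * (2 * card J)" "s * t"] by (simp add: K_def abs_mult mult_ac)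
qed

text \<open>Inserting the extremal \<open>g\<close> into the bound for the form gives an inequality \<open>G \<le> K F + K G\<close> between
  the two sides. Replacing \<open>(f, g)\<close> by \<open>(\<tau> f, g / \<tau>)\<close> lowers the coefficient of \<open>G\<close> on the right to
  \<open>1/2\<close>, and \<open>G\<close>, a finite number, can be absorbed.\<close>
theorem weighted_shift_bound:
  fixes p W :: real and w \<sigma> :: "'x \<Rightarrow> real"
  assumes p: "1 < p" and W: "0 < W" and \<kappa>: "0 < \<kappa>"
    and w: "\<And>Q x. Q \<in> D \<Longrightarrow> x \<in> Q \<Longrightarrow> 0 < w x" and \<sigma>: "\<And>Q x. Q \<in> D \<Longrightarrow> x \<in> Q \<Longrightarrow> 0 < \<sigma> x"
    and w\<sigma>: "\<And>Q x. Q \<in> D \<Longrightarrow> x \<in> Q \<Longrightarrow> 1 \<le> w x * \<sigma> x powr (p - 1)"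
    and Ap: "\<And>Q. Q \<in> D \<Longrightarrow> sum w Q * sum \<sigma> Q powr (p - 1) \<le> W * real (card Q) powr p"
    and Q: "Q \<in> D"
  shows "(\<Sum>x\<in>Q. lr L r (\<lambda>j. apply_shift D k h Q f j x) powr p * w x)
    \<le> (2 * (tree_const p B * (2 * tree_const r B * (A + \<kappa>) + \<kappa>) * W powr (max 1 (1 / (p - 1))))) powr p *
      (\<Sum>x\<in>Q. lr L r (\<lambda>j. f j x) powr p / \<sigma> x powr (p - 1))"
proof -
  define K where "K = tree_const p B * (2 * tree_const r B * (A + \<kappa>) + \<kappa>) * W powr (max 1 (1 / (p - 1)))"
  define T where "T = apply_shift D k h Q f"
  define n where "n = (\<lambda>x. lr L r (\<lambda>j. T j x))"
  define F where "F = (\<Sum>x\<in>Q. lr L r (\<lambda>j. f j x) powr p / \<sigma> x powr (p - 1))"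
  define G where "G = (\<Sum>x\<in>Q. n x powr p * w x)"
  define p' where "p' = p / (p - 1)"
  have p': "1 < p'" using p by (simp add: p'_def)
  have A2: "0 \<le> 2 * tree_const r B * (A + \<kappa>)"
    using tree_const_pos[OF r B_ge_1] A_nonneg \<kappa> by (intro mult_nonneg_nonneg add_nonneg_nonneg) auto
  have K: "0 < K"
    using tree_const_pos[OF p B_ge_1] A2 \<kappa> W unfolding K_def
    by (intro mult_pos_pos add_nonneg_pos) auto
  \<comment> \<open>The extremal dual function, with dual norm \<open>w(x) n(x) powr (p - 1)\<close>.\<close>
  define g where "g = (\<lambda>j x. w x * n x powr (p - r) * (sgn (T j x) * \<bar>T j x\<bar> powr (r - 1)))"
  have n0: "0 \<le> n x" for x by (simp add: n_def lr_nonneg)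
  have nr: "(\<Sum>j\<in>L. \<bar>T j x\<bar> powr r) = n x powr r" for x
    using r by (simp add: n_def lr_powr)
  have Tg: "(\<Sum>j\<in>L. T j x * g j x) = n x powr p * w x" for x
  proof -
    have "T j x * g j x = w x * n x powr (p - r) * \<bar>T j x\<bar> powr r" for j
    proof -
      have "T j x * g j x = w x * n x powr (p - r) * (\<bar>T j x\<bar> * \<bar>T j x\<bar> powr (r - 1))"
        by (simp add: g_def sgn_if)
      then show ?thesis by (cases "T j x = 0") (simp_all add: powr_diff)
    qed
    then have "(\<Sum>j\<in>L. T j x * g j x) = w x * n x powr (p - r) * n x powr r"
      by (simp add: sum_distrib_left[symmetric] nr)
    then show ?thesis by (simp add: powr_add[symmetric])
  qed
  have g': "lr L (r / (r - 1)) (\<lambda>j. g j x) = w x * n x powr (p - 1)" if x: "x \<in> Q" for x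
  proof -
    have w0: "0 < w x" using w Q x by auto
    have "\<bar>g j x\<bar> powr (r / (r - 1)) = (w x * n x powr (p - r)) powr (r / (r - 1)) * \<bar>T j x\<bar> powr r" for j
      using r w0 by (cases "T j x = 0") (simp_all add: g_def abs_mult powr_mult powr_powr)
    then have "lr L (r / (r - 1)) (\<lambda>j. g j x)
        = ((w x * n x powr (p - r)) powr (r / (r - 1)) * n x powr r) powr ((r - 1) / r)"
      by (simp add: lr_def sum_distrib_left[symmetric] nr)
    also have "\<dots> = w x * n x powr (p - r) * n x powr (r - 1)"
      using r w0 by (simp add: powr_mult powr_powr)
    also have "\<dots> = w x * n x powr (p - 1)" by (simp add: powr_add[symmetric])
    finally show ?thesis .
  qed
  have G: "G = form D L k h Q f g"
    unfolding G_def form_eq_apply_shift[OF Q] T_def[symmetric] by (simp add: Tg)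
  have G0: "0 \<le> G" using w[OF Q] by (auto simp: G_def less_imp_le intro!: sum_nonneg mult_nonneg_nonneg)
  \<comment> \<open>With this \<open>\<tau>\<close> the term with \<open>g / \<tau>\<close> equals \<open>G / (2 K)\<close>.\<close>
  define \<tau> where "\<tau> = (2 * K) powr (1 / p')"
  have \<tau>: "0 < \<tau>" "\<tau> powr p' = 2 * K"
    using K p' by (auto simp: \<tau>_def powr_powr)
  have "form D L k h Q f g = form D L k h Q (\<lambda>j x. \<tau> * f j x) (\<lambda>j x. 1 / \<tau> * g j x)"
    using \<tau> unfolding form_scale by simp
  also have "\<dots> \<le> \<bar>\<dots>\<bar>" by simp
  also have "\<dots> \<le> K * ((\<Sum>x\<in>Q. lr L r (\<lambda>j. \<tau> * f j x) powr p / \<sigma> x powr (p - 1)) +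
     (\<Sum>x\<in>Q. lr L (r / (r - 1)) (\<lambda>j. 1 / \<tau> * g j x) powr p' / w x powr (p' - 1)))"
    unfolding K_def p'_def
    using W by (intro weighted_form_bound[OF p A2 _ vector_test w \<sigma> w\<sigma> Ap Q]) auto
  also have "(\<Sum>x\<in>Q. lr L r (\<lambda>j. \<tau> * f j x) powr p / \<sigma> x powr (p - 1)) = \<tau> powr p * F"
  proof -
    have "lr L r (\<lambda>j. \<tau> * f j x) = \<tau> * lr L r (\<lambda>j. f j x)" for x
      using \<tau> r by (simp add: lr_def abs_mult powr_mult sum_distrib_left[symmetric] sum_nonneg powr_powr)
    then show ?thesis using \<tau> by (simp add: F_def powr_mult lr_nonneg sum_distrib_left)
  qed
  also have "(\<Sum>x\<in>Q. lr L (r / (r - 1)) (\<lambda>j. 1 / \<tau> * g j x) powr p' / w x powr (p' - 1)) = G / (2 * K)"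
  proof -
    have "lr L (r / (r - 1)) (\<lambda>j. 1 / \<tau> * g j x) powr p' / w x powr (p' - 1) = n x powr p * w x / (2 * K)"
      if x: "x \<in> Q" for x
    proof -
      have w0: "0 < w x" using w Q x by auto
      have "lr L (r / (r - 1)) (\<lambda>j. 1 / \<tau> * g j x) = lr L (r / (r - 1)) (\<lambda>j. g j x) / \<tau>"
        using \<tau> r by (simp add: lr_def powr_divide sum_divide_distrib[symmetric] sum_nonneg powr_powr)
      also have "\<dots> powr p' = w x powr p' * n x powr p / (2 * K)"
        using \<tau> w0 p by (simp add: g'[OF x] powr_divide powr_mult powr_powr p'_def)
      finally show ?thesis using w0 by (simp add: powr_diff)
    qed
    then show ?thesis by (simp add: G_def sum_divide_distrib)
  qed
  finally have "G \<le> K * (\<tau> powr p * F) + G / 2"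
    using K by (simp add: G[symmetric] distrib_left)
  then have "G \<le> (2 * K) * \<tau> powr p * F" by simp
  also have "(2 * K) * \<tau> powr p = (2 * K) powr p"
  proof -
    have "1 + p / p' = p" using p by (simp add: p'_def)
    then have "(2 * K) powr p = (2 * K) powr (1 + p / p')" by simp
    also have "\<dots> = (2 * K) * \<tau> powr p"
      using K by (simp add: \<tau>_def powr_powr powr_add)
    finally show ?thesis by simp
  qed
  finally show ?thesis unfolding G_def F_def K_def n_def T_def .
qed

end

section \<open>Geometry of the dyadic grid\<close>

definition grid_index :: "int \<Rightarrow> real^'n \<Rightarrow> int^'n" where
  "grid_index j x = (\<chi> i. \<lfloor>2 powi j * x $ i\<rfloor>)"

definition grid_point :: "int \<Rightarrow> int^'n \<Rightarrow> real^'n" where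
  "grid_point j m = (\<chi> i. 2 powi (- j) * real_of_int (m $ i))"

text \<open>The union of the cubes of side length \<open>2\<^sup>-\<^sup>j\<close> with indices in \<open>I\<close>. It turns the sets of leaves
  below back into cubes.\<close>
definition region :: "int \<Rightarrow> (int^'n) set \<Rightarrow> (real^'n) set" where
  "region j I = {x. grid_index j x \<in> I}"

lemma two_powi_cancel: "2 powi j * (2 powi (- j) * x) = (x :: real)" "2 powi (- j) * (2 powi j * x) = x"
  by (simp_all add: power_int_minus)

lemma grid_index_point [simp]: "grid_index j (grid_point j m) = m"
  by (simp add: grid_index_def grid_point_def vec_eq_iff two_powi_cancel)

lemma mem_dyadic_cube: "x \<in> dyadic_cube j m \<longleftrightarrow> grid_index j x = m"
proof
  {
    assume "x \<in> dyadic_cube j m"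
    then obtain y :: "real^'a" where y: "\<And>i. 0 \<le> y $ i \<and> y $ i < 1"
      and x: "x = (2 powi (- j)) *\<^sub>R (y + (\<chi> i. real_of_int (m $ i)))"
      by (auto simp: dyadic_cube_def)
    have "2 powi j * x $ i = y $ i + real_of_int (m $ i)" for i
      by (simp add: x two_powi_cancel)
    then show "grid_index j x = m"
      using y by (simp add: grid_index_def vec_eq_iff floor_eq_iff)
  }
  {
    assume m: "grid_index j x = m"
    define y where "y = (\<chi> i. 2 powi j * x $ i - real_of_int (m $ i))"
    have "0 \<le> y $ i \<and> y $ i < 1" for i
      unfolding y_def m[symmetric] grid_index_def by simp linarith
    moreover have "x = (2 powi (- j)) *\<^sub>R (y + (\<chi> i. real_of_int (m $ i)))"
      by (simp add: vec_eq_iff y_def two_powi_cancel)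
    ultimately show "x \<in> dyadic_cube j m" by (auto simp: dyadic_cube_def)
  }
qed

lemma dyadic_cube_region: "dyadic_cube j m = region j {m}"
  by (auto simp: mem_dyadic_cube region_def)

lemma grid_point_mem: "grid_point j m \<in> dyadic_cube j m"
  by (simp add: mem_dyadic_cube)

lemma grid_index_coarser: "grid_index (j - int d) x = (\<chi> i. grid_index j x $ i div 2 ^ d)"
proof -
  have "\<lfloor>2 powi (j - int d) * x $ i\<rfloor> = \<lfloor>2 powi j * x $ i\<rfloor> div 2 ^ d" for i
  proof -
    have "2 powi (j - int d) * x $ i = (2 powi j * x $ i) / real_of_int (2 ^ d)"
      by (simp add: power_int_diff)
    then show ?thesis by (metis floor_divide_real_eq_div zero_le_numeral zero_le_power)
  qed
  then show ?thesis by (simp add: grid_index_def vec_eq_iff)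
qed

lemma grid_index_coarser': "i \<le> j \<Longrightarrow> grid_index i x = (\<chi> l. grid_index j x $ l div 2 ^ nat (j - i))"
  using grid_index_coarser[of j "nat (j - i)" x] by simp

lemma grid_index_eq_coarser:
  "i \<le> j \<Longrightarrow> grid_index j x = grid_index j y \<Longrightarrow> grid_index i x = grid_index i y"
  by (simp add: grid_index_coarser')

abbreviation cube_side :: "int \<Rightarrow> real" where "cube_side j \<equiv> 2 powi (- j)"

definition cube_volume :: "'n itself \<Rightarrow> int \<Rightarrow> real" where
  "cube_volume _ j = (2 powi (- j)) ^ CARD('n)"

lemma cube_volume_pos: "0 < cube_volume TYPE('n::finite) j"
  by (simp add: cube_volume_def)

lemma cube_volume_coarser:
  "cube_volume TYPE('n::finite) (j - int d) = 2 ^ (d * CARD('n)) * cube_volume TYPE('n) j"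
  by (simp add: cube_volume_def power_mult_distrib[symmetric] power_mult power_int_diff power_int_minus field_simps)

lemma dyadic_cube_subset_cube:
  fixes m :: "int^'n"
  shows "dyadic_cube j m \<subseteq> cube (grid_point j m) (cube_side j)"
proof
  fix x :: "real^'n" assume "x \<in> dyadic_cube j m"
  then have m: "m = grid_index j x" by (simp add: mem_dyadic_cube)
  have "2 powi (- j) * real_of_int \<lfloor>2 powi j * x $ i\<rfloor> \<le> x $ i \<and>
      x $ i \<le> 2 powi (- j) * real_of_int \<lfloor>2 powi j * x $ i\<rfloor> + 2 powi (- j)" for i
  proof -
    have "real_of_int \<lfloor>2 powi j * x $ i\<rfloor> \<le> 2 powi j * x $ i"
      "2 powi j * x $ i \<le> real_of_int \<lfloor>2 powi j * x $ i\<rfloor> + 1" by linarith+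
    then show ?thesis by (simp add: power_int_minus field_simps)
  qed
  then show "x \<in> cube (grid_point j m) (cube_side j)"
    by (simp add: cube_def mem_box_cart m grid_point_def grid_index_def)
qed

lemma box_subset_dyadic_cube:
  fixes m :: "int^'n"
  shows "box (grid_point j m) (\<chi> i. grid_point j m $ i + cube_side j) \<subseteq> dyadic_cube j m"
proof
  fix x :: "real^'n" assume "x \<in> box (grid_point j m) (\<chi> i. grid_point j m $ i + cube_side j)"
  then have *: "2 powi (- j) * real_of_int (m $ i) < x $ i"
    "x $ i < 2 powi (- j) * real_of_int (m $ i) + 2 powi (- j)" for i
    by (auto simp: mem_box_cart grid_point_def)
  have "\<lfloor>2 powi j * x $ i\<rfloor> = m $ i" for i
    using *[of i] by (simp add: floor_eq_iff power_int_minus field_simps)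
  then show "x \<in> dyadic_cube j m"
    by (simp add: mem_dyadic_cube grid_index_def vec_eq_iff)
qed

lemma Basis_inner_const: "b \<in> Basis \<Longrightarrow> (\<chi> i. (s :: real)) \<bullet> (b :: real^'n) = s"
  by (auto simp: Basis_vec_def inner_axis)

lemma cube_diff: "(\<chi> i. a $ i + s) - a = (\<chi> i. (s :: real))" for a :: "real^'n"
  by (simp add: vec_eq_iff)

lemma Basis_cube_le: "0 \<le> s \<Longrightarrow> b \<in> Basis \<Longrightarrow> a \<bullet> b \<le> (\<chi> i. a $ i + s) \<bullet> (b :: real^'n)"
  by (auto simp: Basis_vec_def inner_axis)

lemma emeasure_cube: "0 \<le> s \<Longrightarrow> emeasure lebesgue (cube a s :: (real^'n) set) = ennreal (s ^ CARD('n))"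
  by (simp add: cube_def emeasure_lborel_cbox Basis_cube_le cube_diff Basis_inner_const)

lemma grid_index_borel: "(grid_index j :: real^'n \<Rightarrow> int^'n) \<in> borel \<rightarrow>\<^sub>M count_space UNIV"
proof -
  have "grid_index j -` {m} \<in> sets (borel :: (real^'n) measure)" for m :: "int^'n"
  proof -
    have "grid_index j -` {m} = {x. \<forall>i. \<lfloor>2 powi j * x $ i\<rfloor> = m $ i}"
      by (auto simp: grid_index_def vec_eq_iff)
    also have "\<dots> \<in> sets borel" by measurable
    finally show ?thesis .
  qed
  then show ?thesis by (simp add: measurable_count_space_eq2_countable)
qed

lemma grid_index_measurable [measurable]: "grid_index j \<in> lebesgue \<rightarrow>\<^sub>M count_space UNIV"
  by (rule measurable_completion) (use grid_index_borel in simp)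

lemma grid_function_measurable: "(\<lambda>x. \<phi> (grid_index j x)) \<in> borel_measurable lebesgue"
  by (rule measurable_compose[OF grid_index_measurable]) simp

lemma region_sets [measurable]: "region j I \<in> sets lebesgue"
proof -
  have "region j I = grid_index j -` I \<inter> space lebesgue" by (auto simp: region_def)
  then show ?thesis using measurable_sets[OF grid_index_measurable, of I] by simp
qed

lemma dyadic_cube_sets [measurable]: "dyadic_cube j m \<in> sets lebesgue"
  unfolding dyadic_cube_region by (rule region_sets)

lemma emeasure_dyadic_cube: "emeasure lebesgue (dyadic_cube j m :: (real^'n) set) = ennreal (cube_volume TYPE('n) j)"
proof (rule antisym)
  have "emeasure lebesgue (dyadic_cube j m :: (real^'n) set)
      \<le> emeasure lebesgue (cube (grid_point j m) (cube_side j))"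
    by (intro emeasure_mono dyadic_cube_subset_cube) (simp add: cube_def)
  also have "\<dots> = ennreal (cube_volume TYPE('n) j)"
    by (subst emeasure_cube) (simp_all add: cube_volume_def)
  finally show "emeasure lebesgue (dyadic_cube j m :: (real^'n) set) \<le> ennreal (cube_volume TYPE('n) j)" .
  have "ennreal (cube_volume TYPE('n) j) = emeasure lebesgue (box (grid_point j m) (\<chi> i. grid_point j m $ i + cube_side j) :: (real^'n) set)"
    by (simp add: emeasure_lborel_box Basis_cube_le cube_diff Basis_inner_const cube_volume_def)
  also have "\<dots> \<le> emeasure lebesgue (dyadic_cube j m)"
    by (intro emeasure_mono box_subset_dyadic_cube dyadic_cube_sets)
  finally show "ennreal (cube_volume TYPE('n) j) \<le> emeasure lebesgue (dyadic_cube j m :: (real^'n) set)" .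
qed

lemma measure_dyadic_cube: "measure lebesgue (dyadic_cube j m :: (real^'n) set) = cube_volume TYPE('n) j"
  using cube_volume_pos[where 'n = 'n] by (simp add: measure_def emeasure_dyadic_cube less_imp_le)

lemma dyadic_cube_inj:
  assumes "dyadic_cube i m = (dyadic_cube j m' :: (real^'n) set)"
  shows "i = j \<and> m = m'"
proof -
  have "cube_volume TYPE('n) i = cube_volume TYPE('n) j"
    using assms measure_dyadic_cube by metis
  then have "(2::real) powi (- i) = 2 powi (- j)"
    unfolding cube_volume_def by (rule power_eq_imp_eq_base) auto
  then have ij: "i = j"
    using power_int_strict_increasing[of "- i" "- j" "2::real"] power_int_strict_increasing[of "- j" "- i" "2::real"]
    by (cases i j rule: linorder_cases) auto
  moreover have "grid_index j (grid_point i m) = m'"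
    using assms grid_point_mem[of i m] by (simp add: mem_dyadic_cube)
  ultimately show ?thesis by simp
qed

text \<open>A dyadic cube of side length \<open>2\<^sup>d\<close> times that of the leaves, as the set of the indices of its
  leaves; \<open>m\<close> is the index of one of them.\<close>
definition cell :: "nat \<Rightarrow> int^'n \<Rightarrow> (int^'n) set" where
  "cell d m = {m'. \<forall>i. m' $ i div 2 ^ d = m $ i div 2 ^ d}"

lemma cell_self [simp]: "m \<in> cell d m"
  by (simp add: cell_def)

lemma cell_0 [simp]: "cell 0 m = {m}"
  by (auto simp: cell_def vec_eq_iff)

lemma cell_eq: "m' \<in> cell d m \<Longrightarrow> cell d m' = cell d m"
  by (auto simp: cell_def)

lemma cell_mono:
  assumes "d \<le> e" shows "cell d m \<subseteq> cell e m"
proof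
  have *: "a div 2 ^ e = a div 2 ^ d div 2 ^ (e - d)" for a :: int
    using assms by (simp add: power_add[symmetric] flip: zdiv_zmult2_eq)
  fix m' assume "m' \<in> cell d m"
  then show "m' \<in> cell e m" by (simp add: cell_def *)
qed

lemma region_cell: "region j (cell d m) = dyadic_cube (j - int d) (\<chi> i. m $ i div 2 ^ d)"
  by (auto simp: region_def mem_dyadic_cube cell_def grid_index_coarser vec_eq_iff)

lemma region_cell_index: "region j (cell d (grid_index j x)) = dyadic_cube (j - int d) (grid_index (j - int d) x)"
  by (simp add: region_cell grid_index_coarser)

lemma vec_set_card:
  fixes S :: "'n::finite \<Rightarrow> 'a set"
  shows "card {v :: 'a^'n. \<forall>i. v $ i \<in> S i} = (\<Prod>i\<in>UNIV. card (S i))"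
    and "(\<And>i. finite (S i)) \<Longrightarrow> finite {v :: 'a^'n. \<forall>i. v $ i \<in> S i}"
proof -
  have bij: "bij_betw vec_nth {v :: 'a^'n. \<forall>i. v $ i \<in> S i} (PiE UNIV S)"
    by (rule bij_betwI[where g = vec_lambda]) auto
  from bij_betw_same_card[OF bij]
  show "card {v :: 'a^'n. \<forall>i. v $ i \<in> S i} = (\<Prod>i\<in>UNIV. card (S i))"
    by (simp add: card_PiE)
  show "finite {v :: 'a^'n. \<forall>i. v $ i \<in> S i}" if "\<And>i. finite (S i)"
    using bij_betw_finite[OF bij] that by (simp add: finite_PiE)
qed

lemma cell_finite: "finite (cell d (m :: int^'n::finite))"
  and card_cell: "card (cell d (m :: int^'n::finite)) = 2 ^ (d * CARD('n))"
proof -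
  define S where "S i = {m $ i div 2 ^ d * 2 ^ d ..< m $ i div 2 ^ d * 2 ^ d + 2 ^ d}" for i
  have "(a div 2 ^ d = b) \<longleftrightarrow> b * 2 ^ d \<le> a \<and> a < b * 2 ^ d + 2 ^ d" for a b :: int
  proof
    assume "a div 2 ^ d = b"
    then have "a = b * 2 ^ d + a mod 2 ^ d" by (metis div_mult_mod_eq)
    moreover have "0 \<le> a mod 2 ^ d" "a mod 2 ^ d < 2 ^ d" by simp_all
    ultimately show "b * 2 ^ d \<le> a \<and> a < b * 2 ^ d + 2 ^ d" by linarith
  next
    assume "b * 2 ^ d \<le> a \<and> a < b * 2 ^ d + 2 ^ d"
    then show "a div 2 ^ d = b"
      by (intro int_div_pos_eq[of a "2 ^ d" b "a - b * 2 ^ d"]) auto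
  qed
  then have cell: "cell d m = {v. \<forall>i. v $ i \<in> S i}"
    by (simp add: cell_def S_def)
  show "finite (cell d m)"
    unfolding cell by (rule vec_set_card(2)) (simp add: S_def)
  show "card (cell d m) = 2 ^ (d * CARD('n))"
    unfolding cell vec_set_card(1) by (simp add: S_def nat_power_eq power_mult)
qed

section \<open>Haar shifts on the tree of cells\<close>

definition cells :: "nat \<Rightarrow> int^'n \<Rightarrow> (int^'n) set set" where
  "cells d0 m0 = {cell d m |d m. d \<le> d0 \<and> m \<in> cell d0 m0}"

lemma cell_nonempty: "cell d m \<noteq> {}"
  using cell_self by blast

lemma cell_subset_iff:
  fixes m :: "int^'n::finite"
  shows "cell d m \<subset> cell e m' \<longleftrightarrow> d < e \<and> cell e m' = cell e m"
proof
  assume sub: "cell d m \<subset> cell e m'"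
  then have "m \<in> cell e m'" using cell_self[of m d] by blast
  then have eq: "cell e m' = cell e m" by (simp add: cell_eq)
  moreover have "d < e"
    using sub cell_mono[of e d m] unfolding eq by (meson leI not_less psubsetE)
  ultimately show "d < e \<and> cell e m' = cell e m" by simp
next
  assume "d < e \<and> cell e m' = cell e m"
  moreover from this have "card (cell d m) < card (cell e m)" by (simp add: card_cell)
  ultimately show "cell d m \<subset> cell e m'"
    using cell_mono[of d e m] by (metis less_imp_le nat_neq_iff psubsetI)
qed

lemma cells_E:
  assumes "Q \<in> cells d0 m0" "x \<in> Q"
  obtains d where "d \<le> d0" "Q = cell d x" "x \<in> cell d0 m0"
proof -
  obtain d m where d: "d \<le> d0" "Q = cell d m" "m \<in> cell d0 m0"
    using assms by (auto simp: cells_def)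
  then have "x \<in> cell d0 m" using assms cell_mono by blast
  then have "x \<in> cell d0 m0" using cell_eq[OF d(3)] by simp
  then show thesis using that d assms cell_eq by metis
qed

lemma cell_inj_on: "inj_on (\<lambda>d. cell d (m :: int^'n::finite)) S"
proof (rule inj_onI)
  fix d e assume "cell d m = cell e m"
  then have "card (cell d m) = card (cell e m)" by simp
  then show "d = e" by (simp add: card_cell)
qed

lemma cells_containing:
  fixes m m0 :: "int^'n::finite"
  assumes dq: "dq \<le> d0" and m: "m \<in> cell d0 m0"
  shows "{I. I \<in> cells d0 m0 \<and> I \<subseteq> cell dq m \<and> m \<in> I} = (\<lambda>d. cell d m) ` {..dq}"
proof (intro set_eqI iffI)
  fix I assume I: "I \<in> {I. I \<in> cells d0 m0 \<and> I \<subseteq> cell dq m \<and> m \<in> I}"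
  then have "I \<in> cells d0 m0" "m \<in> I" by auto
  then obtain d where d: "I = cell d m" by (rule cells_E)
  with I have "card (cell d m) \<le> card (cell dq m)" by (intro card_mono cell_finite) auto
  then have "d \<le> dq" by (simp add: card_cell)
  with d show "I \<in> (\<lambda>d. cell d m) ` {..dq}" by auto
next
  fix I assume "I \<in> (\<lambda>d. cell d m) ` {..dq}"
  then obtain d where d: "d \<le> dq" "I = cell d m" by auto
  then have "I \<in> cells d0 m0" using dq m unfolding cells_def by fastforce
  then show "I \<in> {I. I \<in> cells d0 m0 \<and> I \<subseteq> cell dq m \<and> m \<in> I}"
    using d cell_mono[of d dq m] by auto
qed

lemma cube_tree_cells: "cube_tree (cells d0 (m0 :: int^'n::finite)) (2 ^ CARD('n))"
proof
  have "cells d0 m0 = (\<lambda>(d, m). cell d m) ` ({..d0} \<times> cell d0 m0)"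
    by (auto simp: cells_def)
  then show "finite (cells d0 m0)" by (simp add: cell_finite)
  show "finite Q" "Q \<noteq> {}" if "Q \<in> cells d0 m0" for Q
    using that by (auto simp: cells_def cell_finite cell_nonempty)
  show "I \<subseteq> J \<or> J \<subseteq> I \<or> I \<inter> J = {}" if I: "I \<in> cells d0 m0" and J: "J \<in> cells d0 m0" for I J
  proof (cases "I \<inter> J = {}")
    case False
    then obtain x where x: "x \<in> I" "x \<in> J" by blast
    obtain d e where "I = cell d x" "J = cell e x" using cells_E[OF I x(1)] cells_E[OF J x(2)] by metis
    then show ?thesis using cell_mono[of d e x] cell_mono[of e d x] by (meson nat_le_linear)
  qed simp
  show "{x} \<in> cells d0 m0" if "Q \<in> cells d0 m0" "x \<in> Q" for Q x
  proof -
    have "x \<in> cell d0 m0" using cells_E[OF that] by metis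
    then have "cell 0 x \<in> cells d0 m0" unfolding cells_def by blast
    then show ?thesis by simp
  qed
  show "\<exists>P\<in>cells d0 m0. J \<subset> P \<and> P \<subseteq> Q \<and> real (card P) \<le> 2 ^ CARD('n) * real (card J)"
    if J: "J \<in> cells d0 m0" and Q: "Q \<in> cells d0 m0" and JQ: "J \<subset> Q" for J Q
  proof -
    obtain d m where J': "J = cell d m" "m \<in> cell d0 m0" using J by (auto simp: cells_def)
    then have "m \<in> Q" using JQ cell_self by blast
    then obtain e where e: "e \<le> d0" "Q = cell e m" using cells_E[OF Q] by metis
    have de: "d < e" using JQ unfolding J' e cell_subset_iff by simp
    then have "cell (Suc d) m \<in> cells d0 m0"
      using e(1) J'(2) unfolding cells_def by (metis (mono_tags, lifting) Suc_leI le_trans mem_Collect_eq)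
    moreover have "J \<subset> cell (Suc d) m" unfolding J' cell_subset_iff by simp
    moreover have "cell (Suc d) m \<subseteq> Q" unfolding e using de by (intro cell_mono) simp
    ultimately show ?thesis
      by (intro bexI[of _ "cell (Suc d) m"]) (auto simp: J' card_cell power_add)
  qed
qed simp

text \<open>At a given point only one cube of each side length contributes to \<open>S f\<close>; this is the contribution
  of the cube of side length \<open>2\<^sup>-\<^sup>i\<close>.\<close>
definition haar_term :: "'n::finite cube_family \<Rightarrow> 'n cube_family \<Rightarrow> int \<Rightarrow> (real^'n \<Rightarrow> real) \<Rightarrow> real^'n \<Rightarrow> real" where
  "haar_term h k i f x = pairing f (k (dyadic_cube i (grid_index i x))) * h (dyadic_cube i (grid_index i x)) x"

definition leaf_avg :: "int \<Rightarrow> (real^'n \<Rightarrow> real) \<Rightarrow> int^'n \<Rightarrow> real" where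
  "leaf_avg j f m = (LINT x:dyadic_cube j m|lebesgue. f x) / cube_volume TYPE('n) j"

text \<open>The values of \<open>k\<^sub>I\<close> (or \<open>h\<^sub>I\<close>) on the leaves. Cells fewer than \<open>\<kappa>\<close> generations above the
  leaves are switched off; on the others \<open>k\<^sub>I\<close> is constant on leaves and any point of the leaf gives
  its value.\<close>
definition cell_fun :: "int \<Rightarrow> nat \<Rightarrow> 'n cube_family \<Rightarrow> (int^'n::finite) set \<Rightarrow> int^'n \<Rightarrow> real" where
  "cell_fun j \<kappa> k I m = (if 2 ^ (\<kappa> * CARD('n)) \<le> card I then k (region j I) (grid_point j m) else 0)"

locale haar_shift =
  fixes \<kappa> :: nat and h k :: "'n::finite cube_family"
  assumes gen: "generalized_haar_shift \<kappa> h k"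
begin

lemma support: "x \<notin> dyadic_cube i m \<Longrightarrow> h (dyadic_cube i m) x = 0 \<and> k (dyadic_cube i m) x = 0"
  using gen by (auto simp: generalized_haar_shift_def dyadic_gen_def)

lemma piecewise_constant:
  assumes xy: "grid_index (i + int \<kappa>) x = grid_index (i + int \<kappa>) y"
  shows "h (dyadic_cube i m) x = h (dyadic_cube i m) y \<and> k (dyadic_cube i m) x = k (dyadic_cube i m) y"
proof (cases "grid_index i x = m")
  case True
  define J where "J = dyadic_cube (i + int \<kappa>) (grid_index (i + int \<kappa>) x)"
  have sub: "J \<subseteq> dyadic_cube i m"
    using True grid_index_eq_coarser[of i "i + int \<kappa>"] by (auto simp: J_def mem_dyadic_cube)
  have "J \<in> dyadic_gen (i + int \<kappa>)" "dyadic_cube i m \<in> dyadic_gen i"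
    by (auto simp: J_def dyadic_gen_def)
  then have "h (dyadic_cube i m) constant_on J" "k (dyadic_cube i m) constant_on J"
    using gen sub unfolding generalized_haar_shift_def by blast+
  moreover have "x \<in> J" "y \<in> J" using xy by (auto simp: J_def mem_dyadic_cube)
  ultimately show ?thesis by (auto simp: constant_on_def)
next
  case False
  moreover have "grid_index i y \<noteq> m"
    using False grid_index_eq_coarser[OF _ xy, of i] by simp
  ultimately show ?thesis using support[of x i m] support[of y i m] by (auto simp: mem_dyadic_cube)
qed

lemma eq_at_grid_point:
  "i + int \<kappa> \<le> j \<Longrightarrow> h (dyadic_cube i m) x = h (dyadic_cube i m) (grid_point j (grid_index j x))"
  "i + int \<kappa> \<le> j \<Longrightarrow> k (dyadic_cube i m) x = k (dyadic_cube i m) (grid_point j (grid_index j x))"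
  using piecewise_constant[of i x "grid_point j (grid_index j x)" m]
    grid_index_eq_coarser[of "i + int \<kappa>" j x "grid_point j (grid_index j x)"] by simp_all

lemma finite_range: "finite (range (h (dyadic_cube i m)))" "finite (range (k (dyadic_cube i m)))"
proof -
  define j where "j = i + int \<kappa>"
  define S where "S = insert 0 (h (dyadic_cube i m) ` grid_point j ` {m'. \<forall>l. m' $ l div 2 ^ \<kappa> = m $ l})"
  define S' where "S' = insert 0 (k (dyadic_cube i m) ` grid_point j ` {m'. \<forall>l. m' $ l div 2 ^ \<kappa> = m $ l})"
  have "{m'. \<forall>l. m' $ l div 2 ^ \<kappa> = m $ l} = cell \<kappa> (\<chi> l. m $ l * 2 ^ \<kappa>)"
    by (auto simp: cell_def)
  then have fin: "finite S" "finite S'" by (auto simp: S_def S'_def cell_finite)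
  have "h (dyadic_cube i m) x \<in> S \<and> k (dyadic_cube i m) x \<in> S'" for x
  proof (cases "x \<in> dyadic_cube i m")
    case True
    then have "m = (\<chi> l. grid_index j x $ l div 2 ^ \<kappa>)"
      using grid_index_coarser[of j \<kappa> x] by (simp add: mem_dyadic_cube j_def)
    then show ?thesis
      using eq_at_grid_point[of i j m x] unfolding S_def S'_def by (auto simp: j_def)
  qed (use support in \<open>auto simp: S_def S'_def\<close>)
  then have "range (h (dyadic_cube i m)) \<subseteq> S" "range (k (dyadic_cube i m)) \<subseteq> S'" by auto
  then show "finite (range (h (dyadic_cube i m)))" "finite (range (k (dyadic_cube i m)))"
    using fin finite_subset by blast+
qed

text \<open>The supremum of an unbounded set of reals bounds nothing, and so the bound on the product of
  the suprema becomes a pointwise one only because both functions take finitely many values.\<close>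
lemma size: "\<bar>h (dyadic_cube i m) x\<bar> * \<bar>k (dyadic_cube i m) y\<bar> \<le> 1 / cube_volume TYPE('n) i"
proof -
  have bdd: "bdd_above (range (\<lambda>x. \<bar>u x\<bar>))" if "finite (range u)" for u :: "real^'n \<Rightarrow> real"
    using finite_imageI[OF that, of abs] by (intro bdd_above_finite) (simp add: image_image)
  have "\<bar>h (dyadic_cube i m) x\<bar> * \<bar>k (dyadic_cube i m) y\<bar>
      \<le> (SUP x. \<bar>h (dyadic_cube i m) x\<bar>) * (SUP x. \<bar>k (dyadic_cube i m) x\<bar>)"
  proof (rule mult_mono)
    have le: "\<bar>h (dyadic_cube i m) x\<bar> \<le> (SUP x. \<bar>h (dyadic_cube i m) x\<bar>)"
      by (rule cSUP_upper[OF UNIV_I bdd[OF finite_range(1)]])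
    then show "\<bar>h (dyadic_cube i m) x\<bar> \<le> (SUP x. \<bar>h (dyadic_cube i m) x\<bar>)" .
    show "\<bar>k (dyadic_cube i m) y\<bar> \<le> (SUP x. \<bar>k (dyadic_cube i m) x\<bar>)"
      by (rule cSUP_upper[OF UNIV_I bdd[OF finite_range(2)]])
    show "0 \<le> (SUP x. \<bar>h (dyadic_cube i m) x\<bar>)" using le abs_ge_zero order_trans by blast
  qed simp
  also have "\<dots> \<le> 1 / measure lebesgue (dyadic_cube i m)"
    using gen by (auto simp: generalized_haar_shift_def dyadic_gen_def)
  finally show ?thesis by (simp add: measure_dyadic_cube)
qed

lemma haar_term_eq:
  assumes "i + int \<kappa> \<le> j"
  shows "haar_term h k i f x = haar_term h k i f (grid_point j (grid_index j x))"
proof -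
  have "grid_index i x = grid_index i (grid_point j (grid_index j x))"
    using assms by (intro grid_index_eq_coarser[of i j]) auto
  then show ?thesis
    using eq_at_grid_point(1)[OF assms, of "grid_index i x" x] by (simp add: haar_term_def)
qed

lemma haar_term_measurable [measurable]: "haar_term h k i f \<in> borel_measurable lebesgue"
proof -
  have "haar_term h k i f = (\<lambda>x. haar_term h k i f (grid_point (i + int \<kappa>) (grid_index (i + int \<kappa>) x)))"
    using haar_term_eq[of i "i + int \<kappa>"] by auto
  then show ?thesis
    using grid_function_measurable[of "\<lambda>m'. haar_term h k i f (grid_point (i + int \<kappa>) m')" "i + int \<kappa>"] by simp
qed

lemma haar_term_le:
  assumes f: "set_integrable lebesgue (dyadic_cube i (grid_index i x)) f"
  shows "\<bar>haar_term h k i f x\<bar> \<le> (LINT y:dyadic_cube i (grid_index i x)|lebesgue. \<bar>f y\<bar>) / cube_volume TYPE('n) i"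
proof -
  define I where "I = dyadic_cube i (grid_index i x)"
  have "haar_term h k i f x = (\<integral>y. (f y * k I y) * h I x \<partial>lebesgue)"
    by (simp add: haar_term_def pairing_def I_def)
  also have "\<bar>\<dots>\<bar> \<le> (\<integral>y. \<bar>(f y * k I y) * h I x\<bar> \<partial>lebesgue)"
    by (rule integral_abs_bound)
  also have "\<dots> \<le> (\<integral>y. indicator I y *\<^sub>R \<bar>f y\<bar> / cube_volume TYPE('n) i \<partial>lebesgue)"
  proof (rule integral_mono')
    have "set_integrable lebesgue I (\<lambda>y. \<bar>f y\<bar>)" using f unfolding I_def by (rule set_integrable_abs)
    then show "integrable lebesgue (\<lambda>y. indicator I y *\<^sub>R \<bar>f y\<bar> / cube_volume TYPE('n) i)"
      unfolding set_integrable_def by (rule integrable_divide_zero)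
    show "\<bar>f y * k I y * h I x\<bar> \<le> indicator I y *\<^sub>R \<bar>f y\<bar> / cube_volume TYPE('n) i" for y
    proof (cases "y \<in> I")
      case True
      have "\<bar>f y * k I y * h I x\<bar> = \<bar>f y\<bar> * (\<bar>h I x\<bar> * \<bar>k I y\<bar>)" by (simp add: abs_mult)
      also have "\<dots> \<le> \<bar>f y\<bar> * (1 / cube_volume TYPE('n) i)"
        unfolding I_def by (intro mult_left_mono size) simp
      finally show ?thesis using True by simp
    next
      case False
      then show ?thesis using support[of y i "grid_index i x"] by (simp add: I_def)
    qed
    show "0 \<le> indicator I y *\<^sub>R \<bar>f y\<bar> / cube_volume TYPE('n) i" for y
      using cube_volume_pos[where 'n = 'n, of i] by simp
  qed
  also have "\<dots> = (LINT y:I|lebesgue. \<bar>f y\<bar>) / cube_volume TYPE('n) i"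
    by (simp add: set_lebesgue_integral_def)
  finally show ?thesis by (simp add: I_def)
qed

lemma haar_partial_eq: "haar_partial h k N f x = (\<Sum>i\<in>{- int N..int N}. haar_term h k i f x)"
proof -
  define C where "C i = dyadic_cube i (grid_index i x)" for i
  have inj: "inj_on C S" for S by (auto simp: inj_on_def C_def dest: dyadic_cube_inj)
  have "haar_partial h k N f x = (\<Sum>\<^sub>\<infinity>I\<in>C ` {- int N..int N}. pairing f (k I) * h I x)"
    unfolding haar_partial_def
  proof (rule infsum_cong_neutral)
    fix I assume I: "I \<in> (\<Union>j\<in>{- int N..int N}. dyadic_gen j) - C ` {- int N..int N}"
    then obtain i m where im: "i \<in> {- int N..int N}" "I = dyadic_cube i m"
      by (auto simp: dyadic_gen_def)
    then have "x \<notin> I" using I by (auto simp: C_def mem_dyadic_cube)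
    then show "pairing f (k I) * h I x = 0" using support im by simp
  qed (auto simp: C_def dyadic_gen_def)
  also have "\<dots> = (\<Sum>i\<in>{- int N..int N}. haar_term h k i f x)"
    unfolding haar_term_def C_def[symmetric] by (simp add: sum.reindex[OF inj])
  finally show ?thesis .
qed

text \<open>As \<open>k\<^sub>I\<close> is constant on leaves, only the averages of \<open>f\<close> over the leaves enter.\<close>
lemma pairing_cell:
  assumes \<kappa>d: "\<kappa> \<le> d" and f: "\<And>m'. set_integrable lebesgue (dyadic_cube j m') f"
  shows "pairing f (k (region j (cell d m)))
    = cube_volume TYPE('n) j * (\<Sum>m'\<in>cell d m. leaf_avg j f m' * cell_fun j \<kappa> k (cell d m) m')"
proof -
  define I where "I = dyadic_cube (j - int d) (\<chi> i. m $ i div 2 ^ d)"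
  have I: "region j (cell d m) = I" by (simp add: region_cell I_def)
  have active: "cell_fun j \<kappa> k (cell d m) m' = k I (grid_point j m')" for m'
    using \<kappa>d by (simp add: cell_fun_def card_cell I)
  have "f x * k I x = (\<Sum>m'\<in>cell d m. indicator (dyadic_cube j m') x *\<^sub>R f x * k I (grid_point j m'))" for x
  proof (cases "grid_index j x \<in> cell d m")
    case True
    have "(\<Sum>m'\<in>cell d m. indicator (dyadic_cube j m') x *\<^sub>R f x * k I (grid_point j m'))
        = (\<Sum>m'\<in>cell d m. if m' = grid_index j x then f x * k I (grid_point j m') else 0)"
      by (intro sum.cong refl) (auto simp: mem_dyadic_cube indicator_def)
    also have "\<dots> = f x * k I (grid_point j (grid_index j x))"
      using True by (simp add: cell_finite)
    also have "\<dots> = f x * k I x"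
      using eq_at_grid_point(2)[of "j - int d" j _ x] \<kappa>d unfolding I_def by simp
    finally show ?thesis by simp
  next
    case False
    then have "x \<notin> I" using I by (auto simp: region_def)
    then have "k I x = 0" using support unfolding I_def by blast
    moreover have "indicator (dyadic_cube j m') x = (0::real)" if "m' \<in> cell d m" for m'
      using that False by (auto simp: mem_dyadic_cube indicator_def)
    ultimately show ?thesis by simp
  qed
  then have "pairing f (k I) = (\<integral>x. (\<Sum>m'\<in>cell d m. indicator (dyadic_cube j m') x *\<^sub>R f x * k I (grid_point j m')) \<partial>lebesgue)"
    unfolding pairing_def by simp
  also have "\<dots> = (\<Sum>m'\<in>cell d m. (LINT x:dyadic_cube j m'|lebesgue. f x) * k I (grid_point j m'))"
    unfolding set_lebesgue_integral_def
    by (subst Bochner_Integration.integral_sum) (use f in \<open>auto simp: set_integrable_def\<close>)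
  also have "\<dots> = cube_volume TYPE('n) j * (\<Sum>m'\<in>cell d m. leaf_avg j f m' * cell_fun j \<kappa> k (cell d m) m')"
    using cube_volume_pos[where 'n = 'n, of j]
    by (simp add: active leaf_avg_def sum_distrib_left)
  finally show ?thesis by (simp add: I)
qed

end

text \<open>The volume of a leaf accounts for the passage from Lebesgue measure to counting measure on leaves.\<close>
abbreviation cell_fun_scaled :: "int \<Rightarrow> nat \<Rightarrow> 'n cube_family \<Rightarrow> (int^'n::finite) set \<Rightarrow> int^'n \<Rightarrow> real" where
  "cell_fun_scaled j \<kappa> h I m \<equiv> cube_volume TYPE('n) j * cell_fun j \<kappa> h I m"

lemma apply_shift_cells:
  fixes h k :: "'j \<Rightarrow> 'n::finite cube_family"
  assumes gen: "generalized_haar_shift \<kappa> (h l) (k l)"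
    and f: "\<And>m'. set_integrable lebesgue (dyadic_cube j m') (f l)"
    and x: "grid_index j x = m" and dq: "dq \<le> d0" and m: "m \<in> cell d0 m0"
  shows "apply_shift (cells d0 m0) (\<lambda>l. cell_fun j \<kappa> (k l)) (\<lambda>l. cell_fun_scaled j \<kappa> (h l)) (cell dq m)
      (\<lambda>l. leaf_avg j (f l)) l m = (\<Sum>d\<in>{\<kappa>..dq}. haar_term (h l) (k l) (j - int d) (f l) x)"
proof -
  interpret haar_shift \<kappa> "h l" "k l" by standard (rule gen)
  define T where "T I = (\<Sum>x\<in>I. leaf_avg j (f l) x * cell_fun j \<kappa> (k l) I x) * cell_fun_scaled j \<kappa> (h l) I m" for I
  note set_eq = cells_containing[OF dq m] and inj = cell_inj_on[of m "{..dq}"]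
  have "apply_shift (cells d0 m0) (\<lambda>l. cell_fun j \<kappa> (k l)) (\<lambda>l. cell_fun_scaled j \<kappa> (h l)) (cell dq m)
      (\<lambda>l. leaf_avg j (f l)) l m = (\<Sum>d\<in>{..dq}. T (cell d m))"
    unfolding apply_shift_def set_eq T_def by (simp add: sum.reindex[OF inj])
  also have "\<dots> = (\<Sum>d\<in>{\<kappa>..dq}. T (cell d m))"
    by (rule sum.mono_neutral_right) (auto simp: T_def cell_fun_def card_cell)
  also have "\<dots> = (\<Sum>d\<in>{\<kappa>..dq}. haar_term (h l) (k l) (j - int d) (f l) x)"
  proof (rule sum.cong[OF refl])
    fix d assume d: "d \<in> {\<kappa>..dq}"
    define I where "I = dyadic_cube (j - int d) (grid_index (j - int d) x)"
    have I: "region j (cell d m) = I" using region_cell_index[of j d x] by (simp add: x I_def)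
    have "haar_term (h l) (k l) (j - int d) (f l) x = pairing (f l) (k l I) * h l I x"
      by (simp add: haar_term_def I_def)
    also have "h l I x = h l I (grid_point j m)"
      using eq_at_grid_point(1)[of "j - int d" j _ x] d x by (simp add: I_def)
    also have "\<dots> = cell_fun j \<kappa> (h l) (cell d m) m"
      using d by (simp add: cell_fun_def card_cell I)
    also have "pairing (f l) (k l I) = cube_volume TYPE('n) j *
        (\<Sum>m'\<in>cell d m. leaf_avg j (f l) m' * cell_fun j \<kappa> (k l) (cell d m) m')"
      using pairing_cell[of d j "f l" m] f d by (simp add: I)
    finally show "T (cell d m) = haar_term (h l) (k l) (j - int d) (f l) x"
      by (simp add: T_def mult_ac)
  qed
  finally show ?thesis .
qed

text \<open>The function \<open>k\<^sub>I\<close> is constant on \<open>J\<close> as soon as \<open>I\<close> lies at least \<open>\<kappa>\<close> generations above \<open>J\<close>.\<close>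
lemma haar_tree_cells:
  fixes h k :: "'j \<Rightarrow> 'n::finite cube_family"
  assumes dual: "dual_norms L N N'"
    and gen: "\<And>l. l \<in> L \<Longrightarrow> generalized_haar_shift \<kappa> (h l) (k l)"
  shows "haar_tree L N N' (cells d0 m0) (2 ^ CARD('n))
    (\<lambda>l. cell_fun j \<kappa> (k l)) (\<lambda>l. cell_fun_scaled j \<kappa> (h l)) \<kappa>"
proof -
  interpret dual_norms L N N' by (rule dual)
  interpret cube_tree "cells d0 m0" "2 ^ CARD('n)" by (rule cube_tree_cells)
  show ?thesis
  proof
    show "\<bar>cell_fun j \<kappa> (k l) I x\<bar> * \<bar>cell_fun_scaled j \<kappa> (h l) I y\<bar> \<le> 1 / real (card I)"
      if l: "l \<in> L" and I: "I \<in> cells d0 m0" for l I x y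
    proof -
      interpret haar_shift \<kappa> "h l" "k l" by standard (rule gen[OF l])
      obtain d m where d: "I = cell d m" using I by (auto simp: cells_def)
      define v where "v = cube_volume TYPE('n) j"
      have v: "0 < v" by (simp add: v_def cube_volume_pos)
      have "\<bar>cell_fun j \<kappa> (k l) I x\<bar> * \<bar>cell_fun_scaled j \<kappa> (h l) I y\<bar>
          = v * (\<bar>cell_fun j \<kappa> (h l) I y\<bar> * \<bar>cell_fun j \<kappa> (k l) I x\<bar>)"
        using v by (simp add: abs_mult v_def)
      also have "\<bar>cell_fun j \<kappa> (h l) I y\<bar> * \<bar>cell_fun j \<kappa> (k l) I x\<bar> \<le> 1 / (real (card I) * v)"
        using size[of "j - int d" "\<chi> i. m $ i div 2 ^ d" "grid_point j y" "grid_point j x"] v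
        by (simp add: cell_fun_def d region_cell cube_volume_coarser card_cell v_def)
      finally show ?thesis using v by (simp add: mult_left_mono)
    qed
    show "real (card {I \<in> cells d0 m0. J \<subset> I \<and> \<not> (\<forall>l\<in>L. cell_fun j \<kappa> (k l) I constant_on J \<and>
        cell_fun_scaled j \<kappa> (h l) I constant_on J)}) \<le> real \<kappa>" (is "real (card ?S) \<le> _")
      if J: "J \<in> cells d0 m0" for J
    proof -
      obtain e m where e: "J = cell e m" using J by (auto simp: cells_def)
      have "?S \<subseteq> (\<lambda>d. cell d m) ` {e<..<e + \<kappa>}"
      proof
        fix I assume I: "I \<in> ?S"
        then have "m \<in> I" using e cell_self by blast
        then obtain d where d: "I = cell d m" using I cells_E by blast
        have "cell e m \<subset> cell d m" using I unfolding e d by blast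
        then have ed: "e < d" by (simp add: cell_subset_iff)
        have "d < e + \<kappa>"
        proof (rule ccontr)
          assume "\<not> d < e + \<kappa>"
          then have de: "e \<le> d - \<kappa>" "\<kappa> \<le> d" by auto
          have "cell_fun j \<kappa> (k l) I x = cell_fun j \<kappa> (k l) I m \<and> cell_fun j \<kappa> (h l) I x = cell_fun j \<kappa> (h l) I m"
            if l: "l \<in> L" and x: "x \<in> J" for l x
          proof -
            interpret haar_shift \<kappa> "h l" "k l" by standard (rule gen[OF l])
            have "x \<in> cell (d - \<kappa>) m" using x cell_mono[OF de(1)] e by blast
            then have "grid_index (j - int (d - \<kappa>)) (grid_point j x) = grid_index (j - int (d - \<kappa>)) (grid_point j m)"
              by (simp add: grid_index_coarser cell_def)
            moreover have "j - int d + int \<kappa> = j - int (d - \<kappa>)" using de by simp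
            ultimately have "grid_index (j - int d + int \<kappa>) (grid_point j x)
                = grid_index (j - int d + int \<kappa>) (grid_point j m)" by presburger
            from piecewise_constant[OF this, of "\<chi> i. m $ i div 2 ^ d"] show ?thesis
              by (simp add: cell_fun_def d region_cell)
          qed
          then have "\<forall>l\<in>L. cell_fun j \<kappa> (k l) I constant_on J \<and> cell_fun_scaled j \<kappa> (h l) I constant_on J"
            unfolding constant_on_def by metis
          then show False using I by blast
        qed
        with d ed show "I \<in> (\<lambda>d. cell d m) ` {e<..<e + \<kappa>}" by auto
      qed
      then have "card ?S \<le> card ((\<lambda>d. cell d m) ` {e<..<e + \<kappa>})" by (intro card_mono) auto
      also have "\<dots> \<le> card {e<..<e + \<kappa>}" by (rule card_image_le) simp
      also have "\<dots> \<le> \<kappa>" by simp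
      finally show ?thesis by simp
    qed
  qed
qed

section \<open>Local testing from boundedness on \<open>L\<^sup>2\<close>\<close>

lemma ennpow_ennreal: "0 \<le> x \<Longrightarrow> ennpow (ennreal x) a = ennreal (x powr a)"
  by (simp add: ennpow_def)

lemma ennpow_top [simp]: "ennpow top a = top"
  by (simp add: ennpow_def)

lemma ennpow_mono: "0 < a \<Longrightarrow> x \<le> y \<Longrightarrow> ennpow x a \<le> ennpow y a"
  by (cases x; cases y) (auto simp: ennpow_ennreal powr_mono2 top_unique)

lemma ennpow_ennpow: "0 < a \<Longrightarrow> 0 < b \<Longrightarrow> ennpow (ennpow x a) b = ennpow x (a * b)"
  by (cases x) (auto simp: ennpow_ennreal powr_powr)

lemma ennpow_1 [simp]: "ennpow x 1 = x"
  by (cases x) (auto simp: ennpow_ennreal)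

text \<open>Raising to the power \<open>a\<close> is an order isomorphism with inverse \<open>1/a\<close>.\<close>
lemma ennpow_le_iff:
  assumes a: "0 < a"
  shows "ennpow x a \<le> y \<longleftrightarrow> x \<le> ennpow y (1 / a)"
proof
  assume "ennpow x a \<le> y"
  then have "ennpow (ennpow x a) (1 / a) \<le> ennpow y (1 / a)" using a by (intro ennpow_mono) auto
  then show "x \<le> ennpow y (1 / a)" using a by (simp add: ennpow_ennpow)
next
  assume "x \<le> ennpow y (1 / a)"
  then have "ennpow x a \<le> ennpow (ennpow y (1 / a)) a" using a by (intro ennpow_mono) auto
  then show "ennpow x a \<le> y" using a by (simp add: ennpow_ennpow)
qed

lemma L2_norm_le_iff:
  assumes c: "0 \<le> c"
  shows "L2_norm f \<le> ennreal c \<longleftrightarrow> (\<integral>\<^sup>+x. ennreal ((f x)\<^sup>2) \<partial>lebesgue) \<le> ennreal (c\<^sup>2)"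
proof -
  have "L2_norm f = ennpow (\<integral>\<^sup>+x. ennreal ((f x)\<^sup>2) \<partial>lebesgue) (1 / 2)"
    by (simp add: L2_norm_def Lp_norm_def ennpow_ennreal)
  then show ?thesis using c by (simp add: ennpow_le_iff ennpow_ennreal)
qed

lemma L2_norm_mono:
  fixes f g :: "real^'n \<Rightarrow> real"
  assumes "L2_norm f \<le> L2_norm g"
  shows "(\<integral>\<^sup>+x. ennreal ((f x)\<^sup>2) \<partial>lebesgue) \<le> (\<integral>\<^sup>+x. ennreal ((g x)\<^sup>2) \<partial>lebesgue)"
proof -
  have "L2_norm u = ennpow (\<integral>\<^sup>+x. ennreal ((u x)\<^sup>2) \<partial>lebesgue) (1 / 2)" for u :: "real^'n \<Rightarrow> real"
    by (simp add: L2_norm_def Lp_norm_def ennpow_ennreal)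
  then show ?thesis
    using assms by (simp add: ennpow_le_iff ennpow_ennpow)
qed

lemma set_integrable_bounded_cube:
  fixes f :: "real^'n \<Rightarrow> real"
  assumes "f \<in> borel_measurable lebesgue" "\<And>x. \<bar>f x\<bar> \<le> 1"
  shows "set_integrable lebesgue (dyadic_cube i m) f"
  unfolding set_integrable_def
proof (rule integrableI_bounded_set_indicator[where B = 1])
  show "emeasure lebesgue (dyadic_cube i m) < \<infinity>"
    by (simp add: emeasure_dyadic_cube)
qed (use assms in auto)

lemma nn_integral_region:
  assumes "finite Q" "F \<in> borel_measurable lebesgue"
  shows "(\<integral>\<^sup>+x. F x * indicator (region j Q) x \<partial>lebesgue)
    = (\<Sum>m\<in>Q. \<integral>\<^sup>+x. F x * indicator (dyadic_cube j m) x \<partial>lebesgue)"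
proof -
  have "indicator (region j Q) x = (\<Sum>m\<in>Q. indicator (dyadic_cube j m) x :: ennreal)" for x
    using assms(1) by (auto simp: indicator_def mem_dyadic_cube region_def sum.delta')
  then show ?thesis
    using assms(2) by (simp add: sum_distrib_left nn_integral_sum)
qed

lemma sum_half_powers_le: "(\<Sum>d\<in>{1..D}. (1 / 2 :: real) ^ d) \<le> 1"
proof -
  have "(\<Sum>d\<in>{1..D}. (1 / 2 :: real) ^ d) = 1 - (1 / 2) ^ D"
    by (induction D) auto
  then show ?thesis by simp
qed

context haar_shift
begin

lemma haar_term_le_1:
  assumes f: "f \<in> borel_measurable lebesgue" "\<And>x. \<bar>f x\<bar> \<le> 1"
  shows "\<bar>haar_term h k i f x\<bar> \<le> 1"
proof -
  define I where "I = dyadic_cube i (grid_index i x)"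
  have "(LINT y:I|lebesgue. \<bar>f y\<bar>) \<le> (LINT y:I|lebesgue. 1)"
    unfolding I_def using f by (intro set_integral_mono set_integrable_bounded_cube) auto
  also have "\<dots> = cube_volume TYPE('n) i"
    by (simp add: set_lebesgue_integral_def I_def measure_dyadic_cube)
  finally have "(LINT y:I|lebesgue. \<bar>f y\<bar>) / cube_volume TYPE('n) i \<le> 1"
    using cube_volume_pos[where 'n = 'n, of i] by simp
  moreover have "\<bar>haar_term h k i f x\<bar> \<le> (LINT y:I|lebesgue. \<bar>f y\<bar>) / cube_volume TYPE('n) i"
    unfolding I_def by (intro haar_term_le set_integrable_bounded_cube f)
  ultimately show ?thesis by linarith
qed

text \<open>For large \<open>N\<close> the partial sum is close in \<open>L\<^sup>2\<close> to \<open>g = S f\<close>, whose norm is at most that of \<open>f\<close>.\<close>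
lemma partial_L1_bound:
  assumes f: "f \<in> borel_measurable lebesgue" "\<And>x. \<bar>f x\<bar> \<le> indicator (dyadic_cube i0 m) x"
  shows "\<forall>\<^sub>F N in sequentially. (\<integral>\<^sup>+x. ennreal \<bar>haar_partial h k N f x\<bar> * indicator (dyadic_cube i0 m) x \<partial>lebesgue)
    \<le> ennreal (3 * cube_volume TYPE('n) i0)"
proof -
  define Q where "Q = (dyadic_cube i0 m :: (real^'n) set)"
  define v where "v = cube_volume TYPE('n) i0"
  have v: "0 < v" by (simp add: v_def cube_volume_pos)
  have emQ: "emeasure lebesgue Q = ennreal v" by (simp add: Q_def v_def emeasure_dyadic_cube)
  have Q [measurable]: "Q \<in> sets lebesgue" by (simp add: Q_def)
  have "(\<integral>\<^sup>+x. ennreal ((f x)\<^sup>2) \<partial>lebesgue) \<le> (\<integral>\<^sup>+x. indicator Q x \<partial>lebesgue)"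
  proof (rule nn_integral_mono)
    fix x
    show "ennreal ((f x)\<^sup>2) \<le> indicator Q x"
      using f(2)[of x] by (cases "x \<in> Q") (auto simp: Q_def abs_square_le_1)
  qed
  also have "\<dots> = ennreal v" by (simp add: emQ)
  finally have f2: "(\<integral>\<^sup>+x. ennreal ((f x)\<^sup>2) \<partial>lebesgue) \<le> ennreal v" .
  then have "L2_norm f \<le> ennreal (sqrt v)"
    using v by (subst L2_norm_le_iff) auto
  then have "f \<in> L2" using f(1) by (auto simp: L2_def intro: le_less_trans)
  then obtain g where g: "g \<in> L2" "(\<lambda>N. L2_norm (\<lambda>x. haar_partial h k N f x - g x)) \<longlonglongrightarrow> 0"
    "L2_norm g \<le> L2_norm f"
    using gen unfolding generalized_haar_shift_def by blast
  have [measurable]: "g \<in> borel_measurable lebesgue" using g(1) by (simp add: L2_def)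
  have [measurable]: "haar_partial h k N f \<in> borel_measurable lebesgue" for N
    unfolding haar_partial_eq[abs_def] by measurable
  have g2: "(\<integral>\<^sup>+x. ennreal ((g x)\<^sup>2) \<partial>lebesgue) \<le> ennreal v"
    using L2_norm_mono[OF g(3)] f2 by (rule order_trans)
  have "\<forall>\<^sub>F N in sequentially. L2_norm (\<lambda>x. haar_partial h k N f x - g x) < ennreal (sqrt v)"
    using g(2) v by (intro order_tendstoD) auto
  then show ?thesis
  proof (rule eventually_mono)
    fix N assume "L2_norm (\<lambda>x. haar_partial h k N f x - g x) < ennreal (sqrt v)"
    then have d2: "(\<integral>\<^sup>+x. ennreal ((haar_partial h k N f x - g x)\<^sup>2) \<partial>lebesgue) \<le> ennreal v"
      using L2_norm_le_iff[of "sqrt v" "\<lambda>x. haar_partial h k N f x - g x"] v by (simp add: less_imp_le)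
    have "(\<integral>\<^sup>+x. ennreal \<bar>haar_partial h k N f x\<bar> * indicator Q x \<partial>lebesgue)
        \<le> (\<integral>\<^sup>+x. indicator Q x + (ennreal ((haar_partial h k N f x - g x)\<^sup>2) + ennreal ((g x)\<^sup>2)) \<partial>lebesgue)"
    proof (rule nn_integral_mono)
      fix x
      define a where "a = haar_partial h k N f x"
      \<comment> \<open>Here \<open>2 \<bar>a\<bar> \<le> 1 + a\<^sup>2\<close> and \<open>a\<^sup>2 \<le> 2 (a - g)\<^sup>2 + 2 g\<^sup>2\<close>.\<close>
      have "0 \<le> (\<bar>a\<bar> - 1)\<^sup>2" "0 \<le> (a - g x - g x)\<^sup>2" by simp_all
      then have "\<bar>a\<bar> \<le> 1 + ((a - g x)\<^sup>2 + (g x)\<^sup>2)"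
        by (simp add: power2_eq_square algebra_simps)
      then show "ennreal \<bar>haar_partial h k N f x\<bar> * indicator Q x
          \<le> indicator Q x + (ennreal ((haar_partial h k N f x - g x)\<^sup>2) + ennreal ((g x)\<^sup>2))"
        unfolding a_def[symmetric]
        using ennreal_leI[of "\<bar>a\<bar>" "1 + ((a - g x)\<^sup>2 + (g x)\<^sup>2)"]
        by (cases "x \<in> Q") (simp_all add: ennreal_plus)
    qed
    also have "\<dots> = ennreal v + ((\<integral>\<^sup>+x. ennreal ((haar_partial h k N f x - g x)\<^sup>2) \<partial>lebesgue)
        + (\<integral>\<^sup>+x. ennreal ((g x)\<^sup>2) \<partial>lebesgue))"
      by (simp add: nn_integral_add emQ)
    also have "\<dots> \<le> ennreal v + (ennreal v + ennreal v)"
      by (intro add_mono d2 g2 order_refl)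
    also have "\<dots> = ennreal (3 * v)" using v by (simp flip: ennreal_plus)
    finally show "(\<integral>\<^sup>+x. ennreal \<bar>haar_partial h k N f x\<bar> * indicator (dyadic_cube i0 m) x \<partial>lebesgue)
        \<le> ennreal (3 * cube_volume TYPE('n) i0)"
      by (simp add: Q_def v_def)
  qed
qed

text \<open>The mass of \<open>f\<close> is at most the volume of \<open>Q\<close>, and so the cube \<open>d\<close> generations above \<open>Q\<close>
  contributes at most the ratio of the volumes of \<open>Q\<close> and of that cube, which is at most \<open>2\<^sup>-\<^sup>d\<close>.\<close>
lemma coarse_terms_le:
  assumes f: "f \<in> borel_measurable lebesgue" "\<And>x. \<bar>f x\<bar> \<le> indicator (dyadic_cube i0 m) x"
  shows "\<bar>\<Sum>i\<in>{a..<i0}. haar_term h k i f x\<bar> \<le> 1"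
proof -
  define Q where "Q = (dyadic_cube i0 m :: (real^'n) set)"
  have f1: "\<bar>f x\<bar> \<le> 1" for x
    using f(2)[of x] by (cases "x \<in> dyadic_cube i0 m") auto
  have term_le: "\<bar>haar_term h k (i0 - int d) f x\<bar> \<le> (1 / 2) ^ d" for d
  proof -
    define I where "I = dyadic_cube (i0 - int d) (grid_index (i0 - int d) x)"
    have "(LINT y:I|lebesgue. \<bar>f y\<bar>) \<le> (\<integral>y. indicator Q y \<partial>lebesgue)"
      unfolding set_lebesgue_integral_def
    proof (rule integral_mono')
      show "integrable lebesgue (indicat_real Q)"
        by (auto simp: Q_def emeasure_dyadic_cube intro!: integrable_real_indicator)
      show "indicat_real I y *\<^sub>R \<bar>f y\<bar> \<le> indicat_real Q y" for y
        using f(2)[of y] by (cases "y \<in> I") (auto simp: Q_def)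
    qed simp
    also have "\<dots> = cube_volume TYPE('n) i0" by (simp add: Q_def measure_dyadic_cube)
    finally have "(LINT y:I|lebesgue. \<bar>f y\<bar>) / cube_volume TYPE('n) (i0 - int d)
        \<le> cube_volume TYPE('n) i0 / cube_volume TYPE('n) (i0 - int d)"
      using cube_volume_pos[where 'n = 'n, of "i0 - int d"] by (intro divide_right_mono) auto
    also have "\<dots> = (1 / 2) ^ (d * CARD('n))"
      using cube_volume_pos[where 'n = 'n, of i0] by (simp add: cube_volume_coarser power_divide)
    also have "\<dots> \<le> (1 / 2) ^ d"
      by (intro power_decreasing) auto
    finally have "(LINT y:I|lebesgue. \<bar>f y\<bar>) / cube_volume TYPE('n) (i0 - int d) \<le> (1 / 2) ^ d" .
    moreover have "\<bar>haar_term h k (i0 - int d) f x\<bar>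
        \<le> (LINT y:I|lebesgue. \<bar>f y\<bar>) / cube_volume TYPE('n) (i0 - int d)"
      unfolding I_def by (intro haar_term_le set_integrable_bounded_cube f f1)
    ultimately show ?thesis by linarith
  qed
  have "bij_betw (\<lambda>d. i0 - int d) {1..nat (i0 - a)} {a..<i0}"
    by (rule bij_betwI[where g = "\<lambda>i. nat (i0 - i)"]) auto
  then have "(\<Sum>i\<in>{a..<i0}. haar_term h k i f x) = (\<Sum>d\<in>{1..nat (i0 - a)}. haar_term h k (i0 - int d) f x)"
    by (rule sum.reindex_bij_betw[symmetric])
  also have "\<bar>\<dots>\<bar> \<le> (\<Sum>d\<in>{1..nat (i0 - a)}. (1 / 2) ^ d)"
    by (rule order_trans[OF sum_abs]) (intro sum_mono term_le)
  also have "\<dots> \<le> 1" by (rule sum_half_powers_le)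
  finally show ?thesis .
qed

text \<open>The assumption on \<open>S\<close> concerns the full sum; this passes to the sum over the subcubes of \<open>Q\<close>
  alone, by subtracting the larger cubes.\<close>
lemma local_L1_bound:
  assumes f: "f \<in> borel_measurable lebesgue" "\<And>x. \<bar>f x\<bar> \<le> indicator (dyadic_cube i0 m) x"
  shows "\<forall>\<^sub>F N in sequentially. (\<integral>\<^sup>+x. ennreal \<bar>\<Sum>i\<in>{i0..int N}. haar_term h k i f x\<bar> *
      indicator (dyadic_cube i0 m) x \<partial>lebesgue) \<le> ennreal (4 * cube_volume TYPE('n) i0)"
proof -
  define v where "v = cube_volume TYPE('n) i0"
  have v: "0 < v" by (simp add: v_def cube_volume_pos)
  define Q where "Q = (dyadic_cube i0 m :: (real^'n) set)"
  have Q [measurable]: "Q \<in> sets lebesgue" by (simp add: Q_def)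
  have [measurable]: "haar_partial h k N f \<in> borel_measurable lebesgue" for N
    unfolding haar_partial_eq[abs_def] by measurable
  show ?thesis
    using eventually_conj[OF partial_L1_bound[OF f] eventually_ge_at_top[of "nat \<bar>i0\<bar>"]]
  proof (rule eventually_mono)
    fix N assume N: "(\<integral>\<^sup>+x. ennreal \<bar>haar_partial h k N f x\<bar> * indicator (dyadic_cube i0 m) x \<partial>lebesgue)
        \<le> ennreal (3 * cube_volume TYPE('n) i0) \<and> nat \<bar>i0\<bar> \<le> N"
    have "(\<integral>\<^sup>+x. ennreal \<bar>\<Sum>i\<in>{i0..int N}. haar_term h k i f x\<bar> * indicator Q x \<partial>lebesgue)
        \<le> (\<integral>\<^sup>+x. ennreal \<bar>haar_partial h k N f x\<bar> * indicator Q x + indicator Q x \<partial>lebesgue)"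
    proof (rule nn_integral_mono)
      fix x
      have "{- int N..int N} = {- int N..<i0} \<union> {i0..int N}" using N by auto
      moreover have "{- int N..<i0} \<inter> {i0..int N} = {}" by auto
      ultimately have "haar_partial h k N f x
          = (\<Sum>i\<in>{- int N..<i0}. haar_term h k i f x) + (\<Sum>i\<in>{i0..int N}. haar_term h k i f x)"
        by (simp add: haar_partial_eq sum.union_disjoint)
      then have "\<bar>\<Sum>i\<in>{i0..int N}. haar_term h k i f x\<bar> \<le> \<bar>haar_partial h k N f x\<bar> + 1"
        using coarse_terms_le[OF f, where a = "- int N" and x = x] by linarith
      then show "ennreal \<bar>\<Sum>i\<in>{i0..int N}. haar_term h k i f x\<bar> * indicator Q x
          \<le> ennreal \<bar>haar_partial h k N f x\<bar> * indicator Q x + indicator Q x"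
        using ennreal_leI[of "\<bar>\<Sum>i\<in>{i0..int N}. haar_term h k i f x\<bar>" "\<bar>haar_partial h k N f x\<bar> + 1"]
        by (cases "x \<in> Q") (simp_all add: ennreal_plus)
    qed
    also have "\<dots> = (\<integral>\<^sup>+x. ennreal \<bar>haar_partial h k N f x\<bar> * indicator Q x \<partial>lebesgue) + ennreal v"
      by (simp add: nn_integral_add Q_def v_def emeasure_dyadic_cube)
    also have "\<dots> \<le> ennreal (3 * v) + ennreal v"
      using N by (intro add_mono) (auto simp: v_def Q_def)
    also have "\<dots> = ennreal (4 * v)" using v by (simp flip: ennreal_plus)
    finally show "(\<integral>\<^sup>+x. ennreal \<bar>\<Sum>i\<in>{i0..int N}. haar_term h k i f x\<bar> *
      indicator (dyadic_cube i0 m) x \<partial>lebesgue) \<le> ennreal (4 * cube_volume TYPE('n) i0)"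
      by (simp add: Q_def v_def)
  qed
qed

lemma haar_term_localize:
  assumes i: "j \<le> i" and F: "\<And>y. grid_index j y = grid_index j x \<Longrightarrow> F y = c"
  shows "haar_term h k i F x = c * haar_term h k i (indicator (dyadic_cube j (grid_index j x))) x"
proof -
  define I where "I = dyadic_cube i (grid_index i x)"
  have "F y * k I y = c * (indicator (dyadic_cube j (grid_index j x)) y * k I y)" for y
  proof (cases "y \<in> I")
    case True
    then have "grid_index j y = grid_index j x"
      using grid_index_eq_coarser[OF i, of y x] by (simp add: I_def mem_dyadic_cube)
    then show ?thesis by (simp add: F mem_dyadic_cube)
  next
    case False
    then show ?thesis using support unfolding I_def by auto
  qed
  then have "pairing F (k I) = (\<integral>y. c * (indicator (dyadic_cube j (grid_index j x)) y * k I y) \<partial>lebesgue)"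
    unfolding pairing_def by (rule Bochner_Integration.integral_cong[OF refl])
  also have "\<dots> = c * pairing (indicator (dyadic_cube j (grid_index j x))) (k I)"
    by (simp add: pairing_def)
  finally have "pairing F (k I) = c * pairing (indicator (dyadic_cube j (grid_index j x))) (k I)" .
  then show ?thesis by (simp add: haar_term_def I_def)
qed

end

text \<open>Let \<open>F\<close> be the function that equals \<open>f\<^sub>m\<close> on the leaf \<open>m\<close> of \<open>Q\<close>. The sum over the active cells in
  \<open>Q\<close> equals the sum over all subcubes of \<open>Q\<close> up to a fine side length \<open>2\<^sup>-\<^sup>N\<close>, minus the fewer than \<open>\<kappa>\<close>
  generations just above the leaves, minus the cubes inside the leaves. The first sum is bounded
  by the local estimate on \<open>Q\<close>, the second is at most \<open>\<kappa>\<close> pointwise. In the third, \<open>F\<close> is constant on each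
  leaf and can be replaced by a multiple of the indicator of the leaf, so that the local estimate on
  the leaf applies.\<close>
lemma cell_test:
  fixes h k :: "'j \<Rightarrow> 'n::finite cube_family" and f g :: "'j \<Rightarrow> int^'n \<Rightarrow> real"
  assumes \<kappa>1: "1 \<le> \<kappa>" and gen: "generalized_haar_shift \<kappa> (h l) (k l)" and Q: "Q \<in> cells d0 m0"
    and f: "\<And>m. m \<in> Q \<Longrightarrow> \<bar>f l m\<bar> \<le> 1" and g: "\<And>m. m \<in> Q \<Longrightarrow> \<bar>g l m\<bar> \<le> 1"
  shows "\<bar>form (cells d0 m0) {l} (\<lambda>l. cell_fun j \<kappa> (k l)) (\<lambda>l. cell_fun_scaled j \<kappa> (h l)) Q f g\<bar>
    \<le> (real \<kappa> + 8) * card Q"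
proof -
  let ?k = "\<lambda>l. cell_fun j \<kappa> (k l)" and ?h = "\<lambda>l. cell_fun_scaled j \<kappa> (h l)"
  interpret haar_shift \<kappa> "h l" "k l" by standard (rule gen)
  interpret ht: haar_tree "{l}" "\<lambda>u. \<bar>u l\<bar>" "\<lambda>u. \<bar>u l\<bar>" "cells d0 m0" "2 ^ CARD('n)"
    ?k ?h "real \<kappa>"
    by (rule haar_tree_cells[OF dual_norms_abs]) (use gen in auto)
  define v where "v = cube_volume TYPE('n) j"
  have v: "0 < v" by (simp add: v_def cube_volume_pos)
  have finQ: "finite Q" by (rule ht.finite_cube[OF Q])
  obtain dq mq where dq: "dq \<le> d0" "Q = cell dq mq" using Q by (auto simp: cells_def)
  define i0 where "i0 = j - int dq"
  define QQ where "QQ = (region j Q :: (real^'n) set)"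
  obtain M where QQ: "QQ = dyadic_cube i0 M" by (simp add: QQ_def dq region_cell i0_def)
  have vQ: "cube_volume TYPE('n) i0 = v * card Q"
    by (simp add: i0_def cube_volume_coarser v_def dq card_cell)
  define F where "F x = (if grid_index j x \<in> Q then f l (grid_index j x) else 0)" for x
  have Fm [measurable]: "F \<in> borel_measurable lebesgue"
    unfolding F_def by (rule grid_function_measurable[of "\<lambda>m. if m \<in> Q then f l m else 0" j])
  have FQ: "\<bar>F x\<bar> \<le> indicator QQ x" for x
    using f by (auto simp: F_def QQ_def region_def indicator_def)
  have F1: "\<bar>F x\<bar> \<le> 1" for x using f by (auto simp: F_def)
  have leaf: "leaf_avg j F m = f l m" if "m \<in> Q" for m
  proof -
    have "(LINT x:dyadic_cube j m|lebesgue. F x) = (LINT x:dyadic_cube j m|lebesgue. f l m)"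
      using that by (intro set_lebesgue_integral_cong) (auto simp: mem_dyadic_cube F_def)
    also have "\<dots> = f l m * v"
      by (simp add: set_lebesgue_integral_def measure_dyadic_cube v_def)
    finally show ?thesis using v by (simp add: leaf_avg_def v_def)
  qed
  define T where "T = apply_shift (cells d0 m0) ?k ?h Q
      (\<lambda>_. leaf_avg j F) l"
  have "form (cells d0 m0) {l} ?k ?h Q f g
      = form (cells d0 m0) {l} ?k ?h Q (\<lambda>_. leaf_avg j F) g"
    unfolding form_def block_def by (intro sum.cong refl arg_cong2[of _ _ _ _ "(*)"]) (auto simp: leaf)
  also have "\<dots> = (\<Sum>m\<in>Q. T m * g l m)"
    unfolding ht.form_eq_apply_shift[OF Q] T_def by simp
  also have "\<bar>\<dots>\<bar> \<le> (\<Sum>m\<in>Q. \<bar>T m\<bar>)"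
    using g by (intro order_trans[OF sum_abs] sum_mono) (auto simp: abs_mult intro!: mult_left_le)
  finally have form_le: "\<bar>form (cells d0 m0) {l} ?k ?h Q f g\<bar>
      \<le> (\<Sum>m\<in>Q. \<bar>T m\<bar>)" .
  define t where "t i x = haar_term (h l) (k l) i F x" for i x
  have T: "T (grid_index j x) = (\<Sum>d\<in>{\<kappa>..dq}. t (j - int d) x)" if x: "x \<in> QQ" for x
  proof -
    define m where "m = grid_index j x"
    have mQ: "m \<in> Q" using x by (simp add: QQ_def region_def m_def)
    then have "cell dq m = Q" using cell_eq dq by blast
    moreover have "m \<in> cell d0 m0" using cells_E[OF Q mQ] by blast
    ultimately show ?thesis
      using apply_shift_cells[where f = "\<lambda>_. F" and h = h and k = k and l = l and \<kappa> = \<kappa> and j = j, OF gen _ m_def[symmetric] dq(1)]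
        set_integrable_bounded_cube[OF Fm F1] by (simp add: T_def t_def m_def)
  qed
  have "ennreal (v * (\<Sum>m\<in>Q. \<bar>T m\<bar>)) \<le> ennreal (v * ((real \<kappa> + 8) * card Q))"
  proof (cases "dq < \<kappa>")
    case True
    have "T m = 0" if "m \<in> Q" for m
      using T[of "grid_point j m"] that True by (simp add: QQ_def region_def)
    then show ?thesis by simp
  next
    case False
    define u where "u N m x = \<bar>\<Sum>i\<in>{j..int N}. haar_term (h l) (k l) i (indicator (dyadic_cube j m)) x\<bar>" for N m x
    have "\<forall>\<^sub>F N in sequentially. \<forall>m\<in>Q. (\<integral>\<^sup>+x. ennreal (u N m x) * indicator (dyadic_cube j m) x \<partial>lebesgue) \<le> ennreal (4 * v)"
      unfolding u_def v_def using finQ by (intro eventually_ball_finite ballI local_L1_bound) auto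
    moreover have "\<forall>\<^sub>F N in sequentially. (\<integral>\<^sup>+x. ennreal \<bar>\<Sum>i\<in>{i0..int N}. t i x\<bar> * indicator QQ x \<partial>lebesgue)
        \<le> ennreal (4 * (v * card Q))"
      unfolding t_def vQ[symmetric] QQ by (rule local_L1_bound) (use FQ QQ in auto)
    ultimately have "\<forall>\<^sub>F N in sequentially. (\<forall>m\<in>Q. (\<integral>\<^sup>+x. ennreal (u N m x) * indicator (dyadic_cube j m) x \<partial>lebesgue) \<le> ennreal (4 * v)) \<and>
        (\<integral>\<^sup>+x. ennreal \<bar>\<Sum>i\<in>{i0..int N}. t i x\<bar> * indicator QQ x \<partial>lebesgue) \<le> ennreal (4 * (v * card Q)) \<and> nat \<bar>j\<bar> \<le> N"
      by (intro eventually_conj eventually_ge_at_top)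
    then obtain N where N: "\<And>m. m \<in> Q \<Longrightarrow> (\<integral>\<^sup>+x. ennreal (u N m x) * indicator (dyadic_cube j m) x \<partial>lebesgue) \<le> ennreal (4 * v)"
      "(\<integral>\<^sup>+x. ennreal \<bar>\<Sum>i\<in>{i0..int N}. t i x\<bar> * indicator QQ x \<partial>lebesgue) \<le> ennreal (4 * (v * card Q))"
      "nat \<bar>j\<bar> \<le> N"
      unfolding eventually_sequentially by blast
    have tm [measurable]: "t i \<in> borel_measurable lebesgue" for i
      unfolding t_def by (rule haar_term_measurable)
    have um [measurable]: "u N m \<in> borel_measurable lebesgue" for m
      unfolding u_def by measurable
    have QQm [measurable]: "QQ \<in> sets lebesgue" by (simp add: QQ_def)
    have TT: "\<bar>T (grid_index j x)\<bar> \<le> \<bar>\<Sum>i\<in>{i0..int N}. t i x\<bar> + real \<kappa> + u N (grid_index j x) x" if x: "x \<in> QQ" for x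
    proof -
      define m where "m = grid_index j x"
      have mQ: "m \<in> Q" using x by (simp add: QQ_def region_def m_def)
      have "bij_betw (\<lambda>d. j - int d) {\<kappa>..dq} {i0..j - int \<kappa>}"
        by (rule bij_betwI[where g = "\<lambda>i. nat (j - i)"]) (auto simp: i0_def)
      then have Tm: "T m = (\<Sum>i\<in>{i0..j - int \<kappa>}. t i x)"
        unfolding m_def T[OF x] by (rule sum.reindex_bij_betw)
      have "{i0..int N} = {i0..j - int \<kappa>} \<union> ({j - int \<kappa><..<j} \<union> {j..int N})"
        using False N(3) by (auto simp: i0_def)
      moreover have "{i0..j - int \<kappa>} \<inter> ({j - int \<kappa><..<j} \<union> {j..int N}) = {}"
        "{j - int \<kappa><..<j} \<inter> {j..int N} = {}" using \<kappa>1 by auto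
      ultimately have "(\<Sum>i\<in>{i0..int N}. t i x) = (\<Sum>i\<in>{i0..j - int \<kappa>}. t i x)
          + ((\<Sum>i\<in>{j - int \<kappa><..<j}. t i x) + (\<Sum>i\<in>{j..int N}. t i x))"
        by (simp add: sum.union_disjoint)
      moreover have "\<bar>\<Sum>i\<in>{j - int \<kappa><..<j}. t i x\<bar> \<le> real \<kappa>"
      proof -
        have "\<bar>\<Sum>i\<in>{j - int \<kappa><..<j}. t i x\<bar> \<le> (\<Sum>i\<in>{j - int \<kappa><..<j}. 1)"
          unfolding t_def by (rule order_trans[OF sum_abs]) (intro sum_mono haar_term_le_1 Fm F1)
        also have "\<dots> \<le> real \<kappa>" by simp
        finally show ?thesis .
      qed
      moreover have "\<bar>\<Sum>i\<in>{j..int N}. t i x\<bar> \<le> u N m x"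
      proof -
        have "t i x = f l m * haar_term (h l) (k l) i (indicator (dyadic_cube j m)) x" if "i \<in> {j..int N}" for i
          unfolding t_def m_def using that mQ by (intro haar_term_localize) (auto simp: F_def m_def)
        then have "(\<Sum>i\<in>{j..int N}. t i x) = f l m * (\<Sum>i\<in>{j..int N}. haar_term (h l) (k l) i (indicator (dyadic_cube j m)) x)"
          by (simp add: sum_distrib_left)
        then show ?thesis using f[OF mQ] by (simp add: u_def abs_mult mult_left_le_one_le)
      qed
      ultimately show ?thesis using Tm unfolding m_def by linarith
    qed
    have "ennreal (v * (\<Sum>m\<in>Q. \<bar>T m\<bar>)) = (\<Sum>m\<in>Q. \<integral>\<^sup>+x. ennreal \<bar>T (grid_index j x)\<bar> * indicator (dyadic_cube j m) x \<partial>lebesgue)"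
    proof -
      have "(\<integral>\<^sup>+x. ennreal \<bar>T (grid_index j x)\<bar> * indicator (dyadic_cube j m) x \<partial>lebesgue) = ennreal (v * \<bar>T m\<bar>)" for m
      proof -
        have "(\<integral>\<^sup>+x. ennreal \<bar>T (grid_index j x)\<bar> * indicator (dyadic_cube j m) x \<partial>lebesgue)
            = (\<integral>\<^sup>+x. ennreal \<bar>T m\<bar> * indicator (dyadic_cube j m) x \<partial>lebesgue)"
          by (intro nn_integral_cong) (auto simp: indicator_def mem_dyadic_cube)
        also have "\<dots> = ennreal \<bar>T m\<bar> * ennreal v"
          by (simp add: nn_integral_cmult_indicator emeasure_dyadic_cube v_def)
        finally show ?thesis using v by (simp add: ennreal_mult' mult.commute)
      qed
      then show ?thesis using v by (simp add: sum_distrib_left sum_ennreal)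
    qed
    also have "\<dots> = (\<integral>\<^sup>+x. ennreal \<bar>T (grid_index j x)\<bar> * indicator QQ x \<partial>lebesgue)"
    proof -
      have [measurable]: "(\<lambda>x. T (grid_index j x)) \<in> borel_measurable lebesgue" by (rule grid_function_measurable)
      show ?thesis unfolding QQ_def by (rule nn_integral_region[symmetric, OF finQ]) measurable
    qed
    also have "\<dots> \<le> (\<integral>\<^sup>+x. ennreal \<bar>\<Sum>i\<in>{i0..int N}. t i x\<bar> * indicator QQ x
        + (ennreal (real \<kappa>) * indicator QQ x + (\<Sum>m\<in>Q. ennreal (u N m x) * indicator (dyadic_cube j m) x)) \<partial>lebesgue)"
    proof (rule nn_integral_mono)
      fix x
      show "ennreal \<bar>T (grid_index j x)\<bar> * indicator QQ x \<le> ennreal \<bar>\<Sum>i\<in>{i0..int N}. t i x\<bar> * indicator QQ x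
        + (ennreal (real \<kappa>) * indicator QQ x + (\<Sum>m\<in>Q. ennreal (u N m x) * indicator (dyadic_cube j m) x))"
      proof (cases "x \<in> QQ")
        case True
        then have mQ: "grid_index j x \<in> Q" by (simp add: QQ_def region_def)
        have u0: "0 \<le> u N m x" for m by (simp add: u_def)
        have "ennreal \<bar>T (grid_index j x)\<bar> \<le> ennreal (\<bar>\<Sum>i\<in>{i0..int N}. t i x\<bar> + (real \<kappa> + u N (grid_index j x) x))"
          using TT[OF True] by (intro ennreal_leI) simp
        also have "\<dots> = ennreal \<bar>\<Sum>i\<in>{i0..int N}. t i x\<bar> + (ennreal (real \<kappa>) + ennreal (u N (grid_index j x) x))"
          using u0 by (simp add: ennreal_plus)
        also have "ennreal (u N (grid_index j x) x) = ennreal (u N (grid_index j x) x) * indicator (dyadic_cube j (grid_index j x)) x"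
          by (simp add: mem_dyadic_cube)
        also have "\<dots> \<le> (\<Sum>m\<in>Q. ennreal (u N m x) * indicator (dyadic_cube j m) x)"
          by (rule member_le_sum[OF mQ _ finQ]) simp
        finally show ?thesis using True by (simp add: add_left_mono)
      qed simp
    qed
    also have "\<dots> = (\<integral>\<^sup>+x. ennreal \<bar>\<Sum>i\<in>{i0..int N}. t i x\<bar> * indicator QQ x \<partial>lebesgue)
        + (ennreal (real \<kappa>) * emeasure lebesgue QQ + (\<Sum>m\<in>Q. \<integral>\<^sup>+x. ennreal (u N m x) * indicator (dyadic_cube j m) x \<partial>lebesgue))"
      by (simp add: nn_integral_add nn_integral_sum nn_integral_cmult_indicator)
    also have "\<dots> \<le> ennreal (4 * (v * card Q)) + (ennreal (real \<kappa>) * ennreal (v * card Q) + (\<Sum>m\<in>Q. ennreal (4 * v)))"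
      using N by (intro add_mono sum_mono) (auto simp: QQ emeasure_dyadic_cube vQ)
    also have "\<dots> = ennreal (4 * (v * card Q) + (real \<kappa> * (v * card Q) + card Q * (4 * v)))"
    proof -
      have "(\<Sum>m\<in>Q. ennreal (4 * v)) = ennreal (card Q * (4 * v))"
        using v by (subst sum_ennreal) auto
      moreover have "ennreal (real \<kappa>) * ennreal (v * card Q) = ennreal (real \<kappa> * (v * card Q))"
        using v by (subst ennreal_mult) auto
      ultimately show ?thesis
        using v by (simp only: ennreal_plus[symmetric] mult_nonneg_nonneg add_nonneg_nonneg less_imp_le of_nat_0_le_iff zero_le_numeral)
    qed
    also have "\<dots> = ennreal (v * ((real \<kappa> + 8) * card Q))"
      by (simp add: algebra_simps)
    finally show ?thesis .
  qed
  then have "v * (\<Sum>m\<in>Q. \<bar>T m\<bar>) \<le> v * ((real \<kappa> + 8) * card Q)"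
    using v by (subst (asm) ennreal_le_iff) auto
  then show ?thesis using form_le v by simp
qed

section \<open>Weights and leaf averages\<close>

lemma lr_measurable [measurable]:
  "(\<And>l. l \<in> L \<Longrightarrow> f l \<in> borel_measurable M) \<Longrightarrow> (\<lambda>x. lr L r (\<lambda>l. f l x)) \<in> borel_measurable M"
  unfolding lr_def by measurable

lemma sum_leaf_avg:
  assumes Q: "finite Q" and f: "\<And>m. m \<in> Q \<Longrightarrow> set_integrable lebesgue (dyadic_cube j m) f"
  shows "(\<Sum>m\<in>Q. leaf_avg j f m) * cube_volume TYPE('n::finite) j = (LINT x:region j Q|lebesgue. f (x :: real^'n))"
proof -
  have "indicator (region j Q) x = (\<Sum>m\<in>Q. indicator (dyadic_cube j m) x :: real)" for x :: "real^'n"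
    using Q by (auto simp: indicator_def mem_dyadic_cube region_def sum.delta')
  then have "(LINT x:region j Q|lebesgue. f x) = (\<integral>x. (\<Sum>m\<in>Q. indicator (dyadic_cube j m) x *\<^sub>R f x) \<partial>lebesgue)"
    unfolding set_lebesgue_integral_def by (simp add: sum_distrib_right)
  also have "\<dots> = (\<Sum>m\<in>Q. LINT x:dyadic_cube j m|lebesgue. f x)"
    unfolding set_lebesgue_integral_def
    by (subst Bochner_Integration.integral_sum) (use f in \<open>auto simp: set_integrable_def\<close>)
  also have "\<dots> = (\<Sum>m\<in>Q. leaf_avg j f m) * cube_volume TYPE('n) j"
    using cube_volume_pos[where 'n = 'n, of j] by (simp add: leaf_avg_def sum_distrib_right)
  finally show ?thesis by simp
qed

lemma nn_integral_leaf:
  fixes f :: "real^'n::finite \<Rightarrow> real"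
  assumes f: "set_integrable lebesgue (dyadic_cube j m) f" and pos: "AE x in lebesgue. 0 \<le> f x"
  shows "(\<integral>\<^sup>+x. ennreal (f x) * indicator (dyadic_cube j m) x \<partial>lebesgue)
    = ennreal (cube_volume TYPE('n) j * leaf_avg j f m)"
proof -
  have "(\<integral>\<^sup>+x. ennreal (f x) * indicator (dyadic_cube j m) x \<partial>lebesgue)
      = (\<integral>\<^sup>+x. ennreal (indicator (dyadic_cube j m) x *\<^sub>R f x) \<partial>lebesgue)"
    by (intro nn_integral_cong) (auto simp: indicator_def)
  also have "\<dots> = ennreal (LINT x:dyadic_cube j m|lebesgue. f x)"
    unfolding set_lebesgue_integral_def using f pos
    by (intro nn_integral_eq_integral) (auto simp: set_integrable_def)
  also have "(LINT x:dyadic_cube j m|lebesgue. f x) = cube_volume TYPE('n) j * leaf_avg j f m"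
    using cube_volume_pos[where 'n = 'n, of j] by (simp add: leaf_avg_def)
  finally show ?thesis .
qed

lemma leaf_avg_pos:
  fixes f :: "real^'n::finite \<Rightarrow> real"
  assumes f: "set_integrable lebesgue (dyadic_cube j m) f" and m: "f \<in> borel_measurable lebesgue"
    and pos: "AE x in lebesgue. 0 < f x"
  shows "0 < leaf_avg j f m"
proof (rule ccontr)
  assume "\<not> 0 < leaf_avg j f m"
  then have "cube_volume TYPE('n) j * leaf_avg j f m \<le> 0"
    using cube_volume_pos[where 'n = 'n, of j] by (simp add: mult_le_0_iff)
  moreover have "AE x in lebesgue. 0 \<le> f x" using pos by eventually_elim simp
  ultimately have "(\<integral>\<^sup>+x. ennreal (f x) * indicator (dyadic_cube j m) x \<partial>lebesgue) = 0"
    using nn_integral_leaf[OF f] by (simp add: ennreal_neg)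
  then have "AE x in lebesgue. ennreal (f x) * indicator (dyadic_cube j m) x = 0"
    using m by (subst (asm) nn_integral_0_iff_AE) auto
  with pos have "AE x in lebesgue. x \<notin> dyadic_cube j m"
  proof eventually_elim
    case (elim x)
    then show ?case by (auto simp: ennreal_mult_eq_top_iff indicator_def split: if_splits)
  qed
  then have "emeasure lebesgue (dyadic_cube j m :: (real^'n) set) = 0"
    by (subst (asm) AE_iff_measurable[OF dyadic_cube_sets[of j m]]) auto
  then show False
    using cube_volume_pos[where 'n = 'n, of j] by (simp add: emeasure_dyadic_cube)
qed

text \<open>Hoelder's inequality for averages, obtained by integrating the tangent inequality.\<close>
lemma leaf_avg_powr_quotient_le:
  fixes \<phi> s \<Phi> :: "real^'n::finite \<Rightarrow> real"
  assumes p: "1 < p"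
    and int: "set_integrable lebesgue (dyadic_cube j m) \<phi>" "set_integrable lebesgue (dyadic_cube j m) s"
      "set_integrable lebesgue (dyadic_cube j m) \<Phi>"
    and s: "AE x in lebesgue. 0 < s x" and avg: "0 \<le> leaf_avg j \<phi> m" "0 < leaf_avg j s m"
    and le: "AE x in lebesgue. \<bar>\<phi> x\<bar> powr p / s x powr (p - 1) \<le> \<Phi> x"
  shows "leaf_avg j \<phi> m powr p / leaf_avg j s m powr (p - 1) \<le> leaf_avg j \<Phi> m"
proof -
  define c where "c = leaf_avg j \<phi> m / leaf_avg j s m"
  have c: "0 \<le> c" using avg by (simp add: c_def)
  define v where "v = cube_volume TYPE('n) j"
  have v: "0 < v" by (simp add: v_def cube_volume_pos)
  have li: "(LINT x:dyadic_cube j m|lebesgue. g x) = leaf_avg j g m * v" for g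
    using v by (simp add: leaf_avg_def v_def)
  have "(LINT x:dyadic_cube j m|lebesgue. p * c powr (p - 1) * \<phi> x - (p - 1) * c powr p * s x)
      \<le> (LINT x:dyadic_cube j m|lebesgue. \<Phi> x)"
  proof (rule set_integral_mono_AE)
    show "set_integrable lebesgue (dyadic_cube j m) (\<lambda>x. p * c powr (p - 1) * \<phi> x - (p - 1) * c powr p * s x)"
      using int by (intro set_integral_diff set_integrable_mult_right) auto
    have "AE x in lebesgue. p * c powr (p - 1) * \<phi> x - (p - 1) * c powr p * s x \<le> \<Phi> x"
      using s le
    proof eventually_elim
      case (elim x)
      have "p * c powr (p - 1) * \<phi> x \<le> p * c powr (p - 1) * \<bar>\<phi> x\<bar>"
        using p by (intro mult_left_mono) auto
      with powr_tangent_le[OF p c, of "\<bar>\<phi> x\<bar>" "s x"] elim show ?case by linarith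
    qed
    then show "AE x\<in>dyadic_cube j m in lebesgue. p * c powr (p - 1) * \<phi> x - (p - 1) * c powr p * s x \<le> \<Phi> x"
      by eventually_elim simp
  qed (rule int)
  also have "(LINT x:dyadic_cube j m|lebesgue. p * c powr (p - 1) * \<phi> x - (p - 1) * c powr p * s x)
      = p * c powr (p - 1) * (LINT x:dyadic_cube j m|lebesgue. \<phi> x) - (p - 1) * c powr p * (LINT x:dyadic_cube j m|lebesgue. s x)"
    using int by (subst set_integral_diff) auto
  finally have "(p * c powr (p - 1) * leaf_avg j \<phi> m - (p - 1) * c powr p * leaf_avg j s m) * v \<le> leaf_avg j \<Phi> m * v"
    unfolding li by (simp add: algebra_simps)
  then show ?thesis
    using v avg powr_quotient_eq_tangent[of "leaf_avg j \<phi> m" "leaf_avg j s m" p] by (simp add: c_def)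
qed

lemma leaf_avg_cell_sum:
  fixes f :: "real^'n::finite \<Rightarrow> real"
  assumes "\<And>m'. set_integrable lebesgue (dyadic_cube j m') f"
  shows "(\<Sum>m'\<in>cell d m. leaf_avg j f m') = card (cell d m) * leaf_avg (j - int d) f (\<chi> i. m $ i div 2 ^ d)"
  using sum_leaf_avg[of "cell d m" j f] assms cube_volume_pos[where 'n = 'n, of j]
  by (simp add: cell_finite region_cell leaf_avg_def[of "j - int d"] cube_volume_coarser card_cell field_simps)

lemma dyadic_cube_subset_compact: "\<exists>K. compact K \<and> dyadic_cube i m \<subseteq> K"
  using dyadic_cube_subset_cube[of i m] compact_cbox unfolding cube_def by blast

lemma locally_integrable_cube:
  assumes "locally_integrable f" shows "set_integrable lebesgue (dyadic_cube i m) f"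
proof -
  obtain K where "compact K" "dyadic_cube i m \<subseteq> K" using dyadic_cube_subset_compact by blast
  then show ?thesis
    using assms set_integrable_subset[of lebesgue K f "dyadic_cube i m"] by (auto simp: locally_integrable_def)
qed

locale Ap_weight =
  fixes p :: real and w :: "real^'n::finite \<Rightarrow> real"
  assumes p: "1 < p" and w: "w \<in> Ap_weights p"
begin

definition dual_weight where "dual_weight x = w x powr (- 1 / (p - 1))"

definition char_real where "char_real = enn2real (Ap_char p w)"

lemma Ap_char_eq: "Ap_char p w = ennreal char_real"
  using w by (simp add: Ap_weights_def char_real_def)

lemma w_measurable [measurable]: "w \<in> borel_measurable lebesgue"
  using w by (simp add: Ap_weights_def weight_def locally_integrable_def)

lemma dual_weight_measurable [measurable]: "dual_weight \<in> borel_measurable lebesgue"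
  unfolding dual_weight_def[abs_def] by measurable

lemma w_pos: "AE x in lebesgue. 0 < w x"
  using w by (simp add: Ap_weights_def weight_def)

lemma dual_weight_pos: "AE x in lebesgue. 0 < dual_weight x"
  using w_pos by eventually_elim (simp add: dual_weight_def)

lemma w_integrable: "set_integrable lebesgue (dyadic_cube i m) w"
  using w by (intro locally_integrable_cube) (simp add: Ap_weights_def weight_def)

lemma w_avg_pos: "0 < leaf_avg i w m"
  by (intro leaf_avg_pos w_integrable w_pos w_measurable)

lemma average_cube_ge:
  fixes m :: "int^'n"
  assumes "f \<in> borel_measurable lebesgue"
  shows "(\<integral>\<^sup>+x. ennreal (f x) * indicator (dyadic_cube i m) x \<partial>lebesgue) / ennreal (cube_volume TYPE('n) i)
    \<le> average (cube (grid_point i m) (2 powi (- i))) f"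
proof -
  have "emeasure lebesgue (cube (grid_point i m) (2 powi (- i))) = ennreal (cube_volume TYPE('n) i)"
    by (simp add: emeasure_cube cube_volume_def)
  moreover have "(\<integral>\<^sup>+x. ennreal (f x) * indicator (dyadic_cube i m) x \<partial>lebesgue)
      \<le> (\<integral>\<^sup>+x. ennreal (f x) * indicator (cube (grid_point i m) (2 powi (- i))) x \<partial>lebesgue)"
    using dyadic_cube_subset_cube[of i m]
    by (intro nn_integral_mono) (auto simp: indicator_def)
  ultimately show ?thesis unfolding average_def by (simp add: divide_right_mono_ennreal)
qed

lemma Ap_cube_le:
  "average (cube a s) w * ennpow (average (cube a s) dual_weight) (p - 1) \<le> Ap_char p w" if "0 < s"
  unfolding Ap_char_def dual_weight_def[abs_def]
  using that by (intro SUP_upper2[of "(a, s)"]) auto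

lemma w_average_ge: "ennreal (leaf_avg i w m) \<le> average (cube (grid_point i m) (2 powi (- i))) w"
proof -
  have "AE x in lebesgue. 0 \<le> w x" using w_pos by eventually_elim simp
  then have "ennreal (leaf_avg i w m) = (\<integral>\<^sup>+x. ennreal (w x) * indicator (dyadic_cube i m) x \<partial>lebesgue) / ennreal (cube_volume TYPE('n) i)"
    using cube_volume_pos[where 'n = 'n, of i] w_avg_pos[of i m]
    by (simp add: nn_integral_leaf[OF w_integrable] divide_ennreal)
  then show ?thesis using average_cube_ge[OF w_measurable] by simp
qed

text \<open>The average of \<open>w\<close> over a cube is positive, and so a finite \<open>A\<^sub>p\<close> characteristic forces
  the other factor to be finite.\<close>
lemma dual_weight_integrable: "set_integrable lebesgue (dyadic_cube i m) dual_weight"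
proof -
  define Q where "Q = cube (grid_point i m) (2 powi (- i))"
  have "ennpow (average Q dual_weight) (p - 1) \<noteq> top"
  proof
    assume "ennpow (average Q dual_weight) (p - 1) = top"
    moreover have "average Q w \<noteq> 0"
      using w_average_ge[of i m] w_avg_pos[of i m] unfolding Q_def by (auto simp: ennreal_eq_0_iff)
    ultimately have "average Q w * ennpow (average Q dual_weight) (p - 1) = top"
      by (simp add: ennreal_mult_top)
    then show False
      using Ap_cube_le[of "2 powi (- i)" "grid_point i m"] w unfolding Q_def Ap_weights_def by (simp add: top_unique)
  qed
  then have "average Q dual_weight \<noteq> top" by auto
  then have fin: "(\<integral>\<^sup>+x. ennreal (dual_weight x) * indicator (dyadic_cube i m) x \<partial>lebesgue) / ennreal (cube_volume TYPE('n) i) \<noteq> top"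
    using average_cube_ge[OF dual_weight_measurable, of i m] unfolding Q_def by (metis top_unique)
  then have "(\<integral>\<^sup>+x. ennreal (dual_weight x) * indicator (dyadic_cube i m) x \<partial>lebesgue) \<noteq> top"
    by (metis ennreal_divide_top ennreal_top_divide ennreal_neq_top)
  then have "(\<integral>\<^sup>+x. ennreal (dual_weight x) * indicator (dyadic_cube i m) x \<partial>lebesgue) < \<infinity>"
    by (simp add: top.not_eq_extremum)
  moreover have "(\<integral>\<^sup>+x. ennreal (norm (indicator (dyadic_cube i m) x *\<^sub>R dual_weight x)) \<partial>lebesgue)
      = (\<integral>\<^sup>+x. ennreal (dual_weight x) * indicator (dyadic_cube i m) x \<partial>lebesgue)"
    by (intro nn_integral_cong) (auto simp: indicator_def dual_weight_def)
  ultimately show ?thesis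
    unfolding set_integrable_def by (intro integrableI_bounded) auto
qed

lemma dual_avg_pos: "0 < leaf_avg i dual_weight m"
  by (intro leaf_avg_pos dual_weight_integrable dual_weight_pos dual_weight_measurable)

lemma Ap_leaf: "leaf_avg i w m * leaf_avg i dual_weight m powr (p - 1) \<le> char_real"
proof -
  define Q where "Q = cube (grid_point i m) (2 powi (- i))"
  have "AE x in lebesgue. 0 \<le> dual_weight x" using dual_weight_pos by eventually_elim simp
  then have "ennreal (leaf_avg i dual_weight m) =
      (\<integral>\<^sup>+x. ennreal (dual_weight x) * indicator (dyadic_cube i m) x \<partial>lebesgue) / ennreal (cube_volume TYPE('n) i)"
    using cube_volume_pos[where 'n = 'n, of i] dual_avg_pos[of i m]
    by (simp add: nn_integral_leaf[OF dual_weight_integrable] divide_ennreal)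
  then have dual: "ennreal (leaf_avg i dual_weight m) \<le> average Q dual_weight"
    using average_cube_ge[OF dual_weight_measurable] by (simp add: Q_def)
  have "ennreal (leaf_avg i w m * leaf_avg i dual_weight m powr (p - 1))
      = ennreal (leaf_avg i w m) * ennpow (ennreal (leaf_avg i dual_weight m)) (p - 1)"
    using w_avg_pos[of i m] dual_avg_pos[of i m] by (simp add: ennpow_ennreal ennreal_mult)
  also have "\<dots> \<le> average Q w * ennpow (average Q dual_weight) (p - 1)"
    using w_average_ge dual p unfolding Q_def by (intro mult_mono ennpow_mono) auto
  also have "\<dots> \<le> ennreal char_real"
    using Ap_cube_le[of "2 powi (- i)" "grid_point i m"] by (simp add: Q_def Ap_char_eq)
  finally show ?thesis
    by (subst (asm) ennreal_le_iff) (simp_all add: char_real_def)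
qed

lemma Ap_cell:
  "sum (leaf_avg j w) (cell d m) * sum (leaf_avg j dual_weight) (cell d m) powr (p - 1)
    \<le> char_real * real (card (cell d m)) powr p"
proof -
  define c where "c = real (card (cell d m))"
  have c: "0 < c" by (simp add: c_def card_cell)
  define M where "M = (\<chi> i. m $ i div 2 ^ d)"
  have "c * leaf_avg (j - int d) w M * (c * leaf_avg (j - int d) dual_weight M) powr (p - 1)
      = (leaf_avg (j - int d) w M * leaf_avg (j - int d) dual_weight M powr (p - 1)) * c powr p"
    using c dual_avg_pos[of "j - int d" M] by (simp add: powr_mult powr_diff)
  also have "\<dots> \<le> char_real * c powr p"
    by (intro mult_right_mono Ap_leaf) simp
  finally show ?thesis
    by (simp add: leaf_avg_cell_sum w_integrable dual_weight_integrable c_def M_def)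
qed

lemma dual_weight_quotient:
  assumes "0 < w x" shows "y / dual_weight x powr (p - 1) = y * w x"
proof -
  have "dual_weight x powr (p - 1) = w x powr (- 1)"
    unfolding dual_weight_def powr_powr using p by simp
  then show ?thesis using assms by (simp add: powr_minus_divide)
qed

lemma one_le_avgs: "1 \<le> leaf_avg j w m * leaf_avg j dual_weight m powr (p - 1)"
proof -
  have one: "leaf_avg j (\<lambda>_. 1) m = 1" for m :: "int^'n"
    using cube_volume_pos[where 'n = 'n, of j]
    by (simp add: leaf_avg_def set_lebesgue_integral_def measure_dyadic_cube)
  have "leaf_avg j (\<lambda>_. 1) m powr p / leaf_avg j dual_weight m powr (p - 1) \<le> leaf_avg j w m"
  proof (rule leaf_avg_powr_quotient_le[OF p _ dual_weight_integrable w_integrable dual_weight_pos _ dual_avg_pos])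
    show "set_integrable lebesgue (dyadic_cube j m) (\<lambda>_. 1 :: real)"
      by (intro set_integrable_bounded_cube) auto
    show "AE x in lebesgue. \<bar>1\<bar> powr p / dual_weight x powr (p - 1) \<le> w x"
      using w_pos by eventually_elim (simp add: dual_weight_quotient)
  qed (simp add: one)
  then show ?thesis using dual_avg_pos[of j m] by (simp add: one divide_le_eq)
qed

text \<open>Hoelder's inequality on a single cube.\<close>
lemma char_real_ge_1: "1 \<le> char_real"
  using one_le_avgs[of 0 0] Ap_leaf[of 0 0] by linarith

text \<open>Pairing the averages with a norming vector \<open>c\<close> reduces this to Hoelder's inequality for the
  single function \<open>\<Sum>\<^sub>l c\<^sub>l f\<^sub>l\<close>, which is at most the norm of \<open>f(x)\<close>.\<close>
lemma lr_leaf_avg_le: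
  fixes f :: "'j \<Rightarrow> real^'n \<Rightarrow> real"
  assumes r: "1 < r" and L: "finite L"
    and f: "\<And>l. l \<in> L \<Longrightarrow> set_integrable lebesgue (dyadic_cube j m) (f l)"
    and \<Phi>: "set_integrable lebesgue (dyadic_cube j m) (\<lambda>x. lr L r (\<lambda>l. f l x) powr p * w x)"
  shows "lr L r (\<lambda>l. leaf_avg j (f l) m) powr p / leaf_avg j dual_weight m powr (p - 1)
    \<le> leaf_avg j (\<lambda>x. lr L r (\<lambda>l. f l x) powr p * w x) m"
proof -
  interpret dual_norms L "lr L r" "lr L (r / (r - 1))" by (rule dual_norms_lr[OF r L])
  obtain c where c: "lr L (r / (r - 1)) c \<le> 1" "(\<Sum>l\<in>L. leaf_avg j (f l) m * c l) = lr L r (\<lambda>l. leaf_avg j (f l) m)"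
    using ex_norming[of "\<lambda>l. leaf_avg j (f l) m"] by auto
  define \<phi> where "\<phi> x = (\<Sum>l\<in>L. f l x * c l)" for x
  have int: "set_integrable lebesgue (dyadic_cube j m) \<phi>"
    unfolding \<phi>_def set_integrable_def scaleR_sum_right using f
    by (intro Bochner_Integration.integrable_sum) (auto simp: set_integrable_def simp flip: mult.assoc)
  have avg: "leaf_avg j \<phi> m = lr L r (\<lambda>l. leaf_avg j (f l) m)"
  proof -
    have "(LINT x:dyadic_cube j m|lebesgue. \<phi> x) = (\<Sum>l\<in>L. (LINT x:dyadic_cube j m|lebesgue. f l x) * c l)"
      unfolding \<phi>_def set_lebesgue_integral_def scaleR_sum_right using f
      by (subst Bochner_Integration.integral_sum) (auto simp: set_integrable_def simp flip: mult.assoc)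
    then show ?thesis unfolding c(2)[symmetric] by (simp add: leaf_avg_def sum_divide_distrib)
  qed
  have "\<bar>\<phi> x\<bar> \<le> lr L r (\<lambda>l. f l x)" for x
  proof -
    have "\<bar>\<phi> x\<bar> \<le> (\<Sum>l\<in>L. \<bar>f l x\<bar> * \<bar>c l\<bar>)"
      unfolding \<phi>_def abs_mult[symmetric] by (rule sum_abs)
    also have "\<dots> \<le> lr L r (\<lambda>l. f l x) * lr L (r / (r - 1)) c" by (rule holder)
    also have "\<dots> \<le> lr L r (\<lambda>l. f l x) * 1" by (intro mult_left_mono c lr_nonneg)
    finally show ?thesis by simp
  qed
  then have le: "\<bar>\<phi> x\<bar> powr p \<le> lr L r (\<lambda>l. f l x) powr p" for x
    using p by (intro powr_mono2) auto
  have "leaf_avg j \<phi> m powr p / leaf_avg j dual_weight m powr (p - 1)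
    \<le> leaf_avg j (\<lambda>x. lr L r (\<lambda>l. f l x) powr p * w x) m"
  proof (rule leaf_avg_powr_quotient_le[OF p int dual_weight_integrable \<Phi> dual_weight_pos _ dual_avg_pos])
    show "0 \<le> leaf_avg j \<phi> m" by (simp add: avg lr_nonneg)
    show "AE x in lebesgue. \<bar>\<phi> x\<bar> powr p / dual_weight x powr (p - 1) \<le> lr L r (\<lambda>l. f l x) powr p * w x"
      using w_pos by eventually_elim (simp add: dual_weight_quotient le mult_right_mono)
  qed
  then show ?thesis by (simp add: avg)
qed

end

section \<open>From one root cube to the whole space\<close>

lemma nn_integral_grid:
  fixes G :: "real^'n::finite \<Rightarrow> ennreal"
  assumes [measurable]: "G \<in> borel_measurable lebesgue"
  shows "(\<integral>\<^sup>+x. G x \<partial>lebesgue)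
    = (\<integral>\<^sup>+M. (\<integral>\<^sup>+x. G x * indicator (dyadic_cube i M) x \<partial>lebesgue) \<partial>count_space UNIV)"
proof -
  have "(\<Union>M. dyadic_cube i M) = (UNIV :: (real^'n) set)" by (auto simp: mem_dyadic_cube)
  then have "(\<integral>\<^sup>+x. G x \<partial>lebesgue) = emeasure (density lebesgue G) (\<Union>M. dyadic_cube i M)"
    by (simp add: emeasure_density)
  also have "\<dots> = (\<integral>\<^sup>+M. emeasure (density lebesgue G) (dyadic_cube i M) \<partial>count_space UNIV)"
    by (rule emeasure_UN_countable) (auto simp: disjoint_family_on_def mem_dyadic_cube)
  finally show ?thesis by (simp add: emeasure_density)
qed

definition shift_const :: "real \<Rightarrow> real \<Rightarrow> real \<Rightarrow> real" where
  "shift_const p r B = 2 * tree_const p B * (20 * tree_const r B + 1)"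

lemma shift_const_pos: "1 < p \<Longrightarrow> 1 < r \<Longrightarrow> 1 \<le> B \<Longrightarrow> 0 < shift_const p r B"
  using tree_const_pos[of p B] tree_const_pos[of r B] by (auto simp: shift_const_def intro!: mult_pos_pos)

locale vector_shift = Ap_weight p w for p and w :: "real^'n::finite \<Rightarrow> real" +
  fixes r :: real and \<kappa> :: nat and h k :: "nat \<Rightarrow> 'n cube_family" and f :: "nat \<Rightarrow> real^'n \<Rightarrow> real"
  assumes r: "1 < r" and \<kappa>: "1 \<le> \<kappa>" and shift: "\<And>l. generalized_haar_shift \<kappa> (h l) (k l)"
    and loc: "\<And>l. locally_integrable (f l)"
begin

lemma f_measurable [measurable]: "f l \<in> borel_measurable lebesgue"
  using loc[of l] by (simp add: locally_integrable_def)

lemma f_integrable: "set_integrable lebesgue (dyadic_cube j m) (f l)"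
  by (rule locally_integrable_cube[OF loc])

lemma partial_measurable [measurable]: "haar_partial (h l) (k l) N (f l) \<in> borel_measurable lebesgue"
proof -
  interpret haar_shift \<kappa> "h l" "k l" by standard (rule shift)
  show ?thesis unfolding haar_partial_eq[abs_def] by measurable
qed

definition K where "K = shift_const p r (2 ^ CARD('n)) * \<kappa> * char_real powr (max 1 (1 / (p - 1)))"

lemma K_pos: "0 < K"
  unfolding K_def using shift_const_pos[OF p r, of "2 ^ CARD('n)"] \<kappa> char_real_ge_1
  by (intro mult_pos_pos) auto

definition input_density where "input_density L x = lr L r (\<lambda>l. f l x) powr p * w x"

definition partial_density where
  "partial_density L N x = lr L r (\<lambda>l. haar_partial (h l) (k l) N (f l) x) powr p * w x"

text \<open>On a cube of side length \<open>2\<^sup>N\<close> the partial sum is the discrete shift applied to the leaf averages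
  of \<open>f\<close>, and the leaf averages of \<open>w\<close> and \<open>\<sigma>\<close> inherit the \<open>A\<^sub>p\<close> condition.\<close>
lemma root_cube_bound:
  assumes L: "finite L" and fin: "(\<integral>\<^sup>+x. ennreal (input_density L x) \<partial>lebesgue) < \<infinity>"
  shows "(\<integral>\<^sup>+x. ennreal (partial_density L N x) * indicator (dyadic_cube (- int N) M) x \<partial>lebesgue)
    \<le> ennreal (K powr p) * (\<integral>\<^sup>+x. ennreal (input_density L x) * indicator (dyadic_cube (- int N) M) x \<partial>lebesgue)"
proof -
  \<comment> \<open>The leaves have side length \<open>2\<^sup>-\<^sup>j\<close>; the side lengths \<open>2\<^sup>-\<^sup>N, \<dots>, 2\<^sup>N\<close> lie \<open>\<kappa>, \<dots>, 2 N + \<kappa>\<close> generations above them.\<close>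
  define j where "j = int (N + \<kappa>)"
  define d0 where "d0 = 2 * N + \<kappa>"
  define m0 where "m0 = (\<chi> i. M $ i * 2 ^ d0)"
  define Q where "Q = cell d0 m0"
  define D where "D = cells d0 m0"
  define B :: real where "B = 2 ^ CARD('n)"
  have B: "1 \<le> B" by (simp add: B_def)
  have reg: "region j Q = dyadic_cube (- int N) M"
  proof -
    have "j - int d0 = - int N" by (simp add: j_def d0_def)
    then show ?thesis by (simp add: Q_def region_cell m0_def)
  qed
  have QD: "Q \<in> D" unfolding Q_def D_def cells_def using cell_self by blast
  define kk where "kk = (\<lambda>l. cell_fun j \<kappa> (k l))"
  define hh where "hh = (\<lambda>l. cell_fun_scaled j \<kappa> (h l))"
  interpret lr_haar_tree L r D B kk hh "real \<kappa>" "real \<kappa> + 8"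
  proof -
    interpret haar_tree L "lr L r" "lr L (r / (r - 1))" D B kk hh "real \<kappa>"
      unfolding D_def B_def kk_def hh_def by (rule haar_tree_cells[OF dual_norms_lr[OF r L] shift])
    show "lr_haar_tree L r D B kk hh (real \<kappa>) (real \<kappa> + 8)"
    proof
      show "\<bar>form D {l} kk hh J f g\<bar> \<le> (real \<kappa> + 8) * card J"
        if "l \<in> L" "J \<in> D" "\<And>x. x \<in> J \<Longrightarrow> \<bar>f l x\<bar> \<le> 1" "\<And>x. x \<in> J \<Longrightarrow> \<bar>g l x\<bar> \<le> 1" for l J f g
        unfolding D_def kk_def hh_def using that by (intro cell_test[OF \<kappa> shift]) (auto simp: D_def)
    qed (use r in auto)
  qed
  define v where "v = cube_volume TYPE('n) j"
  have v: "0 < v" by (simp add: v_def cube_volume_pos)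
  define wm where "wm = leaf_avg j w"
  define sm where "sm = leaf_avg j dual_weight"
  define fm where "fm = (\<lambda>l. leaf_avg j (f l))"
  define T where "T = apply_shift D kk hh Q fm"
  \<comment> \<open>The constant of the discrete bound for the testing constant \<open>A = \<kappa> + 8\<close>; it is of order \<open>\<kappa>\<close> because \<open>\<kappa> \<ge> 1\<close>.\<close>
  define C where "C = 2 * (tree_const p B * (2 * tree_const r B * (real \<kappa> + 8 + real \<kappa>) + real \<kappa>) * char_real powr (max 1 (1 / (p - 1))))"
  have CK: "C \<le> K" and C0: "0 \<le> C"
  proof -
    have t: "0 < tree_const p B" "0 < tree_const r B" by (intro tree_const_pos p r B)+
    have k1: "1 \<le> real \<kappa>" using \<kappa> by simp
    have "2 * tree_const r B * (real \<kappa> + 8 + real \<kappa>) \<le> 2 * tree_const r B * (10 * real \<kappa>)"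
      using t k1 by (intro mult_left_mono) auto
    then have "2 * tree_const r B * (real \<kappa> + 8 + real \<kappa>) + real \<kappa> \<le> (20 * tree_const r B + 1) * real \<kappa>"
      by (simp add: algebra_simps)
    then have "C \<le> 2 * (tree_const p B * ((20 * tree_const r B + 1) * real \<kappa>) * char_real powr (max 1 (1 / (p - 1))))"
      unfolding C_def using t by (intro mult_left_mono mult_right_mono) auto
    then show "C \<le> K" by (simp add: K_def shift_const_def B_def mult_ac)
    show "0 \<le> C" unfolding C_def using t by (intro mult_nonneg_nonneg add_nonneg_nonneg) auto
  qed
  have \<Phi>m [measurable]: "input_density L \<in> borel_measurable lebesgue"
    unfolding input_density_def[abs_def] by measurable
  have \<Phi>0: "AE x in lebesgue. 0 \<le> input_density L x"
    using w_pos by eventually_elim (simp add: input_density_def)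
  have \<Phi>: "set_integrable lebesgue (dyadic_cube j m) (input_density L)" for m
  proof -
    have "integrable lebesgue (input_density L)"
      using fin \<Phi>0 by (intro integrableI_nonneg) auto
    then show ?thesis unfolding set_integrable_def by (intro integrable_mult_indicator) auto
  qed
  have main: "(\<Sum>m\<in>Q. lr L r (\<lambda>l. T l m) powr p * wm m)
      \<le> C powr p * (\<Sum>m\<in>Q. lr L r (\<lambda>l. fm l m) powr p / sm m powr (p - 1))"
    unfolding T_def C_def
  proof (rule weighted_shift_bound[OF p _ _ _ _ _ _ QD])
    show "sum wm Q * sum sm Q powr (p - 1) \<le> char_real * real (card Q) powr p" if "Q \<in> D" for Q
      using that Ap_cell[of j] by (auto simp: D_def cells_def wm_def sm_def)
  qed (use char_real_ge_1 \<kappa> w_avg_pos dual_avg_pos one_le_avgs in \<open>auto simp: wm_def sm_def\<close>)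
  have T: "haar_partial (h l) (k l) N (f l) x = T l (grid_index j x)" if x: "grid_index j x \<in> Q" for l x
  proof -
    interpret s: haar_shift \<kappa> "h l" "k l" by standard (rule shift)
    define m where "m = grid_index j x"
    have Qm: "cell d0 m = Q" using x cell_eq unfolding Q_def m_def by blast
    have "bij_betw (\<lambda>d. j - int d) {\<kappa>..d0} {- int N..int N}"
      by (rule bij_betwI[where g = "\<lambda>i. nat (j - i)"]) (auto simp: j_def d0_def)
    then have "haar_partial (h l) (k l) N (f l) x = (\<Sum>d\<in>{\<kappa>..d0}. haar_term (h l) (k l) (j - int d) (f l) x)"
      unfolding s.haar_partial_eq by (rule sum.reindex_bij_betw[symmetric])
    also have "\<dots> = T l m"
      unfolding T_def D_def kk_def hh_def fm_def Qm[symmetric]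
      using x by (intro apply_shift_cells[symmetric, OF shift f_integrable m_def[symmetric]])
        (auto simp: Q_def m_def)
    finally show ?thesis by (simp add: m_def)
  qed
  have finQ: "finite Q" by (simp add: Q_def cell_finite)
  have leafint: "(\<integral>\<^sup>+x. ennreal (partial_density L N x) * indicator (dyadic_cube j m) x \<partial>lebesgue)
      = ennreal (v * (lr L r (\<lambda>l. T l m) powr p * wm m))" if m: "m \<in> Q" for m
  proof -
    have "(\<integral>\<^sup>+x. ennreal (partial_density L N x) * indicator (dyadic_cube j m) x \<partial>lebesgue)
        = (\<integral>\<^sup>+x. ennreal (lr L r (\<lambda>l. T l m) powr p) * (ennreal (w x) * indicator (dyadic_cube j m) x) \<partial>lebesgue)"
      using m T by (intro nn_integral_cong) (auto simp: partial_density_def indicator_def mem_dyadic_cube ennreal_mult')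
    also have "\<dots> = ennreal (lr L r (\<lambda>l. T l m) powr p) * (\<integral>\<^sup>+x. ennreal (w x) * indicator (dyadic_cube j m) x \<partial>lebesgue)"
      by (rule nn_integral_cmult) measurable
    also have "AE x in lebesgue. 0 \<le> w x" using w_pos by eventually_elim simp
    then have "(\<integral>\<^sup>+x. ennreal (w x) * indicator (dyadic_cube j m) x \<partial>lebesgue) = ennreal (v * wm m)"
      unfolding v_def wm_def by (rule nn_integral_leaf[OF w_integrable])
    also have "ennreal (lr L r (\<lambda>l. T l m) powr p) * ennreal (v * wm m)
        = ennreal (v * (lr L r (\<lambda>l. T l m) powr p * wm m))"
      using v w_avg_pos[of j m] by (subst ennreal_mult[symmetric]) (auto simp: wm_def mult_ac)
    finally show ?thesis .
  qed
  have pm [measurable]: "partial_density L N \<in> borel_measurable lebesgue"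
    unfolding partial_density_def[abs_def] by measurable
  have wm0: "0 \<le> wm m" for m using w_avg_pos[of j m] by (simp add: wm_def)
  have avg_le: "lr L r (\<lambda>l. fm l m) powr p / sm m powr (p - 1) \<le> leaf_avg j (input_density L) m" for m
    unfolding fm_def sm_def input_density_def[abs_def]
    by (intro lr_leaf_avg_le r L f_integrable \<Phi>[unfolded input_density_def[abs_def]])
  have \<Phi>m0: "0 \<le> leaf_avg j (input_density L) m" for m
    by (rule order_trans[OF _ avg_le]) simp
  have "(\<integral>\<^sup>+x. ennreal (partial_density L N x) * indicator (region j Q) x \<partial>lebesgue)
      = (\<Sum>m\<in>Q. ennreal (v * (lr L r (\<lambda>l. T l m) powr p * wm m)))"
    by (subst nn_integral_region[OF finQ]) (simp_all add: leafint)
  also have "\<dots> = ennreal (v * (\<Sum>m\<in>Q. lr L r (\<lambda>l. T l m) powr p * wm m))"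
    using v wm0 by (subst sum_ennreal) (auto simp: sum_distrib_left)
  also have "\<dots> \<le> ennreal (v * (K powr p * (\<Sum>m\<in>Q. leaf_avg j (input_density L) m)))"
  proof (intro ennreal_leI mult_left_mono)
    have "(\<Sum>m\<in>Q. lr L r (\<lambda>l. fm l m) powr p / sm m powr (p - 1)) \<le> (\<Sum>m\<in>Q. leaf_avg j (input_density L) m)"
      by (intro sum_mono avg_le)
    then have "C powr p * (\<Sum>m\<in>Q. lr L r (\<lambda>l. fm l m) powr p / sm m powr (p - 1))
        \<le> K powr p * (\<Sum>m\<in>Q. leaf_avg j (input_density L) m)"
      using CK C0 p by (intro mult_mono powr_mono2) (auto intro!: sum_nonneg)
    with main show "(\<Sum>m\<in>Q. lr L r (\<lambda>l. T l m) powr p * wm m) \<le> K powr p * (\<Sum>m\<in>Q. leaf_avg j (input_density L) m)"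
      by linarith
  qed (use v in auto)
  also have "\<dots> = ennreal (K powr p) * (\<Sum>m\<in>Q. ennreal (v * leaf_avg j (input_density L) m))"
    using v \<Phi>m0 by (subst sum_ennreal) (auto simp: ennreal_mult'[symmetric] sum_distrib_left[symmetric] mult_ac)
  also have "(\<Sum>m\<in>Q. ennreal (v * leaf_avg j (input_density L) m))
      = (\<integral>\<^sup>+x. ennreal (input_density L x) * indicator (region j Q) x \<partial>lebesgue)"
    unfolding v_def by (subst nn_integral_region[OF finQ]) (simp_all add: nn_integral_leaf[OF \<Phi> \<Phi>0])
  finally show ?thesis by (simp add: reg)
qed

text \<open>All cubes in the partial sum have side length at most \<open>2\<^sup>N\<close>, and so the cubes of that side length
  do not interact and their bounds add up.\<close>
lemma partial_bound:
  assumes L: "finite L" and fin: "(\<integral>\<^sup>+x. ennreal (input_density L x) \<partial>lebesgue) < \<infinity>"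
  shows "(\<integral>\<^sup>+x. ennreal (partial_density L N x) \<partial>lebesgue)
    \<le> ennreal (K powr p) * (\<integral>\<^sup>+x. ennreal (input_density L x) \<partial>lebesgue)"
proof -
  have [measurable]: "input_density L \<in> borel_measurable lebesgue" "partial_density L N \<in> borel_measurable lebesgue"
    unfolding input_density_def[abs_def] partial_density_def[abs_def] by measurable
  have "(\<integral>\<^sup>+x. ennreal (partial_density L N x) \<partial>lebesgue)
      = (\<integral>\<^sup>+M. (\<integral>\<^sup>+x. ennreal (partial_density L N x) * indicator (dyadic_cube (- int N) M) x \<partial>lebesgue) \<partial>count_space UNIV)"
    by (rule nn_integral_grid) measurable
  also have "\<dots> \<le> (\<integral>\<^sup>+M. ennreal (K powr p) * (\<integral>\<^sup>+x. ennreal (input_density L x) * indicator (dyadic_cube (- int N) M) x \<partial>lebesgue) \<partial>count_space UNIV)"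
    by (intro nn_integral_mono root_cube_bound L fin)
  also have "\<dots> = ennreal (K powr p) * (\<integral>\<^sup>+M. (\<integral>\<^sup>+x. ennreal (input_density L x) * indicator (dyadic_cube (- int N) M) x \<partial>lebesgue) \<partial>count_space UNIV)"
    by (rule nn_integral_cmult) simp
  also have "(\<integral>\<^sup>+M. (\<integral>\<^sup>+x. ennreal (input_density L x) * indicator (dyadic_cube (- int N) M) x \<partial>lebesgue) \<partial>count_space UNIV)
      = (\<integral>\<^sup>+x. ennreal (input_density L x) \<partial>lebesgue)"
    by (rule nn_integral_grid[symmetric]) measurable
  finally show ?thesis .
qed

end

text \<open>Convergence in measure on \<open>B\<close> is convergence of \<open>min 1 \<bar>d\<bar>\<close> in \<open>L\<^sup>1(B)\<close>. Summing over the finitely many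
  \<open>l\<close> makes one subsequence serve all of them.\<close>
lemma measure_limit_AE_subseq:
  fixes d :: "'l \<Rightarrow> nat \<Rightarrow> real^'n::finite \<Rightarrow> real"
  assumes L: "finite L" and B: "B \<in> sets lebesgue" "bounded B"
    and d: "\<And>l N. l \<in> L \<Longrightarrow> d l N \<in> borel_measurable lebesgue"
    and lim: "\<And>l \<epsilon>. l \<in> L \<Longrightarrow> 0 < \<epsilon> \<Longrightarrow> (\<lambda>N. emeasure lebesgue {x\<in>B. \<bar>d l N x\<bar> > \<epsilon>}) \<longlonglongrightarrow> 0"
  shows "\<exists>s. strict_mono s \<and> (AE x in lebesgue. x \<in> B \<longrightarrow> (\<forall>l\<in>L. (\<lambda>N. d l (s N) x) \<longlonglongrightarrow> 0))"
proof -
  note [measurable] = B(1)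
  have Bfin: "emeasure lebesgue B < \<infinity>"
    using bounded_set_imp_lmeasurable[OF B(2,1)] by (simp add: fmeasurable_def)
  define b where "b = measure lebesgue B"
  have emB: "emeasure lebesgue B = ennreal b"
    using Bfin by (simp add: b_def emeasure_eq_ennreal_measure)
  define u where "u N x = (\<Sum>l\<in>L. min 1 \<bar>d l N x\<bar>) * indicator B x" for N x
  have umeas: "u N \<in> borel_measurable lebesgue" for N
    unfolding u_def using d by (intro borel_measurable_times borel_measurable_sum borel_measurable_min borel_measurable_abs) auto
  have u0: "0 \<le> u N x" for N x by (auto simp: u_def intro!: sum_nonneg mult_nonneg_nonneg)
  have uint: "integrable lebesgue (u N)" for N
  proof (rule integrableI_bounded_set[where A = B and B = "real (card L)"])
    show "AE x\<in>B in lebesgue. norm (u N x) \<le> real (card L)"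
    proof (rule AE_I2, rule impI)
      fix x
      have "(\<Sum>l\<in>L. min 1 \<bar>d l N x\<bar>) \<le> (\<Sum>l\<in>L. 1)" by (intro sum_mono) auto
      moreover have "u N x \<le> (\<Sum>l\<in>L. min 1 \<bar>d l N x\<bar>)"
        unfolding u_def by (cases "x \<in> B") (auto intro: sum_nonneg)
      ultimately show "norm (u N x) \<le> real (card L)" using u0[of N x] by simp
    qed
  qed (use umeas Bfin in \<open>auto simp: u_def\<close>)
  have l_lim: "(\<lambda>N. \<integral>\<^sup>+x. ennreal (min 1 \<bar>d l N x\<bar>) * indicator B x \<partial>lebesgue) \<longlonglongrightarrow> 0" if l: "l \<in> L" for l
  proof (rule tendsto_0_if_Limsup_eq_0_ennreal, rule antisym)
    note [measurable] = d[OF l]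
    have "limsup (\<lambda>N. \<integral>\<^sup>+x. ennreal (min 1 \<bar>d l N x\<bar>) * indicator B x \<partial>lebesgue) \<le> 0 + ennreal e" if e: "0 < e" for e
    proof -
      \<comment> \<open>The truncated integrand is at most \<open>\<epsilon>\<close> outside the exceptional set; adding \<open>1\<close> avoids dividing by \<open>0\<close>.\<close>
      define \<epsilon> where "\<epsilon> = e / (b + 1)"
      have b0: "0 \<le> b" by (simp add: b_def)
      have \<epsilon>: "0 < \<epsilon>" "\<epsilon> * b \<le> e" using e b0 by (auto simp: \<epsilon>_def field_simps)
      have "(\<integral>\<^sup>+x. ennreal (min 1 \<bar>d l N x\<bar>) * indicator B x \<partial>lebesgue)
          \<le> ennreal e + emeasure lebesgue {x\<in>B. \<bar>d l N x\<bar> > \<epsilon>}" for N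
      proof -
        have "(\<integral>\<^sup>+x. ennreal (min 1 \<bar>d l N x\<bar>) * indicator B x \<partial>lebesgue)
            \<le> (\<integral>\<^sup>+x. ennreal \<epsilon> * indicator B x + indicator {x\<in>B. \<bar>d l N x\<bar> > \<epsilon>} x \<partial>lebesgue)"
        proof (rule nn_integral_mono)
          fix x
          show "ennreal (min 1 \<bar>d l N x\<bar>) * indicator B x \<le> ennreal \<epsilon> * indicator B x + indicator {x\<in>B. \<bar>d l N x\<bar> > \<epsilon>} x"
          proof (cases "x \<in> B \<and> \<bar>d l N x\<bar> > \<epsilon>")
            case True
            have "ennreal (min 1 \<bar>d l N x\<bar>) \<le> ennreal 1" by (rule ennreal_leI) simp
            also have "\<dots> \<le> ennreal \<epsilon> + 1" by simp
            finally show ?thesis using True by simp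
          next
            case False
            then show ?thesis by (cases "x \<in> B") (auto intro!: ennreal_leI)
          qed
        qed
        also have "\<dots> = ennreal \<epsilon> * ennreal b + emeasure lebesgue {x\<in>B. \<bar>d l N x\<bar> > \<epsilon>}"
          by (subst nn_integral_add) (auto simp: nn_integral_cmult_indicator emB)
        also have "ennreal \<epsilon> * ennreal b \<le> ennreal e"
          using \<epsilon> b0 by (simp add: ennreal_mult[symmetric] ennreal_leI)
        finally show ?thesis by (simp add: add_right_mono)
      qed
      then have "limsup (\<lambda>N. \<integral>\<^sup>+x. ennreal (min 1 \<bar>d l N x\<bar>) * indicator B x \<partial>lebesgue)
          \<le> limsup (\<lambda>N. ennreal e + emeasure lebesgue {x\<in>B. \<bar>d l N x\<bar> > \<epsilon>})"
        by (intro Limsup_mono) auto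
      also have "\<dots> = ennreal e + 0"
        by (intro lim_imp_Limsup tendsto_add tendsto_const lim[OF l \<epsilon>(1)]) auto
      finally show ?thesis by simp
    qed
    then show "limsup (\<lambda>N. \<integral>\<^sup>+x. ennreal (min 1 \<bar>d l N x\<bar>) * indicator B x \<partial>lebesgue) \<le> 0"
      by (rule ennreal_le_epsilon)
  qed simp
  have "(\<lambda>N. \<Sum>l\<in>L. \<integral>\<^sup>+x. ennreal (min 1 \<bar>d l N x\<bar>) * indicator B x \<partial>lebesgue) \<longlonglongrightarrow> (\<Sum>l\<in>L. 0)"
    by (intro tendsto_sum l_lim)
  moreover have "(\<Sum>l\<in>L. \<integral>\<^sup>+x. ennreal (min 1 \<bar>d l N x\<bar>) * indicator B x \<partial>lebesgue) = (\<integral>\<^sup>+x. ennreal (u N x) \<partial>lebesgue)" for N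
  proof -
    have "ennreal (u N x) = (\<Sum>l\<in>L. ennreal (min 1 \<bar>d l N x\<bar>) * indicator B x)" for x
      by (cases "x \<in> B") (simp_all add: u_def sum_ennreal)
    then show ?thesis using d by (simp add: nn_integral_sum)
  qed
  moreover have "(\<integral>\<^sup>+x. ennreal (u N x) \<partial>lebesgue) = ennreal (\<integral>x. norm (u N x) \<partial>lebesgue)" for N
    using uint u0 by (subst nn_integral_eq_integral) auto
  ultimately have "(\<lambda>N. ennreal (\<integral>x. norm (u N x) \<partial>lebesgue)) \<longlonglongrightarrow> ennreal 0" by simp
  then have "(\<lambda>N. \<integral>x. norm (u N x) \<partial>lebesgue) \<longlonglongrightarrow> 0"
    by (subst (asm) tendsto_ennreal_iff) (auto intro!: always_eventually integral_nonneg)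
  then obtain s where s: "strict_mono s" "AE x in lebesgue. (\<lambda>N. u (s N) x) \<longlonglongrightarrow> 0"
    using tendsto_L1_AE_subseq[of lebesgue u, OF uint] by blast
  have "AE x in lebesgue. x \<in> B \<longrightarrow> (\<forall>l\<in>L. (\<lambda>N. d l (s N) x) \<longlonglongrightarrow> 0)"
    using s(2)
  proof eventually_elim
    case (elim x)
    show ?case
    proof (intro impI ballI)
      fix l assume x: "x \<in> B" and l: "l \<in> L"
      have "(\<lambda>N. min 1 \<bar>d l (s N) x\<bar>) \<longlonglongrightarrow> 0"
      proof (rule tendsto_sandwich[OF _ _ tendsto_const elim])
        have "min 1 \<bar>d l (s N) x\<bar> \<le> u (s N) x" for N
          using x L l by (auto simp: u_def intro!: member_le_sum)
        then show "\<forall>\<^sub>F N in sequentially. min 1 \<bar>d l (s N) x\<bar> \<le> u (s N) x" by simp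
      qed simp
      then have "\<forall>\<^sub>F N in sequentially. min 1 \<bar>d l (s N) x\<bar> < min 1 e" if "0 < e" for e
        using that by (intro order_tendstoD) auto
      moreover have "\<bar>a\<bar> < e" if "min 1 \<bar>a\<bar> < min 1 e" for a e :: real
        using that by (auto simp: min_def split: if_splits)
      ultimately have "\<forall>\<^sub>F N in sequentially. \<bar>d l (s N) x\<bar> < e" if "0 < e" for e
        using that by (meson eventually_mono)
      then show "(\<lambda>N. d l (s N) x) \<longlonglongrightarrow> 0"
        by (simp add: tendsto_iff)
    qed
  qed
  with s(1) show ?thesis by blast
qed

lemma lr_tendsto:
  assumes "0 < r" "\<And>l. l \<in> L \<Longrightarrow> ((\<lambda>N. u N l) \<longlongrightarrow> v l) F"
  shows "((\<lambda>N. lr L r (u N)) \<longlongrightarrow> lr L r v) F"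
  unfolding lr_def using assms
  by (intro tendsto_powr' tendsto_sum tendsto_rabs tendsto_const) (auto intro!: always_eventually sum_nonneg)

context vector_shift
begin

text \<open>Fatou's lemma along an almost everywhere convergent subsequence, on balls exhausting the space.\<close>
lemma limit_bound:
  assumes L: "finite L" and fin: "(\<integral>\<^sup>+x. ennreal (input_density L x) \<partial>lebesgue) < \<infinity>"
    and g: "\<And>l. haar_value (h l) (k l) (f l) (g l)"
  shows "(\<integral>\<^sup>+x. ennreal (lr L r (\<lambda>l. g l x) powr p * w x) \<partial>lebesgue)
    \<le> ennreal (K powr p) * (\<integral>\<^sup>+x. ennreal (input_density L x) \<partial>lebesgue)"
proof -
  define G where "G x = lr L r (\<lambda>l. g l x) powr p * w x" for x
  define X where "X = ennreal (K powr p) * (\<integral>\<^sup>+x. ennreal (input_density L x) \<partial>lebesgue)"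
  have gm [measurable]: "g l \<in> borel_measurable lebesgue" for l using g by (simp add: haar_value_def)
  have Gm [measurable]: "G \<in> borel_measurable lebesgue" unfolding G_def[abs_def] by measurable
  have pm [measurable]: "partial_density L N \<in> borel_measurable lebesgue" for N
    unfolding partial_density_def[abs_def] by measurable
  have ball: "(\<integral>\<^sup>+x. ennreal (G x) * indicator (ball 0 (real R)) x \<partial>lebesgue) \<le> X" for R :: nat
  proof -
    define B where "B = (ball 0 (real R) :: (real^'n) set)"
    have B: "B \<in> sets lebesgue" "bounded B" by (auto simp: B_def)
    note [measurable] = B(1)
    have "\<exists>s. strict_mono s \<and> (AE x in lebesgue. x \<in> B \<longrightarrow>
        (\<forall>l\<in>L. (\<lambda>N. haar_partial (h l) (k l) (s N) (f l) x - g l x) \<longlonglongrightarrow> 0))"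
      using g B by (intro measure_limit_AE_subseq L) (auto simp: haar_value_def)
    then obtain s where s: "AE x in lebesgue. x \<in> B \<longrightarrow>
        (\<forall>l\<in>L. (\<lambda>N. haar_partial (h l) (k l) (s N) (f l) x - g l x) \<longlonglongrightarrow> 0)" by blast
    have "(\<integral>\<^sup>+x. ennreal (G x) * indicator B x \<partial>lebesgue)
        \<le> (\<integral>\<^sup>+x. liminf (\<lambda>N. ennreal (partial_density L (s N) x)) \<partial>lebesgue)"
    proof (rule nn_integral_mono_AE)
      show "AE x in lebesgue. ennreal (G x) * indicator B x \<le> liminf (\<lambda>N. ennreal (partial_density L (s N) x))"
        using s
      proof eventually_elim
        case (elim x)
        show ?case
        proof (cases "x \<in> B")
          case True
          have "(\<lambda>N. haar_partial (h l) (k l) (s N) (f l) x) \<longlonglongrightarrow> g l x" if "l \<in> L" for l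
            using elim True that by (simp add: LIM_zero_iff)
          then have "(\<lambda>N. lr L r (\<lambda>l. haar_partial (h l) (k l) (s N) (f l) x)) \<longlonglongrightarrow> lr L r (\<lambda>l. g l x)"
            using r by (intro lr_tendsto) auto
          then have "(\<lambda>N. partial_density L (s N) x) \<longlonglongrightarrow> G x"
            unfolding partial_density_def G_def using p
            by (intro tendsto_mult tendsto_powr' tendsto_const) (auto simp: lr_nonneg intro: always_eventually)
          then have "(\<lambda>N. ennreal (partial_density L (s N) x)) \<longlonglongrightarrow> ennreal (G x)"
            by (rule tendsto_ennrealI)
          then show ?thesis using True by (simp add: lim_imp_Liminf)
        qed simp
      qed
    qed
    also have "\<dots> \<le> liminf (\<lambda>N. \<integral>\<^sup>+x. ennreal (partial_density L (s N) x) \<partial>lebesgue)"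
      by (rule nn_integral_liminf) measurable
    also have "\<dots> \<le> liminf (\<lambda>N. X)"
      unfolding X_def by (intro Liminf_mono always_eventually allI partial_bound L fin)
    also have "\<dots> = X" by (simp add: Liminf_const)
    finally show ?thesis by (simp add: B_def)
  qed
  have "ennreal (G x) = (SUP R. ennreal (G x) * indicator (ball 0 (real R)) x)" for x
  proof (rule antisym)
    obtain R where "norm x < real R" using reals_Archimedean2 by blast
    then show "ennreal (G x) \<le> (SUP R. ennreal (G x) * indicator (ball 0 (real R)) x)"
      by (intro SUP_upper2[of R]) auto
    show "(SUP R. ennreal (G x) * indicator (ball 0 (real R)) x) \<le> ennreal (G x)"
      by (intro SUP_least) (auto simp: indicator_def)
  qed
  then have "(\<integral>\<^sup>+x. ennreal (G x) \<partial>lebesgue) = (\<integral>\<^sup>+x. (SUP R. ennreal (G x) * indicator (ball 0 (real R)) x) \<partial>lebesgue)"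
    by simp
  also have "\<dots> = (SUP R. \<integral>\<^sup>+x. ennreal (G x) * indicator (ball 0 (real R)) x \<partial>lebesgue)"
  proof (rule nn_integral_monotone_convergence_SUP)
    have [measurable]: "ball 0 (real R) \<in> sets (lebesgue :: (real^'n) measure)" for R by simp
    show "(\<lambda>x. ennreal (G x) * indicator (ball 0 (real R)) x) \<in> borel_measurable lebesgue" for R
      by measurable
    show "incseq (\<lambda>R x. ennreal (G x) * indicator (ball 0 (real R)) x)"
      by (auto simp: incseq_def le_fun_def indicator_def)
  qed
  also have "\<dots> \<le> X" by (intro SUP_least ball)
  finally show ?thesis by (simp add: G_def X_def)
qed

end

lemma ennpow_SUP:
  fixes S :: "nat \<Rightarrow> ennreal"
  assumes "0 < a"
  shows "ennpow (SUP J. S J) a = (SUP J. ennpow (S J) a)"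
proof (rule antisym)
  have "S J \<le> ennpow (SUP J. ennpow (S J) a) (1 / a)" for J
    using assms by (subst ennpow_le_iff[symmetric]) (auto intro: SUP_upper)
  then show "ennpow (SUP J. S J) a \<le> (SUP J. ennpow (S J) a)"
    using assms by (subst ennpow_le_iff) (auto intro: SUP_least)
  show "(SUP J. ennpow (S J) a) \<le> ennpow (SUP J. S J) a"
    using assms by (intro SUP_least ennpow_mono SUP_upper) auto
qed

lemma ennpow_lr_norm_SUP:
  assumes r: "0 < r" and p: "0 < p"
  shows "ennpow (lr_norm r a) p = (SUP J. ennreal (lr {..<J} r a powr p))"
proof -
  have "ennpow (lr_norm r a) p = ennpow (\<Sum>j. ennreal (\<bar>a j\<bar> powr r)) (p / r)"
    using r p by (simp add: lr_norm_def ennpow_ennpow)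
  also have "(\<Sum>j. ennreal (\<bar>a j\<bar> powr r)) = (SUP J. ennreal (\<Sum>j<J. \<bar>a j\<bar> powr r))"
    by (simp add: suminf_eq_SUP sum_ennreal)
  also have "ennpow \<dots> (p / r) = (SUP J. ennreal (lr {..<J} r a powr p))"
    using r p by (simp add: ennpow_SUP ennpow_ennreal sum_nonneg lr_def powr_powr)
  finally show ?thesis .
qed

theorem theorem1p5:
  fixes p r :: real
  assumes "1 < p" and "1 < r"
  shows "\<exists>C>0. \<forall>\<kappa>\<ge>1. \<forall>h k :: nat \<Rightarrow> 'n::finite cube_family. \<forall>w\<in>Ap_weights p.
           (\<forall>j. generalized_haar_shift \<kappa> (h j) (k j)) \<longrightarrow>
           vector_haar_norm p r w h k
             \<le> ennreal (C * real \<kappa> ^ 4) * ennpow (Ap_char p w) (max 1 (1 / (p - 1)))"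
proof (intro exI conjI allI impI ballI)
  define C where "C = shift_const p r (2 ^ CARD('n))"
  show C: "0 < C" unfolding C_def by (rule shift_const_pos[OF assms]) simp
  fix \<kappa> :: nat and h k :: "nat \<Rightarrow> 'n cube_family" and w :: "real^'n \<Rightarrow> real"
  assume \<kappa>: "1 \<le> \<kappa>" and w: "w \<in> Ap_weights p"
    and shift: "\<forall>j. generalized_haar_shift \<kappa> (h j) (k j)"
  interpret Ap_weight p w by standard (use assms w in auto)
  define A where "A = ennreal (C * real \<kappa> ^ 4) * ennpow (Ap_char p w) (max 1 (1 / (p - 1)))"
  have "Lp_norm p w F \<le> A * Lp_lr_norm p r w f"
    if f: "f \<in> Lp_lr p r w" and F: "vector_haar_value r h k f F" for f F
  proof -
    obtain g where loc: "\<And>l. locally_integrable (f l)" and g: "\<And>l. haar_value (h l) (k l) (f l) (g l)"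
      and F: "F = (\<lambda>x. lr_norm r (\<lambda>l. g l x))"
      using F by (auto simp: vector_haar_value_def)
    interpret vector_shift p w r \<kappa> h k f
      by standard (use assms \<kappa> shift loc in auto)
    have gm [measurable]: "g l \<in> borel_measurable lebesgue" for l using g by (simp add: haar_value_def)
    define X where "X = (\<integral>\<^sup>+x. ennpow (lr_norm r (\<lambda>l. f l x)) p * ennreal (w x) \<partial>lebesgue)"
    have fX: "Lp_lr_norm p r w f = ennpow X (1 / p)"
      by (simp add: Lp_lr_norm_def Lp_norm_def X_def)
    have "Lp_lr_norm p r w f < \<infinity>" using f by (simp add: Lp_lr_def)
    then have Xfin: "X < \<infinity>" unfolding fX by (cases "X = \<infinity>") (auto simp: top.not_eq_extremum)
    have dens: "ennreal (input_density {..<J} x) \<le> ennpow (lr_norm r (\<lambda>l. f l x)) p * ennreal (w x)" for J x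
      unfolding input_density_def using assms
      by (subst ennpow_lr_norm_SUP) (auto simp: ennreal_mult' intro!: mult_right_mono SUP_upper)
    have densX: "(\<integral>\<^sup>+x. ennreal (input_density {..<J} x) \<partial>lebesgue) \<le> X" for J
      unfolding X_def by (intro nn_integral_mono dens)
    have "(\<integral>\<^sup>+x. ennpow (F x) p * ennreal (w x) \<partial>lebesgue)
        = (\<integral>\<^sup>+x. (SUP J. ennreal (lr {..<J} r (\<lambda>l. g l x) powr p * w x)) \<partial>lebesgue)"
      using assms by (simp add: F ennpow_lr_norm_SUP SUP_mult_right_ennreal ennreal_mult')
    also have "\<dots> = (SUP J. \<integral>\<^sup>+x. ennreal (lr {..<J} r (\<lambda>l. g l x) powr p * w x) \<partial>lebesgue)"
    proof (rule nn_integral_monotone_convergence_SUP)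
      show "incseq (\<lambda>J x. ennreal (lr {..<J} r (\<lambda>l. g l x) powr p * w x))"
        unfolding incseq_def le_fun_def
      proof (intro allI impI)
        fix J J' :: nat and x assume J: "J \<le> J'"
        have "lr {..<J} r (\<lambda>l. g l x) \<le> lr {..<J'} r (\<lambda>l. g l x)"
          unfolding lr_def using J assms by (intro powr_mono2 sum_mono2) (auto intro: sum_nonneg)
        then have "lr {..<J} r (\<lambda>l. g l x) powr p \<le> lr {..<J'} r (\<lambda>l. g l x) powr p"
          using assms by (intro powr_mono2) (auto simp: lr_nonneg)
        then show "ennreal (lr {..<J} r (\<lambda>l. g l x) powr p * w x) \<le> ennreal (lr {..<J'} r (\<lambda>l. g l x) powr p * w x)"
          by (simp add: ennreal_mult' mult_right_mono ennreal_leI)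
      qed
    qed measurable
    also have "\<dots> \<le> ennreal (K powr p) * X"
    proof (rule SUP_least)
      fix J
      have "(\<integral>\<^sup>+x. ennreal (lr {..<J} r (\<lambda>l. g l x) powr p * w x) \<partial>lebesgue)
          \<le> ennreal (K powr p) * (\<integral>\<^sup>+x. ennreal (input_density {..<J} x) \<partial>lebesgue)"
        using densX[of J] Xfin g by (intro limit_bound) auto
      also have "\<dots> \<le> ennreal (K powr p) * X" by (intro mult_left_mono densX) simp
      finally show "(\<integral>\<^sup>+x. ennreal (lr {..<J} r (\<lambda>l. g l x) powr p * w x) \<partial>lebesgue) \<le> ennreal (K powr p) * X" .
    qed
    finally have "Lp_norm p w F \<le> ennpow (ennreal (K powr p) * X) (1 / p)"
      unfolding Lp_norm_def using assms by (intro ennpow_mono) auto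
    also have "\<dots> = ennreal K * ennpow X (1 / p)"
      using assms K_pos Xfin
      by (cases X) (auto simp: ennreal_mult[symmetric] ennpow_ennreal powr_mult powr_powr)
    also have "ennreal K \<le> A"
    proof -
      have "real \<kappa> \<le> real \<kappa> ^ 4" using \<kappa> self_le_power[of "real \<kappa>" 4] by simp
      then have "K \<le> C * real \<kappa> ^ 4 * char_real powr (max 1 (1 / (p - 1)))"
        unfolding K_def C_def[symmetric] using C by (intro mult_right_mono mult_left_mono) auto
      then have "ennreal K \<le> ennreal (C * real \<kappa> ^ 4 * char_real powr (max 1 (1 / (p - 1))))"
        by (rule ennreal_leI)
      also have "\<dots> = A"
        using C char_real_ge_1 by (simp add: A_def Ap_char_eq ennpow_ennreal ennreal_mult)
      finally show ?thesis .
    qed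
    finally show ?thesis by (simp add: fX mult_right_mono)
  qed
  then show "vector_haar_norm p r w h k \<le> A"
    unfolding vector_haar_norm_def by (intro Inf_lower) auto
qed

end
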